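(* Let $\alpha>0$, let $Q=I\times B$ be an $\alpha$-parabolic cylinder of radius $r$, let $\rho\in L^1(Q)$ with $\rho\ge0$ and $\|\rho\|_\infty\le c_0|Q|^{-1}\|\rho\|_1$, and let $a\in L^1(I;W^{1,1}(B))$. Then $$\frac1{|Q|}\int_Q\Big|\frac{a-\langle a\rangle_\rho}{r}\Big|\,dz\le c\,\frac1{|Q|}\int_Q|\nabla a|\,dz+c\,\alpha\,\mathcal{N}_Q(\partial_t a),$$ with $c$ depending only on $m$ and $c_0$.
   Context: An $\alpha$-parabolic cylinder of radius $r$ is $Q=(t_0-\alpha r^2,t_0+\alpha r^2)\times B_r(x_0)$; $\nabla$ is the spatial gradient. $\langle a\rangle_\rho:=\frac1{\|\rho\|_1}\int_Q a\rho\,dz$. $\mathcal{F}_Q:=\{\xi\in C^\infty_0(Q):\|\xi\|_\infty+r\|\nabla\xi\|_\infty+\alpha r^2\|\partial_t\xi\|_\infty\le1\}$ and for a distribution $b\in\mathcal{D}'(Q)$, $\mathcal{N}_Q(b):=\sup_{\xi\in\mathcal{F}_Q}r|Q|^{-1}|\langle b,\xi\rangle|$ (possibly $+\infty$); here $\langle\partial_t a,\xi\rangle=-\int_Q a\,\partial_t\xi$. *)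

theory Defs
  imports "HOL-Analysis.Analysis"
begin

fun iter_deriv :: "('a::real_normed_vector \<Rightarrow> real) \<Rightarrow> 'a list \<Rightarrow> 'a \<Rightarrow> real" where
  "iter_deriv f [] = f"
| "iter_deriv f (v # vs) = (\<lambda>x. frechet_derivative (iter_deriv f vs) (at x) v)"

definition smooth :: "('a::real_normed_vector \<Rightarrow> real) \<Rightarrow> bool" where
  "smooth f \<longleftrightarrow> (\<forall>vs x. iter_deriv f vs differentiable (at x))"

definition test_fun :: "'a::euclidean_space set \<Rightarrow> ('a \<Rightarrow> real) \<Rightarrow> bool" where
  "test_fun U f \<longleftrightarrow> smooth f \<and> (\<exists>K. compact K \<and> K \<subseteq> U \<and> (\<forall>x. x \<notin> K \<longrightarrow> f x = 0))"

definition par_cyl :: "real \<Rightarrow> real \<Rightarrow> real \<Rightarrow> 'a::euclidean_space \<Rightarrow> (real \<times> 'a) set" where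
  "par_cyl \<alpha> r t0 x0 = {t0 - \<alpha> * r\<^sup>2 <..< t0 + \<alpha> * r\<^sup>2} \<times> ball x0 r"

definition dt :: "(real \<times> 'a::euclidean_space \<Rightarrow> real) \<Rightarrow> real \<times> 'a \<Rightarrow> real" where
  "dt \<xi> z = frechet_derivative \<xi> (at z) (1, 0)"

definition grad_x :: "(real \<times> 'a::euclidean_space \<Rightarrow> real) \<Rightarrow> real \<times> 'a \<Rightarrow> 'a" where
  "grad_x \<xi> z = (\<Sum>i\<in>Basis. frechet_derivative \<xi> (at z) (0, i) *\<^sub>R i)"

definition supn :: "('b \<Rightarrow> 'c::real_normed_vector) \<Rightarrow> ereal" where
  "supn f = (SUP z. ereal (norm (f z)))"

definition FQ :: "real \<Rightarrow> real \<Rightarrow> real \<Rightarrow> 'a::euclidean_space \<Rightarrow> (real \<times> 'a \<Rightarrow> real) set" where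
  "FQ \<alpha> r t0 x0 = {\<xi>. test_fun (par_cyl \<alpha> r t0 x0) \<xi> \<and>
      supn \<xi> + ereal r * supn (grad_x \<xi>) + ereal (\<alpha> * r\<^sup>2) * supn (dt \<xi>) \<le> 1}"

text \<open>N_Q(partial_t a) = sup over F_Q of r |Q|^{-1} |<partial_t a, xi>|, with
  <partial_t a, xi> = - int_Q a partial_t xi.\<close>
definition NQ_dt :: "real \<Rightarrow> real \<Rightarrow> real \<Rightarrow> 'a::euclidean_space \<Rightarrow> (real \<times> 'a \<Rightarrow> real) \<Rightarrow> ereal" where
  "NQ_dt \<alpha> r t0 x0 a = (SUP \<xi>\<in>FQ \<alpha> r t0 x0.
      ereal (r / measure lebesgue (par_cyl \<alpha> r t0 x0) *
        \<bar>- (LINT z:par_cyl \<alpha> r t0 x0|lebesgue. a z * dt \<xi> z)\<bar>))"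

definition wmean :: "(real \<times> 'a::euclidean_space) set \<Rightarrow> (real \<times> 'a \<Rightarrow> real) \<Rightarrow> (real \<times> 'a \<Rightarrow> real) \<Rightarrow> real" where
  "wmean Q \<rho> a = (LINT z:Q|lebesgue. a z * \<rho> z) / (LINT z:Q|lebesgue. \<rho> z)"

definition L1_W11 :: "real set \<Rightarrow> 'a::euclidean_space set \<Rightarrow> (real \<times> 'a \<Rightarrow> real) \<Rightarrow> (real \<times> 'a \<Rightarrow> 'a) \<Rightarrow> bool" where
  "L1_W11 I B a g \<longleftrightarrow>
     set_integrable lebesgue (I \<times> B) a \<and> set_integrable lebesgue (I \<times> B) g \<and>
     (AE t in lebesgue. t \<in> I \<longrightarrow>
        set_integrable lebesgue B (\<lambda>x. a (t, x)) \<and> set_integrable lebesgue B (\<lambda>x. g (t, x)) \<and>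
        (\<forall>\<phi>. test_fun B \<phi> \<longrightarrow> (\<forall>i\<in>Basis.
           (LINT x:B|lebesgue. a (t, x) * frechet_derivative \<phi> (at x) i)
           = - (LINT x:B|lebesgue. \<phi> x * (g (t, x) \<bullet> i)))))"

end

theory Submission
  imports Defs
begin

text \<open>
  By duality, the $L^1$ norm of a function on a ball is a supremum of pairings with test functions,
  so \<open>a\<close> itself never has to be regularised; mollifying the other factor shows that \<open>C\<^sup>1\<close> functions of
  compact support are admissible both in the weak gradient identity and in the definition of the
  seminorm of the time derivative.

  In space, for \<open>y\<close> in the ball \<open>B\<close>, pairing \<open>u(x) - u((x+y)/2)\<close> with \<open>\<psi>\<close> amounts to pairing \<open>u\<close> with
  \<open>\<psi>(z) - 2\<^sup>n \<psi>(2z-y)\<close>, which is the divergence of the explicit field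
  \<open>-(z-y) \<integral>\<^sub>1\<^sup>2 s\<^sup>n\<^sup>-\<^sup>1 \<psi>(y+s(z-y)) ds\<close>, compactly supported in \<open>B\<close>. Integrating in \<open>y\<close> and comparing \<open>u(x)\<close> and
  \<open>u(y)\<close> with the value at the midpoint gives the Poincare inequality on almost every time slice.

  In time, let \<open>m(t)\<close> be the average of \<open>a(t, \<cdot>)\<close> against a fixed cutoff \<open>\<eta>\<close>. Testing \<open>\<partial>\<^sub>t a\<close> with
  \<open>\<theta>(t) \<eta>(x)\<close>, where \<open>\<theta>'\<close> is an arbitrary bounded function corrected to have mean zero, bounds the
  oscillation of \<open>m\<close>. Finally, replacing the resulting constant by the \<open>\<rho>\<close>-mean of \<open>a\<close> costs a factor
  \<open>1 + c\<^sub>0\<close>.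
\<close>

section \<open>Smooth functions and mollification\<close>

text \<open>\<open>smooth\<close> asks for every iterated derivative, which is laborious to verify
  for an explicit formula. The explicit objects (the dilation field, the cutoff, the primitive in
  time) are therefore kept merely C1, with computable bounds, and the smooth test functions close to
  them come from convolution with a single smooth kernel.

  Origin of the factor \<alpha>: with \<open>h = \<alpha> * r\<^sup>2\<close>, the primitive of a
  mean-zero function bounded by S on an interval of length 2h is at most 2hS. All three terms of the
  norm in \<open>FQ\<close> are then of order hS, because r times the gradient of the cutoff is
  bounded. The seminorm N thus contributes a multiple of |Q| h N / r = |Q| \<alpha> r N, and
  division by r |Q| leaves \<alpha> N.

  Measurability: \<open>a\<close> is only Lebesgue measurable on the product, whereas slicing is
  done for product measures, so Fubini is applied to a Borel version vanishing outside the cylinder.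
  The spatial estimate is an extended nonnegative double integral, which makes the exchange of
  variables a matter of measurability alone.\<close>

lemma smooth_coinduct:
  assumes "f \<in> S"
    and diff: "\<And>f x. f \<in> S \<Longrightarrow> f differentiable (at x)"
    and deriv: "\<And>f v. f \<in> S \<Longrightarrow> (\<lambda>x. frechet_derivative f (at x) v) \<in> S"
  shows "smooth f"
proof -
  \<comment> \<open>The head of the list is differentiated last, so each induction step
    differentiates a function already known to lie in \<open>S\<close>.\<close>
  have "iter_deriv f vs \<in> S" for vs
    by (induction vs) (auto simp: assms(1) deriv)
  then show ?thesis
    using diff by (simp add: smooth_def)
qed

lemma smooth_frechet_derivative:
  assumes "smooth f"
  shows "smooth (\<lambda>x. frechet_derivative f (at x) v)"
proof -
  \<comment> \<open>The last direction in the list is the one applied first, hence \<open>v\<close>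
    is appended at the end.\<close>
  have "iter_deriv (\<lambda>x. frechet_derivative f (at x) v) vs = iter_deriv f (vs @ [v])" for vs
    by (induction vs) auto
  then show ?thesis
    using assms unfolding smooth_def by metis
qed

lemma smooth_has_derivative:
  assumes "smooth f"
  shows "(f has_derivative frechet_derivative f (at x)) (at x)"
  using assms frechet_derivative_works[of f "at x"] unfolding smooth_def
  by (metis iter_deriv.simps(1))

lemma smooth_continuous_on:
  assumes "smooth f"
  shows "continuous_on A f"
  by (meson assms has_derivative_continuous continuous_at_imp_continuous_on smooth_has_derivative)

lemma smooth_0: "smooth (\<lambda>x. 0)"
  by (rule smooth_coinduct[where S = "{\<lambda>x. 0}"]) (auto simp: frechet_derivative_const)

lemma smooth_cmult:
  assumes "smooth f"
  shows "smooth (\<lambda>x. c * f x)"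
proof (rule smooth_coinduct[where S = "{\<lambda>x. c * g x | g. smooth g}"])
  have D: "((\<lambda>x. c * g x) has_derivative (\<lambda>v. c * frechet_derivative g (at x) v)) (at x)"
    if "smooth g" for g :: "'a \<Rightarrow> real" and x
    by (intro has_derivative_mult_right smooth_has_derivative that)
  show "f differentiable at x" if "f \<in> {\<lambda>x. c * g x | g. smooth g}" for f :: "'a \<Rightarrow> real" and x
    using that D by (auto simp: differentiable_def)
  fix f :: "'a \<Rightarrow> real" and v
  assume "f \<in> {\<lambda>x. c * g x | g. smooth g}"
  then obtain g where g: "f = (\<lambda>x. c * g x)" "smooth g" by auto
  have "(\<lambda>x. frechet_derivative f (at x) v) = (\<lambda>x. c * frechet_derivative g (at x) v)"
    using frechet_derivative_at[OF D[OF g(2)]] unfolding g(1) by metis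
  then show "(\<lambda>x. frechet_derivative f (at x) v) \<in> {\<lambda>x. c * g x | g. smooth g}"
    using smooth_frechet_derivative[OF g(2)] by auto
qed (use assms in auto)

text \<open>The Leibniz rule wants a derivative that is continuous in operator norm. In finite
  dimension this follows from continuity on each basis vector, which is the form in which the
  hypothesis is easy to check. It serves convolutions as well as the dilation integral in the
  Poincare argument.\<close>

lemma has_derivative_integral_parameter:
  fixes f :: "'a::euclidean_space \<Rightarrow> 'b::euclidean_space \<Rightarrow> real"
  assumes D: "\<And>x t. ((\<lambda>x. f x t) has_derivative D x t) (at x)"
    and cont_D: "\<And>v. v \<in> Basis \<Longrightarrow> continuous_on UNIV (\<lambda>(x, t). D x t v)"
    and cont_f: "\<And>x. continuous_on (cbox a b) (f x)"
  shows "((\<lambda>x. integral (cbox a b) (f x)) has_derivative (\<lambda>v. integral (cbox a b) (\<lambda>t. D x t v))) (at x)"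
proof -
  have bl: "bounded_linear (D x t)" for x t
    using D by (rule has_derivative_bounded_linear)
  have ap: "blinfun_apply (Blinfun (D x t)) = D x t" for x t
    by (rule bounded_linear_Blinfun_apply[OF bl])
  have cont: "continuous_on UNIV (\<lambda>(x, t). Blinfun (D x t))"
    unfolding continuous_on_eq_continuous_within
  proof
    fix z :: "'a \<times> 'b"
    show "isCont (\<lambda>(x, t). Blinfun (D x t)) z"
    proof (rule continuous_blinfun_componentwiseI1)
      fix i :: 'a assume "i \<in> Basis"
      then have "isCont (\<lambda>(x, t). D x t i) z"
        using cont_D unfolding continuous_on_eq_continuous_within by blast
      then show "isCont (\<lambda>x. blinfun_apply (case x of (x, t) \<Rightarrow> Blinfun (D x t)) i) z"
        by (simp add: case_prod_beta' ap)
    qed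
  qed
  have "((\<lambda>x. integral (cbox a b) (f x)) has_derivative
     blinfun_apply (integral (cbox a b) (\<lambda>t. Blinfun (D x t)))) (at x within UNIV)"
  proof (rule leibniz_rule)
    show "continuous_on (UNIV \<times> cbox a b) (\<lambda>(x, t). Blinfun (D x t))"
      using cont continuous_on_subset by blast
  qed (use D cont_f in \<open>auto simp: ap intro: integrable_continuous\<close>)
  moreover have "(\<lambda>t. Blinfun (D x t)) integrable_on cbox a b"
    using continuous_on_compose2[OF cont, of "cbox a b" "Pair x"]
    by (intro integrable_continuous) (auto simp: continuous_on_Pair)
  then have "blinfun_apply (integral (cbox a b) (\<lambda>t. Blinfun (D x t)))
      = (\<lambda>v. integral (cbox a b) (\<lambda>t. D x t v))"
    by (intro ext) (simp add: blinfun_apply_integral ap)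
  ultimately show ?thesis
    by simp
qed

section \<open>A smooth bump function built from exp(-1/s)\<close>

definition inv_exp :: "nat \<Rightarrow> real \<Rightarrow> real" where
  "inv_exp k s = (if s > 0 then exp (- 1 / s) / s ^ k else 0)"

lemma power_div_fact_le_exp:
  fixes x :: real
  assumes "x \<ge> 0"
  shows "x ^ n / fact n \<le> exp x"
proof -
  have "(\<Sum>i\<in>{n}. x ^ i /\<^sub>R fact i) \<le> exp x"
    unfolding exp_def by (rule sum_le_suminf[OF summable_exp_generic]) (use assms in auto)
  then show ?thesis by (simp add: divide_inverse mult.commute)
qed

text \<open>The term of order k + 2 of the exponential series at 1/s dominates \<open>s ^ k\<close>
  with two powers to spare. Quadratic decay at 0 is what makes the difference quotient there tend to
  0.\<close>

lemma inv_exp_le: "\<bar>inv_exp k s\<bar> \<le> fact (k + 2) * s\<^sup>2"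
proof (cases "s > 0")
  case True
  have "(1 / s) ^ (k + 2) / fact (k + 2) \<le> exp (1 / s)"
    by (rule power_div_fact_le_exp) (use True in auto)
  then have "1 \<le> fact (k + 2) * s ^ (k + 2) * exp (1 / s)"
    using True by (simp add: power_one_over divide_simps del: fact_Suc power_Suc)
      (simp add: mult_ac del: fact_Suc power_Suc)
  then have "exp (- (1 / s)) \<le> fact (k + 2) * s ^ (k + 2)"
    by (simp add: exp_minus divide_simps mult_ac del: fact_Suc power_Suc)
  then have "exp (- (1 / s)) / s ^ k \<le> fact (k + 2) * s\<^sup>2"
    using True unfolding power_add by (simp add: divide_simps mult_ac del: fact_Suc power_Suc)
  then show ?thesis using True by (simp add: inv_exp_def)
qed (simp add: inv_exp_def)

text \<open>Differentiating exp(-1/s) / s^k gives members of the same family with exponents k + 2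
  and k + 1, which is why the family is indexed by k. Only the point 0 requires the decay
  estimate.\<close>

lemma inv_exp_has_real_derivative:
  "(inv_exp k has_real_derivative inv_exp (k + 2) s - real k * inv_exp (k + 1) s) (at s)"
proof -
  consider "s > 0" | "s < 0" | "s = 0" by linarith
  then show ?thesis
  proof cases
    case 1
    have "((\<lambda>s. exp (- 1 / s) / s ^ k) has_real_derivative
        inv_exp (k + 2) s - real k * inv_exp (k + 1) s) (at s)"
    proof (cases k)
      case (Suc n)
      have "s ^ (k - 1) = s ^ k / s" "s ^ (k + 1) = s ^ k * s" "s ^ (k + 2) = s ^ k * s * s"
        using 1 Suc by (auto simp: power_add power2_eq_square)
      with 1 show ?thesis
        by (auto intro!: derivative_eq_intros simp: inv_exp_def field_simps power2_eq_square)
    qed (use 1 in \<open>auto intro!: derivative_eq_intros simp: inv_exp_def field_simps power2_eq_square\<close>)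
    then show ?thesis
      by (rule has_field_derivative_transform_within_open[where S = "{0<..}"])
        (use 1 in \<open>auto simp: inv_exp_def\<close>)
  next
    case 2
    have "((\<lambda>s. 0) has_real_derivative inv_exp (k + 2) s - real k * inv_exp (k + 1) s) (at s)"
      using 2 by (simp add: inv_exp_def)
    then show ?thesis
      by (rule has_field_derivative_transform_within_open[where S = "{..<0}"])
        (use 2 in \<open>auto simp: inv_exp_def\<close>)
  next
    case 3
    have "((\<lambda>h. inv_exp k h / h) \<longlongrightarrow> 0) (at 0)"
    proof (rule Lim_null_comparison)
      show "\<forall>\<^sub>F h in at 0. norm (inv_exp k h / h) \<le> fact (k + 2) * \<bar>h\<bar>"
      proof (intro always_eventually allI)
        fix h :: real
        show "norm (inv_exp k h / h) \<le> fact (k + 2) * \<bar>h\<bar>"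
          using inv_exp_le[of k h] unfolding power2_eq_square abs_mult_self_eq[of h, symmetric]
          by (auto simp: divide_simps mult.assoc simp del: fact_Suc abs_mult_self_eq)
      qed
      show "((\<lambda>h. fact (k + 2) * \<bar>h\<bar>) \<longlongrightarrow> 0) (at (0::real))"
        by (auto intro!: tendsto_eq_intros)
    qed
    then show ?thesis
      by (simp add: 3 has_field_derivative_iff inv_exp_def)
  qed
qed

text \<open>The smallest convenient class closed under directional derivatives: the inner derivative
  of \<open>d\<^sup>2 - x \<bullet> x\<close> in direction v is a multiple of the linear functional
  \<open>x \<bullet> v\<close>, so linear factors, scalars and sums suffice.\<close>

inductive_set bump_algebra :: "real \<Rightarrow> ('a::euclidean_space \<Rightarrow> real) set" for d where
  base: "(\<lambda>x. inv_exp k (d\<^sup>2 - x \<bullet> x)) \<in> bump_algebra d"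
| times_linear: "f \<in> bump_algebra d \<Longrightarrow> (\<lambda>x. (x \<bullet> v) * f x) \<in> bump_algebra d"
| scale: "f \<in> bump_algebra d \<Longrightarrow> (\<lambda>x. c * f x) \<in> bump_algebra d"
| add: "f \<in> bump_algebra d \<Longrightarrow> g \<in> bump_algebra d \<Longrightarrow> (\<lambda>x. f x + g x) \<in> bump_algebra d"

lemma bump_algebra_has_derivative:
  assumes "f \<in> bump_algebra d"
  shows "\<exists>D. (\<forall>x. (f has_derivative (\<lambda>v. D v x)) (at x)) \<and> (\<forall>v. D v \<in> bump_algebra d)"
  using assms
proof induction
  case (base k)
  let ?q = "\<lambda>x::'a. d\<^sup>2 - x \<bullet> x"
  let ?D = "\<lambda>v x. (x \<bullet> v) * (- 2 * (inv_exp (k + 2) (?q x) + (- real k) * inv_exp (k + 1) (?q x)))"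
  have "((\<lambda>x. inv_exp k (?q x)) has_derivative (\<lambda>v. ?D v x)) (at x)" for x
  proof -
    have q: "(?q has_derivative (\<lambda>v. - 2 * (x \<bullet> v))) (at x)"
      by (auto intro!: derivative_eq_intros simp: inner_commute)
    show ?thesis
      by (rule has_derivative_eq_rhs[OF has_derivative_compose[OF q
              inv_exp_has_real_derivative[unfolded has_field_derivative_def]]])
        (auto simp: algebra_simps)
  qed
  moreover have "?D v \<in> bump_algebra d" for v
    by (intro bump_algebra.intros)
  ultimately show ?case by (intro exI[of _ ?D]) blast
next
  case (times_linear f w)
  then obtain D where D: "\<And>x. (f has_derivative (\<lambda>v. D v x)) (at x)" "\<And>v. D v \<in> bump_algebra d"
    by auto
  let ?D = "\<lambda>v x. (x \<bullet> w) * D v x + (v \<bullet> w) * f x"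
  have "((\<lambda>x. (x \<bullet> w) * f x) has_derivative (\<lambda>v. ?D v x)) (at x)" for x
    by (auto intro!: derivative_eq_intros D)
  moreover have "?D v \<in> bump_algebra d" for v
    by (intro bump_algebra.intros D times_linear)
  ultimately show ?case by (intro exI[of _ ?D]) blast
next
  case (scale f c)
  then obtain D where D: "\<And>x. (f has_derivative (\<lambda>v. D v x)) (at x)" "\<And>v. D v \<in> bump_algebra d"
    by auto
  let ?D = "\<lambda>v x. c * D v x"
  have "((\<lambda>x. c * f x) has_derivative (\<lambda>v. ?D v x)) (at x)" for x
    by (auto intro!: derivative_eq_intros D)
  moreover have "?D v \<in> bump_algebra d" for v
    by (intro bump_algebra.intros D)
  ultimately show ?case by (intro exI[of _ ?D]) blast
next
  case (add f g)
  then obtain D D' where D: "\<And>x. (f has_derivative (\<lambda>v. D v x)) (at x)" "\<And>v. D v \<in> bump_algebra d"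
      "\<And>x. (g has_derivative (\<lambda>v. D' v x)) (at x)" "\<And>v. D' v \<in> bump_algebra d"
    by auto
  let ?D = "\<lambda>v x. D v x + D' v x"
  have "((\<lambda>x. f x + g x) has_derivative (\<lambda>v. ?D v x)) (at x)" for x
    by (auto intro!: derivative_eq_intros D)
  moreover have "?D v \<in> bump_algebra d" for v
    by (intro bump_algebra.intros D)
  ultimately show ?case by (intro exI[of _ ?D]) blast
qed

lemma bump_algebra_smooth:
  assumes "f \<in> bump_algebra d"
  shows "smooth f"
proof (rule smooth_coinduct[where S = "bump_algebra d"])
  fix f :: "'a \<Rightarrow> real" and x v
  assume "f \<in> bump_algebra d"
  then obtain D where D: "\<And>x. (f has_derivative (\<lambda>v. D v x)) (at x)" "\<And>v. D v \<in> bump_algebra d"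
    using bump_algebra_has_derivative by blast
  show "f differentiable at x"
    using D(1) by (auto simp: differentiable_def)
  have "(\<lambda>x. frechet_derivative f (at x) v) = D v"
    by (rule ext, subst frechet_derivative_at[OF D(1), symmetric]) simp
  then show "(\<lambda>x. frechet_derivative f (at x) v) \<in> bump_algebra d"
    using D(2) by simp
qed (rule assms)

text \<open>Every derivative can be put on the kernel, and derivatives of a smooth kernel are again
  smooth kernels. Hence the convolutions of a fixed continuous \<open>f\<close> with all smooth
  kernels form a class closed under differentiation.\<close>

lemma smooth_convolution:
  fixes f :: "'a::euclidean_space \<Rightarrow> real"
  assumes "smooth j" and f: "continuous_on UNIV f"
  shows "smooth (\<lambda>x. integral (cbox a b) (\<lambda>y. j (x - y) * f y))"
proof -
  let ?C = "\<lambda>j x. integral (cbox a b) (\<lambda>y. j (x - y) * f y)"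
  have fc: "continuous_on A (\<lambda>z. f (h z))" if "continuous_on A h" for A and h :: "'c::topological_space \<Rightarrow> 'a"
    using continuous_on_compose2[OF f that] by auto
  have D: "(?C j has_derivative (\<lambda>v. ?C (\<lambda>x. frechet_derivative j (at x) v) x)) (at x)"
    if j: "smooth j" for j x
  proof (rule has_derivative_integral_parameter)
    have jc: "continuous_on A (\<lambda>z. k (h z))"
      if "smooth k" "continuous_on A h" for A k and h :: "'c::topological_space \<Rightarrow> 'a"
      using continuous_on_compose2[OF smooth_continuous_on[OF that(1), of UNIV] that(2)] by auto
    show "((\<lambda>x. j (x - t) * f t) has_derivative
        (\<lambda>v. frechet_derivative j (at (x - t)) v * f t)) (at x)" for x t
      by (rule has_derivative_mult_left)
        (rule has_derivative_eq_rhs[OF has_derivative_compose[OF _ smooth_has_derivative[OF j]]],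
          auto intro!: derivative_eq_intros)
    show "continuous_on UNIV (\<lambda>(x, t). frechet_derivative j (at (x - t)) v * f t)" for v
      unfolding case_prod_beta'
      by (intro continuous_intros fc jc[OF smooth_frechet_derivative[OF j]])
    show "continuous_on (cbox a b) (\<lambda>y. j (x - y) * f y)" for x
      by (intro continuous_intros fc jc[OF j])
  qed
  show ?thesis
  proof (rule smooth_coinduct[where S = "{?C j | j. smooth j}"])
    show "g differentiable at x" if "g \<in> {?C j | j. smooth j}" for g :: "'a \<Rightarrow> real" and x
      using that D by (auto simp: differentiable_def)
    fix g :: "'a \<Rightarrow> real" and v
    assume "g \<in> {?C j | j. smooth j}"
    then obtain j where j: "g = ?C j" "smooth j" by auto
    have "(\<lambda>x. frechet_derivative g (at x) v) = ?C (\<lambda>x. frechet_derivative j (at x) v)"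
      unfolding j(1) by (rule ext, subst frechet_derivative_at[OF D[OF j(2)], symmetric]) simp
    then show "(\<lambda>x. frechet_derivative g (at x) v) \<in> {?C j | j. smooth j}"
      using smooth_frechet_derivative[OF j(2)] by auto
  qed (use assms(1) in auto)
qed

section \<open>Affine changes of variables and continuous functions of compact support\<close>

lemma lborel_integral_affine:
  fixes f :: "'a::euclidean_space \<Rightarrow> real"
  assumes c: "c \<noteq> 0" and [measurable]: "f \<in> borel_measurable borel"
  shows "(\<integral>x. f x \<partial>lborel) = \<bar>c\<bar> ^ DIM('a) * (\<integral>x. f (t + c *\<^sub>R x) \<partial>lborel)"
  by (subst lborel_affine[OF c, of t])
    (simp add: integral_density integral_distr)

lemma lborel_integrable_affine:
  fixes f :: "'a::euclidean_space \<Rightarrow> real"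
  assumes c: "c \<noteq> 0" and f: "integrable lborel f"
  shows "integrable lborel (\<lambda>x. f (t + c *\<^sub>R x))"
proof -
  have [measurable]: "f \<in> borel_measurable borel" using f by auto
  have "integrable (density (distr lborel borel (\<lambda>x. t + c *\<^sub>R x)) (\<lambda>_. \<bar>c\<bar> ^ DIM('a))) f"
    using f lborel_affine[OF c, of t] by simp
  then have "integrable lborel (\<lambda>x. \<bar>c\<bar> ^ DIM('a) * f (t + c *\<^sub>R x))"
    by (simp add: integrable_density integrable_distr_eq)
  then show ?thesis using c by simp
qed

lemma integrable_lborel_compact_support:
  fixes f :: "'a::euclidean_space \<Rightarrow> real"
  assumes "compact K" "\<And>x. x \<notin> K \<Longrightarrow> f x = 0" "continuous_on UNIV f"
  shows "integrable lborel f"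
proof -
  have "set_integrable lborel K f"
    using assms borel_integrable_compact[of K f] continuous_on_subset
    unfolding set_integrable_def by blast
  moreover have "(\<lambda>x. indicat_real K x *\<^sub>R f x) = f"
    using assms(2) by (auto simp: indicator_def fun_eq_iff)
  ultimately show ?thesis by (simp add: set_integrable_def)
qed

lemma integral_cbox_eq_lborel:
  fixes f :: "'a::euclidean_space \<Rightarrow> real"
  assumes "\<And>x. x \<notin> cbox a b \<Longrightarrow> f x = 0" "continuous_on UNIV f"
  shows "integral (cbox a b) f = (\<integral>x. f x \<partial>lborel)"
proof -
  have "integral (cbox a b) f = integral UNIV (\<lambda>x. if x \<in> cbox a b then f x else 0)"
    by (rule integral_restrict_UNIV[symmetric])
  also have "(\<lambda>x. if x \<in> cbox a b then f x else 0) = f"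
    using assms(1) by auto
  also have "integral UNIV f = (\<integral>x. f x \<partial>lborel)"
    by (rule integral_lborel[OF integrable_lborel_compact_support[OF compact_cbox assms]])
  finally show ?thesis .
qed

text \<open>Uniform continuity is taken on the compact set K plus the closed unit ball. For a shift
  of norm at most 1, either both points lie in this set or neither lies in K, and then both values
  vanish.\<close>

lemma uniform_continuity_compact_support:
  fixes f :: "'a::euclidean_space \<Rightarrow> real"
  assumes K: "compact K" "\<And>x. x \<notin> K \<Longrightarrow> f x = 0" and f: "continuous_on UNIV f" and "\<epsilon> > 0"
  shows "\<exists>d>0. \<forall>x y. norm y \<le> d \<longrightarrow> \<bar>f (x - y) - f x\<bar> \<le> \<epsilon>"
proof -
  let ?K = "(\<lambda>(x, y). x + y) ` (K \<times> cball 0 1)"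
  have "compact ?K"
    by (intro compact_continuous_image compact_Times K compact_cball)
      (auto intro!: continuous_intros simp: case_prod_beta')
  then have "uniformly_continuous_on ?K f"
    using f compact_uniformly_continuous continuous_on_subset by blast
  then obtain d where d: "d > 0" "\<And>x x'. x \<in> ?K \<Longrightarrow> x' \<in> ?K \<Longrightarrow> dist x' x < d \<Longrightarrow> dist (f x') (f x) < \<epsilon>"
    unfolding uniformly_continuous_on_def using \<open>\<epsilon> > 0\<close> by metis
  show ?thesis
  proof (intro exI[of _ "min (d / 2) 1"] conjI allI impI)
    fix x y :: 'a
    assume y: "norm y \<le> min (d / 2) 1"
    show "\<bar>f (x - y) - f x\<bar> \<le> \<epsilon>"
    proof (cases "x \<in> K \<or> x - y \<in> K")
      case True
      have "x - y \<in> ?K"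
      proof (cases "x \<in> K")
        case True
        then show ?thesis using y by (intro image_eqI[of _ _ "(x, -y)"]) auto
      next
        case False
        with \<open>x \<in> K \<or> x - y \<in> K\<close> show ?thesis by (intro image_eqI[of _ _ "(x - y, 0)"]) auto
      qed
      moreover have "x \<in> ?K"
      proof (cases "x \<in> K")
        case True
        then show ?thesis by (intro image_eqI[of _ _ "(x, 0)"]) auto
      next
        case False
        with \<open>x \<in> K \<or> x - y \<in> K\<close> y show ?thesis by (intro image_eqI[of _ _ "(x - y, y)"]) auto
      qed
      moreover have "dist (x - y) x < d"
        using y d(1) by (simp add: dist_norm)
      ultimately show ?thesis using d(2)[of x "x - y"] by (simp add: dist_real_def)
    next
      case False
      then show ?thesis using K(2) \<open>\<epsilon> > 0\<close> by simp
    qed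
  qed (use d in auto)
qed

section \<open>Mollification\<close>

abbreviation sym_box :: "real \<Rightarrow> 'a::euclidean_space set" where
  "sym_box d \<equiv> cbox (- d *\<^sub>R One) (d *\<^sub>R One)"

text \<open>Lets a kernel supported in a ball be integrated over a box, the kind of domain on which
  differentiation under the integral sign is carried out here.\<close>

lemma norm_le_imp_sym_box: "norm x \<le> d \<Longrightarrow> x \<in> sym_box d"
  using Basis_le_norm[of _ x] by (force simp: mem_box abs_le_iff)

lemma mollifier_exists:
  assumes "d > 0"
  obtains j :: "'a::euclidean_space \<Rightarrow> real" where "smooth j" "\<And>x. 0 \<le> j x"
    "\<And>x. d \<le> norm x \<Longrightarrow> j x = 0" "integral (sym_box d) j = 1"
proof -
  define j0 where "j0 = (\<lambda>x::'a. inv_exp 0 (d\<^sup>2 - x \<bullet> x))"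
  have sm: "smooth j0"
    unfolding j0_def by (rule bump_algebra_smooth[OF bump_algebra.base])
  have nonneg: "0 \<le> j0 x" for x
    by (simp add: j0_def inv_exp_def)
  have supp: "j0 x = 0" if "d \<le> norm x" for x
  proof -
    have "d\<^sup>2 \<le> x \<bullet> x"
      using that assms by (simp add: dot_square_norm)
    then show ?thesis by (simp add: j0_def inv_exp_def)
  qed
  define c where "c = integral (sym_box d) j0"
  have 0: "j0 0 > 0" using assms by (simp add: j0_def inv_exp_def)
  \<comment> \<open>A continuous nonnegative function with zero integral would vanish on the whole
    box, contradicting its positive value at the origin.\<close>
  have "c \<noteq> 0"
  proof
    assume "c = 0"
    moreover have "box (- d *\<^sub>R One) (d *\<^sub>R One) \<noteq> ({}::'a set)"
      using assms by (simp add: box_ne_empty)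
    ultimately have "\<forall>x\<in>sym_box d. j0 x = 0"
      using integral_cbox_eq_0_iff[OF smooth_continuous_on[OF sm], of "- d *\<^sub>R One" "d *\<^sub>R One"] nonneg
      unfolding c_def by blast
    then show False using 0 norm_le_imp_sym_box[of "0::'a" d] assms by auto
  qed
  moreover have "c \<ge> 0" unfolding c_def
    by (intro integral_nonneg integrable_continuous smooth_continuous_on sm nonneg)
  ultimately have c: "c > 0" by simp
  show ?thesis
  proof (rule that[of "\<lambda>x. (1 / c) * j0 x"])
    show "integral (sym_box d) (\<lambda>x. (1 / c) * j0 x) = 1"
      using c by (subst integral_mult_right) (simp add: c_def)
    show "smooth (\<lambda>x. (1 / c) * j0 x)"
      by (rule smooth_cmult[OF sm])
  qed (use c nonneg supp in auto)
qed

text \<open>The kernel is a probability density, so only the oscillation of \<open>f\<close> near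
  \<open>x\<close> matters. The oscillation hypothesis concerns a single point and an arbitrary
  continuous function, so that the result applies to directional derivatives too.\<close>

lemma mollification_close:
  fixes f :: "'a::euclidean_space \<Rightarrow> real"
  assumes j: "smooth j" "\<And>x. 0 \<le> j x" "\<And>x. d \<le> norm x \<Longrightarrow> j x = 0" "integral (sym_box d) j = 1"
    and f: "continuous_on UNIV f" "\<And>y. norm y \<le> d \<Longrightarrow> \<bar>f (x - y) - f x\<bar> \<le> \<epsilon>"
  shows "\<bar>integral (sym_box d) (\<lambda>y. j y * f (x - y)) - f x\<bar> \<le> \<epsilon>"
proof -
  have jc: "continuous_on A j" for A by (rule smooth_continuous_on[OF j(1)])
  have fc: "continuous_on A (\<lambda>y. f (x - y))" for A
    by (rule continuous_on_compose2[OF f(1)]) (auto intro!: continuous_intros)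
  have "integral (sym_box d) (\<lambda>y. j y * f (x - y)) - f x
      = integral (sym_box d) (\<lambda>y. j y * f (x - y)) - integral (sym_box d) (\<lambda>y. j y * f x)"
    using j(4) by simp
  also have "\<dots> = integral (sym_box d) (\<lambda>y. j y * f (x - y) - j y * f x)"
    by (intro integral_diff[symmetric] integrable_continuous continuous_intros jc fc)
  finally have eq: "integral (sym_box d) (\<lambda>y. j y * f (x - y)) - f x
      = integral (sym_box d) (\<lambda>y. j y * f (x - y) - j y * f x)" .
  have "norm (integral (sym_box d) (\<lambda>y. j y * f (x - y) - j y * f x)) \<le> integral (sym_box d) (\<lambda>y. j y * \<epsilon>)"
  proof (rule integral_norm_bound_integral)
    fix y :: 'a
    have "j y * \<bar>f (x - y) - f x\<bar> \<le> j y * \<epsilon>"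
      using j(2,3)[of y] f(2)[of y] by (cases "norm y \<le> d") (auto intro: mult_left_mono)
    then show "norm (j y * f (x - y) - j y * f x) \<le> j y * \<epsilon>"
      using j(2)[of y] by (simp add: right_diff_distrib[symmetric] abs_mult)
  qed (intro integrable_continuous continuous_intros jc fc)+
  also have "\<dots> = \<epsilon>" using j(4) by simp
  finally show ?thesis unfolding eq by simp
qed

lemma mollification_test_fun:
  fixes f :: "'a::euclidean_space \<Rightarrow> real"
  assumes j: "smooth j" "\<And>x. d \<le> norm x \<Longrightarrow> j x = 0" and "d > 0"
    and K: "compact K" "\<And>x. x \<notin> K \<Longrightarrow> f x = 0" and f: "continuous_on UNIV f"
    and U: "\<And>x y. x \<in> K \<Longrightarrow> norm y \<le> d \<Longrightarrow> x + y \<in> U"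
  shows "test_fun U (\<lambda>x. integral (sym_box d) (\<lambda>y. j y * f (x - y)))"
proof -
  have jc: "continuous_on A (\<lambda>x. j (h x))" if "continuous_on A h" for A and h :: "'a \<Rightarrow> 'a"
    using continuous_on_compose2[OF smooth_continuous_on[OF j(1), of UNIV] that] by auto
  have fc: "continuous_on A (\<lambda>x. f (h x))" if "continuous_on A h" for A and h :: "'a \<Rightarrow> 'a"
    using continuous_on_compose2[OF f that] by auto
  obtain a where a: "K \<subseteq> cbox (-a) a"
    using bounded_subset_cbox_symmetric compact_imp_bounded K(1) by metis
  have "integral (sym_box d) (\<lambda>y. j y * f (x - y)) = integral (cbox (-a) a) (\<lambda>y. j (x - y) * f y)" for x
  proof -
    have "integral (sym_box d) (\<lambda>y. j y * f (x - y)) = (\<integral>y. j y * f (x - y) \<partial>lborel)"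
    proof (intro integral_cbox_eq_lborel continuous_intros jc fc)
      fix y :: 'a assume "y \<notin> sym_box d"
      then show "j y * f (x - y) = 0"
        using norm_le_imp_sym_box[of y d] j(2)[of y] by (cases "norm y \<le> d") auto
    qed
    \<comment> \<open>The reflection of y to x - y moves the variable x into the kernel, where
      differentiation is free, and leaves a fixed domain of integration.\<close>
    also have "\<dots> = (\<integral>y. j (x + (-1) *\<^sub>R y) * f (x - (x + (-1) *\<^sub>R y)) \<partial>lborel)"
      by (subst lborel_integral_affine[of "-1" _ x])
        (auto intro!: borel_measurable_continuous_onI continuous_intros jc fc)
    also have "\<dots> = (\<integral>y. j (x - y) * f y \<partial>lborel)"
      by simp
    also have "\<dots> = integral (cbox (-a) a) (\<lambda>y. j (x - y) * f y)"
      using a K(2) by (intro integral_cbox_eq_lborel[symmetric] continuous_intros jc fc) auto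
    finally show ?thesis .
  qed
  then have "smooth (\<lambda>x. integral (sym_box d) (\<lambda>y. j y * f (x - y)))"
    using smooth_convolution[OF j(1) f] by simp
  \<comment> \<open>The support lies in K plus the closed ball of radius \<open>d\<close>, a compact
    subset of \<open>U\<close>.\<close>
  moreover have "integral (sym_box d) (\<lambda>y. j y * f (x - y)) = 0"
    if "x \<notin> (\<lambda>(x, y). x + y) ` (K \<times> cball 0 d)" for x
  proof -
    have "j y * f (x - y) = 0" for y
    proof (rule ccontr)
      assume "j y * f (x - y) \<noteq> 0"
      then have "x - y \<in> K" "norm y < d"
        using j(2)[of y] K(2)[of "x - y"] by force+
      then show False using that by (force intro!: image_eqI[of _ _ "(x - y, y)"])
    qed
    then show ?thesis by (simp only: integral_0)
  qed
  moreover have "compact ((\<lambda>(x, y). x + y) ` (K \<times> cball 0 d))"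
    by (intro compact_continuous_image compact_Times K compact_cball)
      (auto intro!: continuous_intros simp: case_prod_beta')
  moreover have "(\<lambda>(x, y). x + y) ` (K \<times> cball 0 d) \<subseteq> U"
    using U by auto
  ultimately show ?thesis
    unfolding test_fun_def by blast
qed

lemma compact_in_open_margin:
  fixes K :: "'a::euclidean_space set"
  assumes "compact K" "K \<subseteq> U" "open U"
  shows "\<exists>d>0. \<forall>x y. x \<in> K \<longrightarrow> norm y \<le> d \<longrightarrow> x + y \<in> U"
proof -
  obtain e where e: "e > 0" "(\<Union>x\<in>K. cball x e) \<subseteq> U"
    using compact_subset_open_imp_cball_epsilon_subset[OF assms(1,3,2)] by auto
  have "x + y \<in> U" if "x \<in> K" "norm y \<le> e" for x y
  proof -
    have "x + y \<in> cball x e" using that by (simp add: dist_norm)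
    then show ?thesis using e that by blast
  qed
  then show ?thesis using e(1) by blast
qed

lemma test_fun_approx_continuous:
  fixes f :: "'a::euclidean_space \<Rightarrow> real"
  assumes U: "open U" and K: "compact K" "K \<subseteq> U" "\<And>x. x \<notin> K \<Longrightarrow> f x = 0"
    and f: "continuous_on UNIV f" and "\<epsilon> > 0"
  obtains \<psi> where "test_fun U \<psi>" "\<And>x. \<bar>\<psi> x - f x\<bar> \<le> \<epsilon>"
proof -
  obtain d1 where d1: "d1 > 0" "\<And>x y. x \<in> K \<Longrightarrow> norm y \<le> d1 \<Longrightarrow> x + y \<in> U"
    using compact_in_open_margin[OF K(1,2) U] by blast
  obtain d2 where d2: "d2 > 0" "\<And>x y. norm y \<le> d2 \<Longrightarrow> \<bar>f (x - y) - f x\<bar> \<le> \<epsilon>"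
    using uniform_continuity_compact_support[OF K(1,3) f \<open>\<epsilon> > 0\<close>] by blast
  \<comment> \<open>\<open>d1\<close> keeps the support inside \<open>U\<close>, \<open>d2\<close>
    controls the oscillation of \<open>f\<close>.\<close>
  define d where "d = min d1 d2"
  have d: "d > 0" using d1 d2 by (simp add: d_def)
  obtain j :: "'a \<Rightarrow> real" where j: "smooth j" "\<And>x. 0 \<le> j x"
    "\<And>x. d \<le> norm x \<Longrightarrow> j x = 0" "integral (sym_box d) j = 1"
    using mollifier_exists[OF d] by blast
  show ?thesis
  proof (rule that)
    show "test_fun U (\<lambda>x. integral (sym_box d) (\<lambda>y. j y * f (x - y)))"
      by (rule mollification_test_fun[OF j(1,3) d K(1,3) f]) (use d1 in \<open>auto simp: d_def\<close>)
    show "\<bar>integral (sym_box d) (\<lambda>y. j y * f (x - y)) - f x\<bar> \<le> \<epsilon>" for x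
      by (rule mollification_close[OF j f]) (use d2 in \<open>auto simp: d_def\<close>)
  qed
qed

lemma derivative_zero_outside_support:
  fixes f :: "'a::euclidean_space \<Rightarrow> real"
  assumes K: "compact K" "\<And>x. x \<notin> K \<Longrightarrow> f x = 0"
    and D: "(f has_derivative D) (at x)" and "x \<notin> K"
  shows "D v = 0"
proof -
  have "((\<lambda>x. 0) has_derivative D) (at x)"
    by (rule has_derivative_transform_within_open[OF D, of "- K"])
      (use K \<open>x \<notin> K\<close> compact_imp_closed in auto)
  then have "D = (\<lambda>v. 0)"
    using has_derivative_unique has_derivative_const by blast
  then show ?thesis by simp
qed

text \<open>The closeness of derivatives comes from differentiating the other factor of the
  convolution: each directional derivative of the mollification is the mollification of that of
  \<open>f\<close>. Smoothness still comes from the kernel.\<close>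

lemma test_fun_approx_C1:
  fixes f :: "'a::euclidean_space \<Rightarrow> real"
  assumes U: "open U" and K: "compact K" "K \<subseteq> U" "\<And>x. x \<notin> K \<Longrightarrow> f x = 0"
    and D: "\<And>x. (f has_derivative D x) (at x)"
    and cont_D: "\<And>v. v \<in> Basis \<Longrightarrow> continuous_on UNIV (\<lambda>x. D x v)" and "\<epsilon> > 0"
  obtains \<psi> where "test_fun U \<psi>" "\<And>x. \<bar>\<psi> x - f x\<bar> \<le> \<epsilon>"
    "\<And>x v. v \<in> Basis \<Longrightarrow> \<bar>frechet_derivative \<psi> (at x) v - D x v\<bar> \<le> \<epsilon>"
proof -
  have f: "continuous_on UNIV f"
    using D has_derivative_continuous continuous_at_imp_continuous_on by blast
  obtain d1 where d1: "d1 > 0" "\<And>x y. x \<in> K \<Longrightarrow> norm y \<le> d1 \<Longrightarrow> x + y \<in> U"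
    using compact_in_open_margin[OF K(1,2) U] by blast
  obtain d2 where d2: "d2 > 0" "\<And>x y. norm y \<le> d2 \<Longrightarrow> \<bar>f (x - y) - f x\<bar> \<le> \<epsilon>"
    using uniform_continuity_compact_support[OF K(1,3) f \<open>\<epsilon> > 0\<close>] by blast
  have "\<exists>d>0. \<forall>x y. norm y \<le> d \<longrightarrow> \<bar>D (x - y) v - D x v\<bar> \<le> \<epsilon>" if "v \<in> Basis" for v
    by (rule uniform_continuity_compact_support[OF K(1) _ cont_D[OF that] \<open>\<epsilon> > 0\<close>])
      (rule derivative_zero_outside_support[OF K(1,3) D])
  then obtain d3 where d3: "\<And>v. v \<in> Basis \<Longrightarrow> d3 v > 0"
      "\<And>v x y. v \<in> Basis \<Longrightarrow> norm y \<le> d3 v \<Longrightarrow> \<bar>D (x - y) v - D x v\<bar> \<le> \<epsilon>"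
    by metis
  \<comment> \<open>The basis is finite, so one radius serves \<open>f\<close> and all its partial
    derivatives.\<close>
  define d where "d = min (min d1 d2) (Min (d3 ` Basis))"
  have d: "d > 0" using d1 d2 d3 by (simp add: d_def)
  have d_le: "d \<le> d3 v" if "v \<in> Basis" for v
    using that by (auto simp: d_def intro!: min.coboundedI2 Min_le)
  obtain j :: "'a \<Rightarrow> real" where j: "smooth j" "\<And>x. 0 \<le> j x"
    "\<And>x. d \<le> norm x \<Longrightarrow> j x = 0" "integral (sym_box d) j = 1"
    using mollifier_exists[OF d] by blast
  define \<psi> where "\<psi> = (\<lambda>x. integral (sym_box d) (\<lambda>y. j y * f (x - y)))"
  have jc: "continuous_on A (\<lambda>x. j (h x))" if "continuous_on A h" for A and h :: "'c::topological_space \<Rightarrow> 'a"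
    using continuous_on_compose2[OF smooth_continuous_on[OF j(1), of UNIV] that] by auto
  have fc: "continuous_on A (\<lambda>x. f (h x))" if "continuous_on A h" for A and h :: "'c::topological_space \<Rightarrow> 'a"
    using continuous_on_compose2[OF f that] by auto
  have Dc: "continuous_on A (\<lambda>x. D (h x) v)" if "v \<in> Basis" "continuous_on A h"
    for A v and h :: "'c::topological_space \<Rightarrow> 'a"
    using continuous_on_compose2[OF cont_D[OF that(1)] that(2)] by auto
  have "(\<psi> has_derivative (\<lambda>v. integral (sym_box d) (\<lambda>y. j y * D (x - y) v))) (at x)" for x
    unfolding \<psi>_def
  proof (rule has_derivative_integral_parameter)
    show "((\<lambda>x. j t * f (x - t)) has_derivative (\<lambda>v. j t * D (x - t) v)) (at x)" for x t
      by (rule has_derivative_mult_right,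
          rule has_derivative_eq_rhs[OF has_derivative_compose[OF _ D]])
        (auto intro!: derivative_eq_intros)
    show "continuous_on UNIV (\<lambda>(x, t). j t * D (x - t) v)" if "v \<in> Basis" for v
      unfolding case_prod_beta' by (intro continuous_intros jc Dc that)
    show "continuous_on (sym_box d) (\<lambda>y. j y * f (x - y))" for x
      by (intro continuous_intros jc fc)
  qed
  then have D\<psi>: "frechet_derivative \<psi> (at x) = (\<lambda>v. integral (sym_box d) (\<lambda>y. j y * D (x - y) v))" for x
    by (rule frechet_derivative_at[symmetric])
  show ?thesis
  proof (rule that)
    show "test_fun U \<psi>" unfolding \<psi>_def
      by (rule mollification_test_fun[OF j(1,3) d K(1,3) f]) (use d1 in \<open>auto simp: d_def\<close>)
    show "\<bar>\<psi> x - f x\<bar> \<le> \<epsilon>" for x unfolding \<psi>_def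
      by (rule mollification_close[OF j f]) (use d2 in \<open>auto simp: d_def\<close>)
    show "\<bar>frechet_derivative \<psi> (at x) v - D x v\<bar> \<le> \<epsilon>" if v: "v \<in> Basis" for x v
    proof -
      have "\<bar>D (x - y) v - D x v\<bar> \<le> \<epsilon>" if "norm y \<le> d" for y
        using d3(2)[OF v] d_le[OF v] that by fastforce
      then show ?thesis
        unfolding D\<psi> using mollification_close[OF j cont_D[OF v]] by blast
    qed
  qed
qed

section \<open>Duality with test functions\<close>

lemma bounded_compact_support:
  fixes h :: "'a::euclidean_space \<Rightarrow> real"
  assumes "compact K" "\<And>x. x \<notin> K \<Longrightarrow> h x = 0" "continuous_on UNIV h"
  obtains S where "\<And>x. \<bar>h x\<bar> \<le> S"
proof -
  have "bounded (h ` K)"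
    using assms by (intro compact_imp_bounded compact_continuous_image) (auto intro: continuous_on_subset)
  then obtain S where S: "\<And>x. x \<in> K \<Longrightarrow> \<bar>h x\<bar> \<le> S"
    by (auto simp: bounded_iff)
  have "\<bar>h x\<bar> \<le> max S 0" for x
    using S[of x] assms(2)[of x] by (cases "x \<in> K") (auto simp: max.coboundedI1)
  then show ?thesis using that by blast
qed

lemma test_fun_continuous: "test_fun U \<psi> \<Longrightarrow> continuous_on UNIV \<psi>"
  using smooth_continuous_on by (auto simp: test_fun_def)

lemma integrable_mult_bounded:
  fixes v \<psi> :: "'c \<Rightarrow> real"
  assumes v: "integrable M v" and m: "\<psi> \<in> borel_measurable M" and b: "\<And>x. \<bar>\<psi> x\<bar> \<le> S"
  shows "integrable M (\<lambda>x. v x * \<psi> x)"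
proof (rule Bochner_Integration.integrable_bound)
  show "integrable M (\<lambda>x. S * v x)" using v by simp
  show "(\<lambda>x. v x * \<psi> x) \<in> borel_measurable M"
    using v m by auto
  have "0 \<le> S" using b order_trans abs_ge_zero by blast
  then show "AE x in M. norm (v x * \<psi> x) \<le> norm (S * v x)"
    using b by (intro AE_I2) (simp add: abs_mult mult.commute mult_right_mono)
qed

lemma integral_mult_close:
  fixes v f g :: "'c \<Rightarrow> real"
  assumes "integrable M v" "integrable M (\<lambda>x. v x * f x)" "integrable M (\<lambda>x. v x * g x)"
    and close: "\<And>x. \<bar>f x - g x\<bar> \<le> \<epsilon>"
  shows "\<bar>(\<integral>x. v x * f x \<partial>M) - (\<integral>x. v x * g x \<partial>M)\<bar> \<le> \<epsilon> * (\<integral>x. \<bar>v x\<bar> \<partial>M)"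
proof -
  have "(\<integral>x. v x * f x \<partial>M) - (\<integral>x. v x * g x \<partial>M) = (\<integral>x. v x * f x - v x * g x \<partial>M)"
    using assms by simp
  also have "\<bar>\<dots>\<bar> \<le> (\<integral>x. \<bar>v x * f x - v x * g x\<bar> \<partial>M)"
    by simp
  also have "\<dots> \<le> (\<integral>x. \<epsilon> * \<bar>v x\<bar> \<partial>M)"
  proof (rule integral_mono)
    fix x
    have "\<bar>v x\<bar> * \<bar>f x - g x\<bar> \<le> \<bar>v x\<bar> * \<epsilon>"
      using close by (intro mult_left_mono) auto
    then show "\<bar>v x * f x - v x * g x\<bar> \<le> \<epsilon> * \<bar>v x\<bar>"
      unfolding right_diff_distrib[symmetric] abs_mult by (simp add: mult.commute)
  qed (use assms in auto)
  finally show ?thesis by simp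
qed

text \<open>The norm is attained in the limit on continuous functions bounded by 1 that converge
  almost everywhere to the sign of \<open>v\<close> on the ball; dominated convergence applies
  because \<open>v\<close> is integrable. The hypothesis is homogeneous in \<open>S\<close> because
  smooth approximations of such functions may slightly exceed 1.\<close>

lemma test_fun_duality:
  fixes v :: "'a::euclidean_space \<Rightarrow> real"
  assumes v: "integrable lborel v" and "M \<ge> 0"
    and bound: "\<And>\<psi> S. test_fun (ball x0 R) \<psi> \<Longrightarrow> (\<And>x. \<bar>\<psi> x\<bar> \<le> S) \<Longrightarrow> (\<integral>x. v x * \<psi> x \<partial>lborel) \<le> M * S"
  shows "(\<integral>x. indicat_real (ball x0 R) x * \<bar>v x\<bar> \<partial>lborel) \<le> M"
proof -
  \<comment> \<open>Extends the bound from smooth to continuous functions supported in the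
    ball.\<close>
  have cont_bound: "(\<integral>x. v x * f x \<partial>lborel) \<le> M"
    if K: "compact K" "K \<subseteq> ball x0 R" "\<And>x. x \<notin> K \<Longrightarrow> f x = 0"
      and f: "continuous_on UNIV f" "\<And>x. \<bar>f x\<bar> \<le> 1" for K f
  proof (rule field_le_epsilon)
    fix e :: real assume "e > 0"
    define I where "I = (\<integral>x. \<bar>v x\<bar> \<partial>lborel)"
    have "I \<ge> 0" by (simp add: I_def)
    \<comment> \<open>Two errors must fit into \<open>e\<close>: M \<epsilon> from the excess of the
      sup norm over 1, and I \<epsilon> from replacing f by its approximation. The summand 1 keeps
      the denominator positive.\<close>
    define \<epsilon> where "\<epsilon> = e / (M + I + 1)"
    have \<epsilon>: "\<epsilon> > 0" "\<epsilon> * (M + I + 1) = e"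
      using \<open>e > 0\<close> \<open>M \<ge> 0\<close> \<open>I \<ge> 0\<close> by (auto simp: \<epsilon>_def)
    obtain \<psi> where \<psi>: "test_fun (ball x0 R) \<psi>" "\<And>x. \<bar>\<psi> x - f x\<bar> \<le> \<epsilon>"
      using test_fun_approx_continuous[OF open_ball K f(1) \<epsilon>(1)] by blast
    have S: "\<bar>\<psi> x\<bar> \<le> 1 + \<epsilon>" for x
      using \<psi>(2)[of x] f(2)[of x] by linarith
    have m: "f \<in> borel_measurable lborel" "\<psi> \<in> borel_measurable lborel"
      using borel_measurable_continuous_onI[OF f(1)]
        borel_measurable_continuous_onI[OF test_fun_continuous[OF \<psi>(1)]] by auto
    have "\<bar>(\<integral>x. v x * \<psi> x \<partial>lborel) - (\<integral>x. v x * f x \<partial>lborel)\<bar> \<le> \<epsilon> * I"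
      unfolding I_def
      by (intro integral_mult_close integrable_mult_bounded[OF v m(1) f(2)]
          integrable_mult_bounded[OF v m(2) S] \<psi> v)
    then have "(\<integral>x. v x * f x \<partial>lborel) \<le> (\<integral>x. v x * \<psi> x \<partial>lborel) + \<epsilon> * I"
      by linarith
    also have "\<dots> \<le> M * (1 + \<epsilon>) + \<epsilon> * I"
      using bound[OF \<psi>(1) S] by simp
    also have "\<dots> \<le> M + e"
      using \<epsilon> by (simp add: algebra_simps)
    finally show "(\<integral>x. v x * f x \<partial>lborel) \<le> M + e" .
  qed
  have [measurable]: "v \<in> borel_measurable borel" using v by auto
  have "(\<lambda>x. sgn (v x)) \<in> borel_measurable lebesgue"
    by (intro measurable_completion) simp
  \<comment> \<open>This notion of measurability provides, by definition, continuous functions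
    converging to the sign off a negligible set.\<close>
  then have "(\<lambda>x. sgn (v x)) measurable_on UNIV"
    by (rule lebesgue_measurable_imp_measurable_on_real) (simp add: lborelD)
  then obtain N g where N: "negligible N" and g: "\<And>n. continuous_on UNIV (g n)"
      "\<And>x. x \<notin> N \<Longrightarrow> (\<lambda>n. g n x) \<longlonglongrightarrow> sgn (v x)"
    unfolding measurable_on_def by auto
  \<comment> \<open>For positive n the first factor is 0 where R - |x - x0| is at most 1/n and 1
    where it is at least 2/n; for n = 0 it is identically 0. The second factor truncates
    \<open>g n\<close> to [-1, 1], which leaves the limit unchanged since a sign lies in that
    range.\<close>
  define h where "h = (\<lambda>n x. max 0 (min 1 (real n * (R - dist x0 x) - 1)) * max (-1) (min 1 (g n x)))"
  have hc: "continuous_on UNIV (h n)" for n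
    unfolding h_def by (intro continuous_intros g)
  have h1: "\<bar>h n x\<bar> \<le> 1" for n x
    unfolding h_def abs_mult by (intro mult_le_one) auto
  have le: "(\<integral>x. v x * h n x \<partial>lborel) \<le> M" for n
  proof (rule cont_bound[OF _ _ _ hc h1])
    show "compact (cball x0 (R - 1 / (real n + 1)))" by simp
    show "cball x0 (R - 1 / (real n + 1)) \<subseteq> ball x0 R"
      by (auto simp: cball_subset_ball_iff)
    show "h n x = 0" if "x \<notin> cball x0 (R - 1 / (real n + 1))" for x
    proof -
      have "(real n + 1) * (R - dist x0 x) < 1"
        using that by (simp add: field_simps)
      then have "real n * (R - dist x0 x) - 1 \<le> 0"
        using mult_nonneg_nonpos[of "real n" "R - dist x0 x"]
        by (cases "R - dist x0 x \<ge> 0") (auto simp: distrib_right)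
      then show ?thesis by (simp add: h_def)
    qed
  qed
  have "(\<lambda>n. \<integral>x. v x * h n x \<partial>lborel) \<longlonglongrightarrow> (\<integral>x. indicat_real (ball x0 R) x * \<bar>v x\<bar> \<partial>lborel)"
  proof (rule integral_dominated_convergence[where w = "\<lambda>x. \<bar>v x\<bar>"])
    show "(\<lambda>x. v x * h n x) \<in> borel_measurable lborel" for n
      using borel_measurable_continuous_onI[OF hc[of n]] by simp
    show "AE x in lborel. norm (v x * h n x) \<le> \<bar>v x\<bar>" for n
      using h1[of n] by (intro AE_I2) (auto simp: abs_mult intro: mult_left_le)
    have "AE x in lebesgue. x \<notin> N"
      using N by (simp add: negligible_iff_null_sets AE_not_in)
    then have "AE x in lborel. x \<notin> N"
      by (simp add: AE_completion_iff)
    then show "AE x in lborel. (\<lambda>n. v x * h n x) \<longlonglongrightarrow> indicat_real (ball x0 R) x * \<bar>v x\<bar>"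
    proof eventually_elim
      case (elim x)
      have g': "(\<lambda>n. max (-1) (min 1 (g n x))) \<longlonglongrightarrow> max (-1) (min 1 (sgn (v x)))"
        by (intro tendsto_intros g elim)
      have "(\<lambda>n. max 0 (min 1 (real n * (R - dist x0 x) - 1))) \<longlonglongrightarrow> indicat_real (ball x0 R) x"
      proof (cases "x \<in> ball x0 R")
        case True
        then obtain m where m: "real m > 2 / (R - dist x0 x)"
          using reals_Archimedean2 by blast
        have "\<forall>\<^sub>F n in sequentially. max 0 (min 1 (real n * (R - dist x0 x) - 1)) = 1"
          using eventually_ge_at_top[of m]
        proof eventually_elim
          case (elim n)
          have "2 < real m * (R - dist x0 x)" using m True by (simp add: field_simps)
          also have "\<dots> \<le> real n * (R - dist x0 x)"
            using elim True by (intro mult_right_mono) auto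
          finally show ?case by simp
        qed
        then show ?thesis using True by (simp add: tendsto_eventually)
      next
        case False
        then have "max 0 (min 1 (real n * (R - dist x0 x) - 1)) = 0" for n
          using mult_nonneg_nonpos[of "real n" "R - dist x0 x"] by simp
        then show ?thesis using False by simp
      qed
      from tendsto_mult[OF tendsto_const[of "v x"] tendsto_mult[OF this g']]
      show ?case unfolding h_def by (simp add: abs_sgn sgn_if mult_ac split: if_splits)
    qed
    show "(\<lambda>x. indicat_real (ball x0 R) x * \<bar>v x\<bar>) \<in> borel_measurable lborel"
      by (intro borel_measurable_times borel_measurable_indicator) auto
  qed (use v in auto)
  then show ?thesis
    by (rule LIMSEQ_le_const2) (use le in auto)
qed

section \<open>Weak derivatives and the Poincare inequality\<close>

text \<open>Both sides are continuous in the test function under uniform convergence of values and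
  first derivatives, since \<open>u\<close> and \<open>w\<close> are integrable. \<open>w\<close>
  stays with the completed measure because the weak gradient is only Lebesgue measurable.\<close>

lemma weak_derivative_C1:
  fixes u w :: "'a::euclidean_space \<Rightarrow> real"
  assumes u: "integrable lborel u" and w: "integrable lebesgue w" and "i \<in> Basis"
    and weak: "\<And>\<phi>. test_fun U \<phi> \<Longrightarrow>
      (\<integral>x. u x * frechet_derivative \<phi> (at x) i \<partial>lborel) = - (\<integral>x. w x * \<phi> x \<partial>lebesgue)"
    and U: "open U" and K: "compact K" "K \<subseteq> U" "\<And>x. x \<notin> K \<Longrightarrow> f x = 0"
    and D: "\<And>x. (f has_derivative D x) (at x)"
    and cont_D: "\<And>v. v \<in> Basis \<Longrightarrow> continuous_on UNIV (\<lambda>x. D x v)"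
  shows "(\<integral>x. u x * D x i \<partial>lborel) = - (\<integral>x. w x * f x \<partial>lebesgue)"
proof -
  have cf: "continuous_on UNIV f"
    using D has_derivative_continuous continuous_at_imp_continuous_on by blast
  define J where "J = (\<integral>x. \<bar>u x\<bar> \<partial>lborel) + (\<integral>x. \<bar>w x\<bar> \<partial>lebesgue)"
  have "J \<ge> 0" by (simp add: J_def)
  obtain S1 where S1: "\<And>x. \<bar>f x\<bar> \<le> S1"
    using bounded_compact_support[OF K(1,3) cf] by blast
  obtain S2 where S2: "\<And>x. \<bar>D x i\<bar> \<le> S2"
    using bounded_compact_support[OF K(1) derivative_zero_outside_support[OF K(1,3) D]
        cont_D[OF \<open>i \<in> Basis\<close>]] by blast
  have "\<bar>(\<integral>x. u x * D x i \<partial>lborel) + (\<integral>x. w x * f x \<partial>lebesgue)\<bar> \<le> 0 + e" if "e > 0" for e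
  proof -
    define \<epsilon> where "\<epsilon> = e / (J + 1)"
    have \<epsilon>: "\<epsilon> > 0" "\<epsilon> * J \<le> e"
      using \<open>e > 0\<close> \<open>J \<ge> 0\<close> by (auto simp: \<epsilon>_def field_simps)
    obtain \<psi> where \<psi>: "test_fun U \<psi>" "\<And>x. \<bar>\<psi> x - f x\<bar> \<le> \<epsilon>"
      "\<And>x v. v \<in> Basis \<Longrightarrow> \<bar>frechet_derivative \<psi> (at x) v - D x v\<bar> \<le> \<epsilon>"
      using test_fun_approx_C1[OF U K D cont_D \<epsilon>(1)] by blast
    have sm: "smooth \<psi>" using \<psi>(1) by (simp add: test_fun_def)
    have S1': "\<bar>\<psi> x\<bar> \<le> S1 + \<epsilon>" for x using S1[of x] \<psi>(2)[of x] by linarith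
    have S2': "\<bar>frechet_derivative \<psi> (at x) i\<bar> \<le> S2 + \<epsilon>" for x
      using S2[of x] \<psi>(3)[OF \<open>i \<in> Basis\<close>, of x] by linarith
    have m: "f \<in> borel_measurable lebesgue" "\<psi> \<in> borel_measurable lebesgue"
      by (intro measurable_completion, simp add: borel_measurable_continuous_onI cf smooth_continuous_on sm)+
    have m': "(\<lambda>x. D x i) \<in> borel_measurable lborel" "(\<lambda>x. frechet_derivative \<psi> (at x) i) \<in> borel_measurable lborel"
      using borel_measurable_continuous_onI[OF cont_D[OF \<open>i \<in> Basis\<close>]]
        borel_measurable_continuous_onI[OF smooth_continuous_on[OF smooth_frechet_derivative[OF sm]]] by auto
    have "\<bar>(\<integral>x. u x * frechet_derivative \<psi> (at x) i \<partial>lborel) - (\<integral>x. u x * D x i \<partial>lborel)\<bar> \<le> \<epsilon> * (\<integral>x. \<bar>u x\<bar> \<partial>lborel)"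
      by (intro integral_mult_close u integrable_mult_bounded[OF u m'(1) S2] integrable_mult_bounded[OF u m'(2) S2']
          \<psi> \<open>i \<in> Basis\<close>)
    moreover have "\<bar>(\<integral>x. w x * \<psi> x \<partial>lebesgue) - (\<integral>x. w x * f x \<partial>lebesgue)\<bar> \<le> \<epsilon> * (\<integral>x. \<bar>w x\<bar> \<partial>lebesgue)"
      by (intro integral_mult_close w integrable_mult_bounded[OF w m(1) S1] integrable_mult_bounded[OF w m(2) S1'] \<psi>)
    ultimately show ?thesis
      using weak[OF \<psi>(1)] \<epsilon>(2) unfolding J_def by (simp add: algebra_simps)
  qed
  then have "\<bar>(\<integral>x. u x * D x i \<partial>lborel) + (\<integral>x. w x * f x \<partial>lebesgue)\<bar> \<le> 0"
    by (rule field_le_epsilon)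
  then show ?thesis by linarith
qed

text \<open>The field is found by writing 2^n \<psi>(2z - y) - \<psi>(z) as the integral over s in
  [1, 2] of d/ds (s^n \<psi>(y + s (z - y))). That integrand is itself the divergence in z of
  s^(n-1) \<psi>(y + s (z - y)) (z - y). The constant combines |p| \<le> 2^(n-1) S with |z - y|
  \<le> 2r.\<close>

lemma dilation_bound:
  fixes u :: "'a::euclidean_space \<Rightarrow> real"
  assumes u: "integrable lborel u" and G: "set_integrable lebesgue (ball x0 r) G"
    and weak: "\<And>\<phi> i. test_fun (ball x0 r) \<phi> \<Longrightarrow> i \<in> Basis \<Longrightarrow>
      (\<integral>x. u x * frechet_derivative \<phi> (at x) i \<partial>lborel) = - (LINT x:ball x0 r|lebesgue. \<phi> x * (G x \<bullet> i))"
    and y: "y \<in> ball x0 r" and \<psi>: "test_fun (ball x0 r) \<psi>" and S: "\<And>x. \<bar>\<psi> x\<bar> \<le> S"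
  shows "\<bar>\<integral>z. u z * (2 ^ DIM('a) * \<psi> (y + 2 *\<^sub>R (z - y)) - \<psi> z) \<partial>lborel\<bar>
    \<le> 2 ^ DIM('a) * r * S * (LINT x:ball x0 r|lebesgue. norm (G x))"
proof -
  define n where "n = DIM('a)"
  have n: "n > 0" by (simp add: n_def)
  let ?B = "ball x0 r"
  let ?D = "\<lambda>x. frechet_derivative \<psi> (at x)"
  have sm: "smooth \<psi>" using \<psi> by (simp add: test_fun_def)
  have pc: "continuous_on A (\<lambda>x. \<psi> (h x))" if "continuous_on A h" for A and h :: "'c::topological_space \<Rightarrow> 'a"
    using continuous_on_compose2[OF smooth_continuous_on[OF sm, of UNIV] that] by auto
  have Dc: "continuous_on A (\<lambda>x. ?D (h x) v)" if "continuous_on A h" for A v and h :: "'c::topological_space \<Rightarrow> 'a"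
    using continuous_on_compose2[OF smooth_continuous_on[OF smooth_frechet_derivative[OF sm], of UNIV] that] by auto
  have lin: "linear (?D x)" for x
    using smooth_has_derivative[OF sm] has_derivative_linear by blast
  define p where "p = (\<lambda>z. integral (cbox 1 2) (\<lambda>s::real. s ^ (n - 1) * \<psi> (y + s *\<^sub>R (z - y))))"
  define p' where "p' = (\<lambda>z v. integral (cbox 1 2) (\<lambda>s::real. s ^ n * ?D (y + s *\<^sub>R (z - y)) v))"
  have p': "(p has_derivative p' z) (at z)" for z
    unfolding p_def p'_def
  proof (rule has_derivative_integral_parameter)
    show "((\<lambda>z. s ^ (n - 1) * \<psi> (y + s *\<^sub>R (z - y))) has_derivative (\<lambda>v. s ^ n * ?D (y + s *\<^sub>R (z - y)) v)) (at z)"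
      for z and s :: real
    proof -
      have "((\<lambda>z. \<psi> (y + s *\<^sub>R (z - y))) has_derivative (\<lambda>v. ?D (y + s *\<^sub>R (z - y)) (s *\<^sub>R v))) (at z)"
        by (rule has_derivative_eq_rhs[OF has_derivative_compose[OF _ smooth_has_derivative[OF sm]]])
          (auto intro!: derivative_eq_intros)
      from has_derivative_mult_right[OF this, of "s ^ (n - 1)"]
      show ?thesis
        using power_minus_mult[OF n, of s] by (simp add: linear_cmul[OF lin] mult.assoc[symmetric])
    qed
    show "continuous_on UNIV (\<lambda>(z, s). s ^ n * ?D (y + s *\<^sub>R (z - y)) v)" for v
      unfolding case_prod_beta' by (intro continuous_intros Dc)
    show "continuous_on (cbox 1 2) (\<lambda>s. s ^ (n - 1) * \<psi> (y + s *\<^sub>R (z - y)))" for z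
      by (intro continuous_intros pc)
  qed
  have p'c: "continuous_on UNIV (\<lambda>z. p' z v)" for v
    unfolding p'_def
    by (rule integral_continuous_on_param)
      (auto intro!: continuous_intros Dc simp: case_prod_beta')
  have pcont: "continuous_on UNIV p"
    using p' has_derivative_continuous continuous_at_imp_continuous_on by blast
  \<comment> \<open>The vector field \<open>z \<mapsto> p z *\<^sub>R (z - y)\<close> has divergence \<open>2 ^ n * \<psi> (2 z - y) - \<psi> z\<close>.\<close>
  have div: "(\<Sum>i\<in>Basis. p' z i * ((z - y) \<bullet> i) + p z * (i \<bullet> i)) = 2 ^ n * \<psi> (y + 2 *\<^sub>R (z - y)) - \<psi> z" for z
  proof -
    have "(\<Sum>i\<in>Basis. p' z i * ((z - y) \<bullet> i)) = p' z (\<Sum>i\<in>Basis. ((z - y) \<bullet> i) *\<^sub>R i)"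
      unfolding linear_sum[OF has_derivative_linear[OF p']] linear_cmul[OF has_derivative_linear[OF p']]
      by (simp add: mult.commute)
    also have "\<dots> = p' z (z - y)" by (simp only: euclidean_representation)
    finally have 1: "(\<Sum>i\<in>Basis. p' z i * ((z - y) \<bullet> i)) = p' z (z - y)" .
    \<comment> \<open>The product rule produces both contributions to the divergence: the radial
      derivative of p and n times p, the latter from the divergence n of z - y.\<close>
    have "((\<lambda>s. s ^ n * ?D (y + s *\<^sub>R (z - y)) (z - y) + real n * (s ^ (n - 1) * \<psi> (y + s *\<^sub>R (z - y))))
       has_integral (2 ^ n * \<psi> (y + 2 *\<^sub>R (z - y)) - 1 ^ n * \<psi> (y + 1 *\<^sub>R (z - y)))) {1..2}"
    proof (rule fundamental_theorem_of_calculus)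
      fix s :: real assume "s \<in> {1..2}"
      have "((\<lambda>s. \<psi> (y + s *\<^sub>R (z - y))) has_derivative (\<lambda>h. ?D (y + s *\<^sub>R (z - y)) (h *\<^sub>R (z - y)))) (at s)"
        by (rule has_derivative_eq_rhs[OF has_derivative_compose[OF _ smooth_has_derivative[OF sm]]])
          (auto intro!: derivative_eq_intros)
      then have "((\<lambda>s. \<psi> (y + s *\<^sub>R (z - y))) has_real_derivative ?D (y + s *\<^sub>R (z - y)) (z - y)) (at s)"
        unfolding has_field_derivative_def linear_cmul[OF lin]
        by (rule has_derivative_eq_rhs) (simp add: fun_eq_iff mult.commute)
      then have "((\<lambda>s. s ^ n * \<psi> (y + s *\<^sub>R (z - y))) has_real_derivative
        s ^ n * ?D (y + s *\<^sub>R (z - y)) (z - y) + real n * (s ^ (n - 1) * \<psi> (y + s *\<^sub>R (z - y)))) (at s)"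
        by (auto intro!: derivative_eq_intros)
      then show "((\<lambda>s. s ^ n * \<psi> (y + s *\<^sub>R (z - y))) has_vector_derivative
        s ^ n * ?D (y + s *\<^sub>R (z - y)) (z - y) + real n * (s ^ (n - 1) * \<psi> (y + s *\<^sub>R (z - y)))) (at s within {1..2})"
        by (simp add: has_real_derivative_iff_has_vector_derivative has_vector_derivative_at_within)
    qed simp
    then have "2 ^ n * \<psi> (y + 2 *\<^sub>R (z - y)) - \<psi> z
      = integral (cbox 1 2) (\<lambda>s. s ^ n * ?D (y + s *\<^sub>R (z - y)) (z - y) + real n * (s ^ (n - 1) * \<psi> (y + s *\<^sub>R (z - y))))"
      by (simp add: integral_unique)
    also have "\<dots> = p' z (z - y) + integral (cbox 1 2) (\<lambda>s. real n * (s ^ (n - 1) * \<psi> (y + s *\<^sub>R (z - y))))"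
      unfolding p'_def
      by (intro integral_add integrable_continuous continuous_intros pc Dc)
    also have "integral (cbox 1 2) (\<lambda>s. real n * (s ^ (n - 1) * \<psi> (y + s *\<^sub>R (z - y)))) = real n * p z"
      by (simp add: p_def)
    finally show ?thesis
      using 1 by (simp add: sum.distrib n_def inner_same_Basis)
  qed
  obtain K where K: "compact K" "K \<subseteq> ?B" "\<And>x. x \<notin> K \<Longrightarrow> \<psi> x = 0"
    using \<psi> by (auto simp: test_fun_def)
  \<comment> \<open>If p does not vanish at z, some y + s (z - y) lies in K, so z is a contraction
    of a point of K towards y by a factor in [1/2, 1]. Convexity of the ball keeps these points
    inside, and compactness of the parameters makes the set compact.\<close>
  define K' where "K' = (\<lambda>(s, k). y + (1 / s) *\<^sub>R (k - y)) ` ({1..2::real} \<times> K)"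
  have K'c: "compact K'" unfolding K'_def
    by (intro compact_continuous_image compact_Times K compact_Icc)
      (auto intro!: continuous_intros simp: case_prod_beta')
  have K'B: "K' \<subseteq> ?B"
  proof
    fix x assume "x \<in> K'"
    then obtain s k where sk: "1 \<le> s" "k \<in> K" "x = y + (1 / s) *\<^sub>R (k - y)" by (auto simp: K'_def)
    have "(1 - 1 / s) *\<^sub>R y + (1 / s) *\<^sub>R k \<in> ?B"
      by (rule convexD_alt[OF convex_ball y]) (use sk K in auto)
    also have "(1 - 1 / s) *\<^sub>R y + (1 / s) *\<^sub>R k = x" unfolding sk(3) by (simp add: algebra_simps)
    finally show "x \<in> ?B" .
  qed
  have p0: "p z = 0" if "z \<notin> K'" for z
  proof -
    have "s ^ (n - 1) * \<psi> (y + s *\<^sub>R (z - y)) = 0" if "s \<in> cbox 1 2" for s :: real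
    proof -
      have "y + s *\<^sub>R (z - y) \<notin> K"
      proof
        assume "y + s *\<^sub>R (z - y) \<in> K"
        moreover have "z = y + (1 / s) *\<^sub>R (y + s *\<^sub>R (z - y) - y)" using that by simp
        ultimately have "z \<in> K'" using that unfolding K'_def
          by (intro image_eqI[of _ _ "(s, y + s *\<^sub>R (z - y))"]) auto
        then show False using \<open>z \<notin> K'\<close> by simp
      qed
      then show ?thesis using K(3) by simp
    qed
    then have "p z = integral (cbox 1 2) (\<lambda>s::real. 0)"
      unfolding p_def by (rule integral_cong)
    then show ?thesis by simp
  qed
  have p_le: "\<bar>p z\<bar> \<le> 2 ^ (n - 1) * S" for z
  proof -
    have "norm (p z) \<le> integral (cbox 1 2) (\<lambda>s::real. 2 ^ (n - 1) * S)"
      unfolding p_def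
    proof (rule integral_norm_bound_integral)
      fix s :: real assume "s \<in> cbox 1 2"
      then show "norm (s ^ (n - 1) * \<psi> (y + s *\<^sub>R (z - y))) \<le> 2 ^ (n - 1) * S"
        using S by (auto simp: abs_mult power_abs intro!: mult_mono power_mono)
    qed (intro integrable_continuous continuous_intros pc)+
    then show ?thesis by simp
  qed
  define w where "w = (\<lambda>i x. indicator ?B x *\<^sub>R (G x \<bullet> i))"
  have wi: "integrable lebesgue (w i)" for i
  proof -
    have "integrable lebesgue (\<lambda>x. (indicat_real ?B x *\<^sub>R G x) \<bullet> i)"
      using G unfolding set_integrable_def by (intro integrable_inner_left)
    then show ?thesis by (simp add: w_def)
  qed
  have eq: "(\<integral>x. u x * (p' x i * ((x - y) \<bullet> i) + p x * (i \<bullet> i)) \<partial>lborel)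
      = - (\<integral>x. w i x * (p x * ((x - y) \<bullet> i)) \<partial>lebesgue)" if i: "i \<in> Basis" for i
  proof (rule weak_derivative_C1[OF u wi i, where U = ?B and K = K'
        and D = "\<lambda>x v. p' x v * ((x - y) \<bullet> i) + p x * (v \<bullet> i)"])
    show "(\<integral>x. u x * frechet_derivative \<phi> (at x) i \<partial>lborel) = - (\<integral>x. w i x * \<phi> x \<partial>lebesgue)" if "test_fun ?B \<phi>" for \<phi>
      using weak[OF that i] by (simp add: w_def set_lebesgue_integral_def mult_ac)
    show "((\<lambda>x. p x * ((x - y) \<bullet> i)) has_derivative (\<lambda>v. p' x v * ((x - y) \<bullet> i) + p x * (v \<bullet> i))) (at x)" for x
      by (auto intro!: derivative_eq_intros p')
    show "continuous_on UNIV (\<lambda>x. p' x v * ((x - y) \<bullet> i) + p x * (v \<bullet> i))" for v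
      by (intro continuous_intros p'c pcont)
  qed (use K'c K'B p0 in auto)
  \<comment> \<open>A crude bound by coordinates, used for integrability of the paired terms; the
    quantitative estimate is made on the full inner product.\<close>
  have bdd: "\<bar>(\<lambda>x. p x * ((x - y) \<bullet> i)) x\<bar> \<le> 2 ^ (n - 1) * S * (2 * r)" if i: "i \<in> Basis" for i x
  proof (cases "x \<in> ?B")
    case True
    have "\<bar>(x - y) \<bullet> i\<bar> \<le> norm (x - y)" by (rule Basis_le_norm[OF i])
    also have "\<dots> \<le> 2 * r" using y True by (simp add: dist_norm) norm
    finally show ?thesis using p_le[of x] by (auto simp: abs_mult intro!: mult_mono)
  next
    case False
    have "0 < r" using y by (metis ball_empty empty_iff linorder_not_le)
    moreover have "p x = 0" using False p0 K'B by blast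
    moreover have "0 \<le> S" using S[of 0] by linarith
    ultimately show ?thesis by simp
  qed
  have wpi: "integrable lebesgue (\<lambda>x. w i x * (p x * ((x - y) \<bullet> i)))" if i: "i \<in> Basis" for i
  proof (rule integrable_mult_bounded[OF wi _ bdd[OF i]])
    have "continuous_on UNIV (\<lambda>x. p x * ((x - y) \<bullet> i))"
      by (intro continuous_intros pcont)
    then show "(\<lambda>x. p x * ((x - y) \<bullet> i)) \<in> borel_measurable lebesgue"
      by (intro measurable_completion) (simp add: borel_measurable_continuous_onI)
  qed
  have ui: "integrable lborel (\<lambda>x. u x * (p' x i * ((x - y) \<bullet> i) + p x * (i \<bullet> i)))" if i: "i \<in> Basis" for i
  proof -
    let ?h = "\<lambda>x. p' x i * ((x - y) \<bullet> i) + p x * (i \<bullet> i)"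
    have hc: "continuous_on UNIV ?h" by (intro continuous_intros p'c pcont)
    have h0: "?h x = 0" if "x \<notin> K'" for x
      using p0[OF that] derivative_zero_outside_support[OF K'c p0 p' that] by simp
    obtain T where "\<And>x. \<bar>?h x\<bar> \<le> T"
      using bounded_compact_support[OF K'c h0 hc] by blast
    then show ?thesis
      by (intro integrable_mult_bounded[OF u]) (auto intro!: borel_measurable_continuous_onI hc)
  qed
  have "(\<integral>z. u z * (2 ^ n * \<psi> (y + 2 *\<^sub>R (z - y)) - \<psi> z) \<partial>lborel)
    = (\<integral>z. (\<Sum>i\<in>Basis. u z * (p' z i * ((z - y) \<bullet> i) + p z * (i \<bullet> i))) \<partial>lborel)"
    unfolding div[symmetric] sum_distrib_left ..
  also have "\<dots> = (\<Sum>i\<in>Basis. \<integral>z. u z * (p' z i * ((z - y) \<bullet> i) + p z * (i \<bullet> i)) \<partial>lborel)"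
    by (rule Bochner_Integration.integral_sum) (rule ui)
  also have "\<dots> = - (\<Sum>i\<in>Basis. \<integral>x. w i x * (p x * ((x - y) \<bullet> i)) \<partial>lebesgue)"
    unfolding sum_negf[symmetric] by (intro sum.cong refl eq)
  also have "(\<Sum>i\<in>Basis. \<integral>x. w i x * (p x * ((x - y) \<bullet> i)) \<partial>lebesgue)
    = (\<integral>x. (\<Sum>i\<in>Basis. w i x * (p x * ((x - y) \<bullet> i))) \<partial>lebesgue)"
    by (rule Bochner_Integration.integral_sum[symmetric]) (rule wpi)
  \<comment> \<open>Recombining the coordinates before estimating allows Cauchy-Schwarz and avoids a
    factor equal to the number of coordinates.\<close>
  also have "(\<lambda>x. \<Sum>i\<in>Basis. w i x * (p x * ((x - y) \<bullet> i))) = (\<lambda>x. indicator ?B x * (p x * (G x \<bullet> (x - y))))"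
    by (simp add: fun_eq_iff w_def euclidean_inner[of "G _" "_ - y"] sum_distrib_left mult_ac)
  finally have main: "\<bar>\<integral>z. u z * (2 ^ n * \<psi> (y + 2 *\<^sub>R (z - y)) - \<psi> z) \<partial>lborel\<bar>
      = \<bar>\<integral>x. indicator ?B x * (p x * (G x \<bullet> (x - y))) \<partial>lebesgue\<bar>" by simp
  also have "\<dots> \<le> (\<integral>x. 2 ^ n * r * S * (indicator ?B x *\<^sub>R norm (G x)) \<partial>lebesgue)"
  proof (rule integral_abs_bound_integral)
    have "integrable lebesgue (\<lambda>x. \<Sum>i\<in>Basis. w i x * (p x * ((x - y) \<bullet> i)))"
      by (rule Bochner_Integration.integrable_sum) (rule wpi)
    then show "integrable lebesgue (\<lambda>x. indicator ?B x * (p x * (G x \<bullet> (x - y))))"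
      by (simp add: w_def euclidean_inner[of "G _" "_ - y"] sum_distrib_left mult_ac)
    show "integrable lebesgue (\<lambda>x. 2 ^ n * r * S * (indicat_real ?B x *\<^sub>R norm (G x)))"
      using set_integrable_norm[OF G] unfolding set_integrable_def by simp
    fix x
    show "\<bar>indicator ?B x * (p x * (G x \<bullet> (x - y)))\<bar> \<le> 2 ^ n * r * S * (indicator ?B x *\<^sub>R norm (G x))"
    proof (cases "x \<in> ?B")
      case True
      have "\<bar>G x \<bullet> (x - y)\<bar> \<le> norm (G x) * norm (x - y)" by (rule Cauchy_Schwarz_ineq2)
      also have "\<dots> \<le> norm (G x) * (2 * r)"
        using y True by (intro mult_left_mono) (auto simp: dist_norm, norm)
      finally have "\<bar>p x\<bar> * \<bar>G x \<bullet> (x - y)\<bar> \<le> (2 ^ (n - 1) * S) * (norm (G x) * (2 * r))"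
        using p_le[of x] by (intro mult_mono) auto
      also have "\<dots> = 2 ^ n * r * S * norm (G x)"
        using n power_minus_mult[of n "2::real"] by (simp add: algebra_simps)
      finally show ?thesis using True by (simp add: abs_mult)
    qed simp
  qed
  also have "\<dots> = 2 ^ n * r * S * (LINT x:?B|lebesgue. norm (G x))"
    by (simp add: set_lebesgue_integral_def)
  finally show ?thesis by (simp add: n_def)
qed

text \<open>Keeping a double integral of differences leaves the choice of mean open, so that a
  weight can be inserted later. Each half of the segment from x to y costs 2^n r times the integral
  of |G|, and the other variable contributes the volume of the ball.\<close>

lemma poincare_ball:
  fixes u :: "'a::euclidean_space \<Rightarrow> real"
  assumes u: "integrable lborel u" and "r > 0" and G: "set_integrable lebesgue (ball x0 r) G"
    and weak: "\<And>\<phi> i. test_fun (ball x0 r) \<phi> \<Longrightarrow> i \<in> Basis \<Longrightarrow>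
      (\<integral>x. u x * frechet_derivative \<phi> (at x) i \<partial>lborel) = - (LINT x:ball x0 r|lebesgue. \<phi> x * (G x \<bullet> i))"
  shows "(\<integral>\<^sup>+y. \<integral>\<^sup>+x. indicator (ball x0 r) y * (indicator (ball x0 r) x * ennreal \<bar>u x - u y\<bar>) \<partial>lborel \<partial>lborel)
    \<le> ennreal (2 * 2 ^ DIM('a) * r * (LINT x:ball x0 r|lebesgue. norm (G x)) * measure lborel (ball x0 r))"
proof -
  let ?B = "ball x0 r"
  define g where "g = (LINT x:?B|lebesgue. norm (G x))"
  have "g \<ge> 0" unfolding g_def set_lebesgue_integral_def by (intro integral_nonneg_AE) auto
  define C where "C = 2 ^ DIM('a) * r * g"
  have "C \<ge> 0" using \<open>g \<ge> 0\<close> \<open>r > 0\<close> by (simp add: C_def)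
  have [measurable]: "u \<in> borel_measurable borel" using u by auto
  have [measurable]: "?B \<in> sets borel" by simp
  have mid: "(\<integral>\<^sup>+x. indicator ?B x * ennreal \<bar>u x - u ((1/2) *\<^sub>R (x + y))\<bar> \<partial>lborel) \<le> ennreal C"
    if y: "y \<in> ?B" for y
  proof -
    let ?u = "\<lambda>x. u ((1/2) *\<^sub>R (x + y))"
    have iu: "integrable lborel ?u"
      using lborel_integrable_affine[of "1/2" u "(1/2) *\<^sub>R y"] u by (simp add: algebra_simps)
    have i: "integrable lborel (\<lambda>x. u x - ?u x)"
      using u iu by simp
    have "(\<integral>x. indicat_real ?B x * \<bar>u x - ?u x\<bar> \<partial>lborel) \<le> C"
    proof (rule test_fun_duality[OF i \<open>C \<ge> 0\<close>])
      fix \<psi> :: "'a \<Rightarrow> real" and S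
      assume \<psi>: "test_fun ?B \<psi>" and S: "\<And>x. \<bar>\<psi> x\<bar> \<le> S"
      have [measurable]: "\<psi> \<in> borel_measurable borel"
        by (rule borel_measurable_continuous_onI[OF test_fun_continuous[OF \<psi>]])
      have i1: "integrable lborel (\<lambda>x. u x * \<psi> x)" "integrable lborel (\<lambda>x. ?u x * \<psi> x)"
        by (auto intro!: integrable_mult_bounded u iu S)
      have i2: "integrable lborel (\<lambda>z. u z * (2 ^ DIM('a) * \<psi> (y + 2 *\<^sub>R (z - y))))"
        by (rule integrable_mult_bounded[OF u, where S = "2 ^ DIM('a) * S"])
          (auto simp: abs_mult S)
      \<comment> \<open>The substitution x = 2z - y turns the midpoint of x and y into z, with
        Jacobian 2^n.\<close>
      have "(\<integral>x. ?u x * \<psi> x \<partial>lborel) = 2 ^ DIM('a) * (\<integral>z. ?u (- y + 2 *\<^sub>R z) * \<psi> (- y + 2 *\<^sub>R z) \<partial>lborel)"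
        using lborel_integral_affine[of 2 "\<lambda>x. ?u x * \<psi> x" "- y"] by simp
      also have "\<dots> = (\<integral>z. u z * (2 ^ DIM('a) * \<psi> (y + 2 *\<^sub>R (z - y))) \<partial>lborel)"
        unfolding integral_mult_right_zero[symmetric]
      proof (intro Bochner_Integration.integral_cong refl)
        fix z
        have "y + 2 *\<^sub>R (z - y) + y = z + z"
          by (simp add: algebra_simps scaleR_2)
        then have *: "- y + 2 *\<^sub>R z = y + 2 *\<^sub>R (z - y)" "(1/2) *\<^sub>R (y + 2 *\<^sub>R (z - y) + y) = z"
          by (simp_all only: scaleR_half_double) (simp add: algebra_simps scaleR_2)
        show "2 ^ DIM('a) * (?u (- y + 2 *\<^sub>R z) * \<psi> (- y + 2 *\<^sub>R z))
            = u z * (2 ^ DIM('a) * \<psi> (y + 2 *\<^sub>R (z - y)))"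
          unfolding * by (simp only: mult_ac)
      qed
      finally have "(\<integral>x. (u x - ?u x) * \<psi> x \<partial>lborel)
          = - (\<integral>z. u z * (2 ^ DIM('a) * \<psi> (y + 2 *\<^sub>R (z - y)) - \<psi> z) \<partial>lborel)"
        using i1 i2 by (simp add: left_diff_distrib right_diff_distrib)
      also have "\<dots> \<le> 2 ^ DIM('a) * r * S * g"
        using dilation_bound[OF u G weak y \<psi> S] unfolding g_def by linarith
      finally show "(\<integral>x. (u x - ?u x) * \<psi> x \<partial>lborel) \<le> C * S"
        by (simp add: C_def mult_ac)
    qed
    moreover have "(\<integral>\<^sup>+x. indicator ?B x * ennreal \<bar>u x - ?u x\<bar> \<partial>lborel)
        = (\<integral>\<^sup>+x. ennreal (indicat_real ?B x * \<bar>u x - ?u x\<bar>) \<partial>lborel)"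
      by (intro nn_integral_cong) (auto simp: indicator_def)
    moreover have "(\<integral>\<^sup>+x. ennreal (indicat_real ?B x * \<bar>u x - ?u x\<bar>) \<partial>lborel)
        = ennreal (\<integral>x. indicat_real ?B x * \<bar>u x - ?u x\<bar> \<partial>lborel)"
    proof (rule nn_integral_eq_integral)
      have "integrable lborel (\<lambda>x. \<bar>u x - ?u x\<bar> * indicat_real ?B x)"
        by (rule integrable_real_mult_indicator) (use i in auto)
      then show "integrable lborel (\<lambda>x. indicat_real ?B x * \<bar>u x - ?u x\<bar>)"
        by (simp only: mult.commute)
    qed simp
    ultimately show ?thesis by (simp add: ennreal_leI)
  qed
  let ?f = "\<lambda>y x. indicator ?B y * (indicator ?B x * ennreal \<bar>u x - u ((1/2) *\<^sub>R (x + y))\<bar>)"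
  have bound: "(\<integral>\<^sup>+y. \<integral>\<^sup>+x. ?f y x \<partial>lborel \<partial>lborel) \<le> ennreal (C * measure lborel ?B)"
  proof -
    have "(\<integral>\<^sup>+y. \<integral>\<^sup>+x. ?f y x \<partial>lborel \<partial>lborel)
      = (\<integral>\<^sup>+y. indicator ?B y * (\<integral>\<^sup>+x. indicator ?B x * ennreal \<bar>u x - u ((1/2) *\<^sub>R (x + y))\<bar> \<partial>lborel) \<partial>lborel)"
      by (intro nn_integral_cong nn_integral_cmult) measurable
    also have "\<dots> \<le> (\<integral>\<^sup>+y. ennreal C * indicator ?B y \<partial>lborel)"
      using mid by (intro nn_integral_mono) (auto simp: indicator_def)
    also have "\<dots> = ennreal C * emeasure lborel ?B"
      by (simp add: nn_integral_cmult_indicator)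
    also have "\<dots> = ennreal (C * measure lborel ?B)"
      using \<open>C \<ge> 0\<close> emeasure_lborel_ball_finite[of x0 r]
      by (subst emeasure_eq_ennreal_measure) (auto simp: ennreal_mult top_unique)
    finally show ?thesis .
  qed
  \<comment> \<open>The midpoint is symmetric in x and y, so the second half of the triangle
    inequality is the first with the variables exchanged.\<close>
  have swap: "(\<integral>\<^sup>+y. \<integral>\<^sup>+x. ?f x y \<partial>lborel \<partial>lborel) = (\<integral>\<^sup>+y. \<integral>\<^sup>+x. ?f y x \<partial>lborel \<partial>lborel)"
    by (rule lborel_pair.Fubini') measurable
  have "(\<integral>\<^sup>+y. \<integral>\<^sup>+x. indicator ?B y * (indicator ?B x * ennreal \<bar>u x - u y\<bar>) \<partial>lborel \<partial>lborel)
    \<le> (\<integral>\<^sup>+y. \<integral>\<^sup>+x. ?f y x + ?f x y \<partial>lborel \<partial>lborel)"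
  proof (intro nn_integral_mono)
    fix x y
    have "\<bar>u x - u y\<bar> \<le> \<bar>u x - u ((1/2) *\<^sub>R (x + y))\<bar> + \<bar>u y - u ((1/2) *\<^sub>R (y + x))\<bar>"
      by (simp add: add.commute[of y x])
    then have "ennreal \<bar>u x - u y\<bar> \<le> ennreal \<bar>u x - u ((1/2) *\<^sub>R (x + y))\<bar> + ennreal \<bar>u y - u ((1/2) *\<^sub>R (y + x))\<bar>"
      by (simp add: ennreal_plus[symmetric] ennreal_leI del: ennreal_plus)
    then show "indicator ?B y * (indicator ?B x * ennreal \<bar>u x - u y\<bar>) \<le> ?f y x + ?f x y"
      by (auto simp: indicator_def)
  qed
  also have "\<dots> = (\<integral>\<^sup>+y. (\<integral>\<^sup>+x. ?f y x \<partial>lborel) + (\<integral>\<^sup>+x. ?f x y \<partial>lborel) \<partial>lborel)"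
    by (intro nn_integral_cong nn_integral_add) measurable
  also have "\<dots> = (\<integral>\<^sup>+y. \<integral>\<^sup>+x. ?f y x \<partial>lborel \<partial>lborel) + (\<integral>\<^sup>+y. \<integral>\<^sup>+x. ?f x y \<partial>lborel \<partial>lborel)"
    by (intro nn_integral_add) measurable
  also have "\<dots> \<le> ennreal (C * measure lborel ?B) + ennreal (C * measure lborel ?B)"
    unfolding swap by (intro add_mono bound)
  also have "\<dots> = ennreal (2 * 2 ^ DIM('a) * r * g * measure lborel ?B)"
  proof -
    have "2 * 2 ^ DIM('a) * r * g * measure lborel ?B = C * measure lborel ?B + C * measure lborel ?B"
      by (simp add: C_def)
    also have "ennreal \<dots> = ennreal (C * measure lborel ?B) + ennreal (C * measure lborel ?B)"
      using \<open>C \<ge> 0\<close> by (intro ennreal_plus) auto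
    finally show ?thesis ..
  qed
  finally show ?thesis by (simp add: g_def)
qed

section \<open>Testing the time derivative\<close>

lemma supn_le: "(\<And>z. norm (f z) \<le> c) \<Longrightarrow> supn f \<le> ereal c"
  unfolding supn_def by (rule SUP_least) simp

text \<open>Normalises a test function by any positive upper bound \<open>L\<close> of its norm. The
  gradient is estimated by the sum of its partial derivatives, whence the factor
  \<open>DIM('a)\<close>.\<close>

lemma scaled_test_fun_in_FQ:
  fixes \<psi> :: "real \<times> 'a::euclidean_space \<Rightarrow> real" and \<alpha> r L L1 L2 L3 :: real
  assumes \<psi>: "test_fun (par_cyl \<alpha> r t0 x0) \<psi>" and "\<alpha> > 0" "r > 0"
    and L1: "\<And>z. \<bar>\<psi> z\<bar> \<le> L1"
    and L2: "\<And>z i. i \<in> Basis \<Longrightarrow> \<bar>frechet_derivative \<psi> (at z) (0, i)\<bar> \<le> L2"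
    and L3: "\<And>z. \<bar>dt \<psi> z\<bar> \<le> L3"
    and L: "L1 + r * (DIM('a) * L2) + \<alpha> * r\<^sup>2 * L3 \<le> L" "L > 0"
  shows "(\<lambda>z. (1 / L) * \<psi> z) \<in> FQ \<alpha> r t0 x0" "dt (\<lambda>z. (1 / L) * \<psi> z) = (\<lambda>z. (1 / L) * dt \<psi> z)"
proof -
  let ?\<xi> = "\<lambda>z. (1 / L) * \<psi> z"
  have sm: "smooth \<psi>" using \<psi> by (simp add: test_fun_def)
  have D: "frechet_derivative ?\<xi> (at z) = (\<lambda>v. (1 / L) * frechet_derivative \<psi> (at z) v)" for z
    by (rule frechet_derivative_at[symmetric]) (intro has_derivative_mult_right smooth_has_derivative sm)
  show dt: "dt ?\<xi> = (\<lambda>z. (1 / L) * dt \<psi> z)"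
    unfolding dt_def D ..
  have "test_fun (par_cyl \<alpha> r t0 x0) ?\<xi>"
  proof -
    obtain K where "compact K" "K \<subseteq> par_cyl \<alpha> r t0 x0" "\<And>z. z \<notin> K \<Longrightarrow> \<psi> z = 0"
      using \<psi> by (auto simp: test_fun_def)
    then show ?thesis
      unfolding test_fun_def using smooth_cmult[OF sm, of "1 / L"] by (auto intro!: exI[of _ K])
  qed
  moreover have "supn ?\<xi> \<le> ereal (L1 / L)"
    by (rule supn_le) (use L1 L in \<open>auto simp: divide_right_mono\<close>)
  moreover have "supn (dt ?\<xi>) \<le> ereal (L3 / L)"
    unfolding dt by (rule supn_le) (use L3 L in \<open>auto simp: divide_right_mono\<close>)
  moreover have "supn (grad_x ?\<xi>) \<le> ereal (DIM('a) * L2 / L)"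
  proof (rule supn_le)
    fix z
    have "norm (grad_x ?\<xi> z) \<le> (\<Sum>i\<in>(Basis::'a set). norm (frechet_derivative ?\<xi> (at z) (0, i) *\<^sub>R i))"
      unfolding grad_x_def by (rule norm_sum)
    also have "\<dots> \<le> (\<Sum>i\<in>(Basis::'a set). L2 / L)"
      using L2[of _ z] L(2) by (intro sum_mono) (simp only: D, auto simp: divide_right_mono)
    finally show "norm (grad_x ?\<xi> z) \<le> DIM('a) * L2 / L" by simp
  qed
  ultimately have "supn ?\<xi> + ereal r * supn (grad_x ?\<xi>) + ereal (\<alpha> * r\<^sup>2) * supn (dt ?\<xi>)
      \<le> ereal (L1 / L) + ereal r * ereal (DIM('a) * L2 / L) + ereal (\<alpha> * r\<^sup>2) * ereal (L3 / L)"
    using \<open>\<alpha> > 0\<close> \<open>r > 0\<close> by (intro add_mono ereal_mult_left_mono) auto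
  also have "\<dots> = ereal ((L1 + r * (DIM('a) * L2) + \<alpha> * r\<^sup>2 * L3) / L)"
    by (simp add: add_divide_distrib)
  also have "\<dots> \<le> 1"
    using L by (simp add: one_ereal_def)
  finally show "?\<xi> \<in> FQ \<alpha> r t0 x0"
    using \<open>test_fun (par_cyl \<alpha> r t0 x0) ?\<xi>\<close> by (simp add: FQ_def)
qed

lemma open_par_cyl: "open (par_cyl \<alpha> r t0 x0)"
  by (simp add: par_cyl_def open_Times)

text \<open>Homogeneity turns the supremum over normalised functions into a bound for arbitrary
  ones, with |Q|/r inverting the prefactor of the seminorm. Approximation within \<epsilon> of
  values and partial derivatives raises the bound \<open>L\<close> by \<open>\<epsilon> * c\<close>,
  which disappears as \<epsilon> tends to 0.\<close>

lemma NQ_dt_bound_C1: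
  fixes a f :: "real \<times> 'a::euclidean_space \<Rightarrow> real" and \<alpha> r N L1 L2 L3 :: real
  assumes "\<alpha> > 0" "r > 0" and a: "set_integrable lebesgue (par_cyl \<alpha> r t0 x0) a"
    and Q: "measure lebesgue (par_cyl \<alpha> r t0 x0) > 0"
    and N: "NQ_dt \<alpha> r t0 x0 a \<le> ereal N"
    and K: "compact K" "K \<subseteq> par_cyl \<alpha> r t0 x0" "\<And>z. z \<notin> K \<Longrightarrow> f z = 0"
    and D: "\<And>z. (f has_derivative D z) (at z)"
    and cont_D: "\<And>v. v \<in> Basis \<Longrightarrow> continuous_on UNIV (\<lambda>z. D z v)"
    and L1: "\<And>z. \<bar>f z\<bar> \<le> L1"
    and L2: "\<And>z i. i \<in> Basis \<Longrightarrow> \<bar>D z (0, i)\<bar> \<le> L2"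
    and L3: "\<And>z. \<bar>D z (1, 0)\<bar> \<le> L3"
  shows "\<bar>LINT z:par_cyl \<alpha> r t0 x0|lebesgue. a z * D z (1, 0)\<bar>
    \<le> measure lebesgue (par_cyl \<alpha> r t0 x0) / r * (L1 + r * (DIM('a) * L2) + \<alpha> * r\<^sup>2 * L3) * N"
proof -
  let ?Q = "par_cyl \<alpha> r t0 x0"
  define L where "L = L1 + r * (DIM('a) * L2) + \<alpha> * r\<^sup>2 * L3"
  have "L1 \<ge> 0" using L1 abs_ge_zero order_trans by blast
  moreover have "L2 \<ge> 0" using L2[OF SOME_Basis] abs_ge_zero order_trans by blast
  moreover have "L3 \<ge> 0" using L3 abs_ge_zero order_trans by blast
  ultimately have "L \<ge> 0" using \<open>\<alpha> > 0\<close> \<open>r > 0\<close> by (simp add: L_def)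
  define c where "c = 1 + r * DIM('a) + \<alpha> * r\<^sup>2"
  have "c > 0" using \<open>\<alpha> > 0\<close> \<open>r > 0\<close> unfolding c_def by (intro add_pos_nonneg) auto
  define v where "v = (\<lambda>z. indicator ?Q z * a z)"
  have v: "integrable lebesgue v" using a by (simp add: v_def set_integrable_def)
  define A where "A = (\<integral>z. \<bar>v z\<bar> \<partial>lebesgue)"
  have "A \<ge> 0" by (simp add: A_def)
  define q where "q = measure lebesgue ?Q / r"
  have "q > 0" using Q \<open>r > 0\<close> by (simp add: q_def)
  have t: "(1, 0) \<in> (Basis :: (real \<times> 'a) set)" by (simp add: Basis_prod_def)
  have x: "(0, i) \<in> (Basis :: (real \<times> 'a) set)" if "i \<in> Basis" for i
    using that by (simp add: Basis_prod_def)
  have "\<bar>\<integral>z. v z * D z (1, 0) \<partial>lebesgue\<bar> \<le> q * L * N + e" if "e > 0" for e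
  proof -
    \<comment> \<open>\<open>J\<close> collects the coefficients of \<epsilon>: the growth of the
      norm bound and the L1 error of replacing the time derivative. \<open>N\<close> may have either
      sign here, hence the absolute value.\<close>
    define J where "J = q * c * \<bar>N\<bar> + A + 1"
    have "J > 0" using \<open>q > 0\<close> \<open>c > 0\<close> \<open>A \<ge> 0\<close> by (simp add: J_def add_nonneg_pos)
    define \<epsilon> where "\<epsilon> = e / J"
    have \<epsilon>: "\<epsilon> > 0" "\<epsilon> * J = e" using \<open>J > 0\<close> \<open>e > 0\<close> by (auto simp: \<epsilon>_def)
    obtain \<psi> where \<psi>: "test_fun ?Q \<psi>" "\<And>x. \<bar>\<psi> x - f x\<bar> \<le> \<epsilon>"
      "\<And>x v. v \<in> Basis \<Longrightarrow> \<bar>frechet_derivative \<psi> (at x) v - D x v\<bar> \<le> \<epsilon>"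
      using test_fun_approx_C1[OF open_par_cyl K D cont_D \<epsilon>(1)] by blast
    have sm: "smooth \<psi>" using \<psi>(1) by (simp add: test_fun_def)
    have L1': "\<bar>\<psi> z\<bar> \<le> L1 + \<epsilon>" for z using \<psi>(2)[of z] L1[of z] by linarith
    have L2': "\<bar>frechet_derivative \<psi> (at z) (0, i)\<bar> \<le> L2 + \<epsilon>" if "i \<in> Basis" for z i
      using \<psi>(3)[OF x[OF that], of z] L2[OF that, of z] by linarith
    have L3': "\<bar>dt \<psi> z\<bar> \<le> L3 + \<epsilon>" for z
      unfolding dt_def using \<psi>(3)[OF t, of z] L3[of z] by linarith
    \<comment> \<open>\<open>L\<close> itself may be 0; the added term makes the division
      legitimate.\<close>
    have pos: "L + \<epsilon> * c > 0" using \<open>L \<ge> 0\<close> \<epsilon>(1) \<open>c > 0\<close> by (simp add: add_nonneg_pos)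
    have Lle: "(L1 + \<epsilon>) + r * (DIM('a) * (L2 + \<epsilon>)) + \<alpha> * r\<^sup>2 * (L3 + \<epsilon>) \<le> L + \<epsilon> * c"
      by (simp add: L_def c_def algebra_simps)
    define \<xi> where "\<xi> = (\<lambda>z. (1 / (L + \<epsilon> * c)) * \<psi> z)"
    note \<xi> = scaled_test_fun_in_FQ[OF \<psi>(1) \<open>\<alpha> > 0\<close> \<open>r > 0\<close> L1' L2' L3' Lle pos, folded \<xi>_def]
    have "ereal (r / measure lebesgue ?Q * \<bar>- (LINT z:?Q|lebesgue. a z * dt \<xi> z)\<bar>) \<le> NQ_dt \<alpha> r t0 x0 a"
      unfolding NQ_dt_def by (rule SUP_upper[OF \<xi>(1)])
    then have "r / measure lebesgue ?Q * \<bar>- (LINT z:?Q|lebesgue. a z * dt \<xi> z)\<bar> \<le> N"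
      using N order_trans ereal_less_eq(3) by blast
    also have "(LINT z:?Q|lebesgue. a z * dt \<xi> z) = (\<integral>z. (1 / (L + \<epsilon> * c)) * (v z * dt \<psi> z) \<partial>lebesgue)"
      unfolding set_lebesgue_integral_def
    proof (rule Bochner_Integration.integral_cong[OF refl])
      fix z
      have "dt \<xi> z = (1 / (L + \<epsilon> * c)) * dt \<psi> z" by (rule fun_cong[OF \<xi>(2)])
      then show "indicat_real ?Q z *\<^sub>R (a z * dt \<xi> z) = (1 / (L + \<epsilon> * c)) * (v z * dt \<psi> z)"
        unfolding v_def by (simp add: mult_ac)
    qed
    also have "\<dots> = (1 / (L + \<epsilon> * c)) * (\<integral>z. v z * dt \<psi> z \<partial>lebesgue)"
      by (rule integral_mult_right_zero)
    finally have "r / measure lebesgue ?Q * ((1 / (L + \<epsilon> * c)) * \<bar>\<integral>z. v z * dt \<psi> z \<partial>lebesgue\<bar>) \<le> N"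
      using pos by (simp add: abs_mult)
    then have "q * (L + \<epsilon> * c) * (r / measure lebesgue ?Q * ((1 / (L + \<epsilon> * c)) * \<bar>\<integral>z. v z * dt \<psi> z \<partial>lebesgue\<bar>))
        \<le> q * (L + \<epsilon> * c) * N"
      using pos \<open>q > 0\<close> by (intro mult_left_mono) auto
    then have b: "\<bar>\<integral>z. v z * dt \<psi> z \<partial>lebesgue\<bar> \<le> q * (L + \<epsilon> * c) * N"
      using pos Q \<open>r > 0\<close> by (simp add: q_def)
    have fc: "continuous_on UNIV (\<lambda>z. D z (1, 0))" by (rule cont_D[OF t])
    have m: "(\<lambda>z. D z (1, 0)) \<in> borel_measurable lebesgue" "dt \<psi> \<in> borel_measurable lebesgue"
      unfolding dt_def
      by (intro measurable_completion,
          simp add: borel_measurable_continuous_onI fc smooth_continuous_on smooth_frechet_derivative sm)+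
    have "\<bar>(\<integral>z. v z * dt \<psi> z \<partial>lebesgue) - (\<integral>z. v z * D z (1, 0) \<partial>lebesgue)\<bar> \<le> \<epsilon> * A"
      unfolding A_def
      by (intro integral_mult_close v integrable_mult_bounded[OF v m(1) L3] integrable_mult_bounded[OF v m(2) L3'])
        (use \<psi>(3)[OF t] in \<open>simp add: dt_def\<close>)
    then have "\<bar>\<integral>z. v z * D z (1, 0) \<partial>lebesgue\<bar> \<le> q * (L + \<epsilon> * c) * N + \<epsilon> * A"
      using b by linarith
    also have "\<dots> = q * L * N + \<epsilon> * (q * c * N + A)" by (simp add: algebra_simps)
    also have "\<dots> \<le> q * L * N + \<epsilon> * J"
    proof -
      have "q * c * N \<le> q * c * \<bar>N\<bar>"
        using \<open>q > 0\<close> \<open>c > 0\<close> by (intro mult_left_mono) auto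
      then show ?thesis
        unfolding J_def using \<epsilon>(1) by (intro add_left_mono mult_left_mono) linarith+
    qed
    finally show ?thesis using \<epsilon> by simp
  qed
  then have "\<bar>\<integral>z. v z * D z (1, 0) \<partial>lebesgue\<bar> \<le> q * L * N"
    by (rule field_le_epsilon)
  then show ?thesis
    by (simp add: v_def q_def L_def set_lebesgue_integral_def mult.assoc)
qed

text \<open>Subtracting from \<psi> a multiple of a fixed density \<omega> gives a function of mean
  zero, hence the derivative of an admissible \<theta>. By duality the same correction amounts to
  subtracting from m its \<omega>-mean, which is the constant \<open>k\<close>. The 9 is 1 + 8: the
  correction is at most (4/h)(2hS) = 8S.\<close>

lemma time_oscillation:
  fixes m :: "real \<Rightarrow> real"
  assumes m: "integrable lborel m" and "h > 0" "M \<ge> 0"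
    and bound: "\<And>\<theta> \<theta>' K S. compact K \<Longrightarrow> K \<subseteq> ball t0 h \<Longrightarrow> (\<And>t. t \<notin> K \<Longrightarrow> \<theta> t = 0) \<Longrightarrow>
      (\<And>t. (\<theta> has_real_derivative \<theta>' t) (at t)) \<Longrightarrow> continuous_on UNIV \<theta>' \<Longrightarrow>
      (\<And>t. \<bar>\<theta>' t\<bar> \<le> S) \<Longrightarrow> (\<And>t. \<bar>\<theta> t\<bar> \<le> 2 * h * S) \<Longrightarrow> \<bar>\<integral>t. m t * \<theta>' t \<partial>lborel\<bar> \<le> M * S"
  shows "\<exists>k. (\<integral>t. indicat_real (ball t0 h) t * \<bar>m t - k\<bar> \<partial>lborel) \<le> 9 * M"
proof -
  have meas_ball: "measure lborel (cball t0 d) = 2 * d" if "d \<ge> 0" for d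
    using that by (simp add: cball_eq_atLeastAtMost)
  \<comment> \<open>A tent supported in the half interval. It is at least 1/2 on an interval of
    length h/2, which gives the lower bound h/4 for its integral.\<close>
  define w where "w = (\<lambda>t. max 0 (1 - 2 * \<bar>t - t0\<bar> / h))"
  have wc: "continuous_on UNIV w" unfolding w_def by (intro continuous_intros) (use \<open>h > 0\<close> in auto)
  have w0: "w t = 0" if "t \<notin> cball t0 (h / 2)" for t
  proof -
    have "h < 2 * \<bar>t - t0\<bar>" using that by (simp add: dist_real_def abs_minus_commute)
    then show ?thesis using \<open>h > 0\<close> by (simp add: w_def)
  qed
  have w1: "0 \<le> w t" "w t \<le> 1" for t using \<open>h > 0\<close> by (auto simp: w_def)
  have wi: "integrable lborel w"
    by (rule integrable_lborel_compact_support[OF compact_cball w0 wc])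
  define c where "c = (\<integral>t. w t \<partial>lborel)"
  have c: "h / 4 \<le> c"
  proof -
    have "(\<integral>t. (1 / 2) * indicat_real (cball t0 (h / 4)) t \<partial>lborel) \<le> c"
      unfolding c_def
    proof (rule integral_mono)
      show "integrable lborel (\<lambda>t. (1 / 2) * indicat_real (cball t0 (h / 4)) t)"
        by (intro integrable_mult_right integrable_real_indicator)
          (use emeasure_lborel_cball_finite in \<open>auto simp: less_top\<close>)
      show "(1 / 2) * indicat_real (cball t0 (h / 4)) t \<le> w t" for t
      proof (cases "t \<in> cball t0 (h / 4)")
        case True
        then have "2 * \<bar>t - t0\<bar> / h \<le> 1 / 2"
          using \<open>h > 0\<close> by (simp add: dist_real_def abs_minus_commute field_simps)
        then show ?thesis using True by (simp add: w_def)
      qed (use w1 in auto)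
    qed (rule wi)
    then show ?thesis using meas_ball[of "h / 4"] \<open>h > 0\<close> by simp
  qed
  then have "c > 0" using \<open>h > 0\<close> by linarith
  define \<omega> where "\<omega> = (\<lambda>t. w t / c)"
  have \<omega>c: "continuous_on UNIV \<omega>" unfolding \<omega>_def by (intro continuous_intros wc) (use \<open>c > 0\<close> in auto)
  have \<omega>b: "\<bar>\<omega> t\<bar> \<le> 4 / h" for t
  proof -
    have "\<bar>\<omega> t\<bar> \<le> 1 / c" using w1[of t] \<open>c > 0\<close> by (simp add: \<omega>_def divide_right_mono)
    also have "\<dots> \<le> 1 / (h / 4)" using c \<open>h > 0\<close> by (intro divide_left_mono) auto
    finally show ?thesis by simp
  qed
  have \<omega>i: "integrable lborel \<omega>" "(\<integral>t. \<omega> t \<partial>lborel) = 1"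
    using wi \<open>c > 0\<close> by (auto simp: \<omega>_def c_def)
  have m\<omega>: "integrable lborel (\<lambda>t. m t * \<omega> t)"
    by (rule integrable_mult_bounded[OF m _ \<omega>b]) (use \<omega>i in auto)
  define k where "k = (\<integral>t. m t * \<omega> t \<partial>lborel)"
  have [measurable]: "ball t0 h \<in> sets lborel" by simp
  \<comment> \<open>The cutoff restores integrability, as a nonzero constant is not integrable on
    the line; test functions supported in the interval do not see it.\<close>
  define v where "v = (\<lambda>t. indicat_real (ball t0 h) t * (m t - k))"
  have v: "integrable lborel v"
  proof -
    have "integrable lborel (\<lambda>t. m t * indicat_real (ball t0 h) t - k * indicat_real (ball t0 h) t)"
    proof (rule Bochner_Integration.integrable_diff)
      show "integrable lborel (\<lambda>t. m t * indicat_real (ball t0 h) t)"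
        by (rule integrable_real_mult_indicator[OF _ m]) simp
      show "integrable lborel (\<lambda>t. k * indicat_real (ball t0 h) t)"
        by (intro integrable_mult_right integrable_real_indicator) (use emeasure_lborel_ball_finite in auto)
    qed
    then show ?thesis by (simp add: v_def algebra_simps)
  qed
  have "(\<integral>t. indicat_real (ball t0 h) t * \<bar>v t\<bar> \<partial>lborel) \<le> 9 * M"
  proof (rule test_fun_duality[OF v])
    fix \<psi> :: "real \<Rightarrow> real" and S
    assume \<psi>: "test_fun (ball t0 h) \<psi>" and S: "\<And>t. \<bar>\<psi> t\<bar> \<le> S"
    have "S \<ge> 0" using S[of 0] by linarith
    obtain K0 where K0: "compact K0" "K0 \<subseteq> ball t0 h" "\<And>t. t \<notin> K0 \<Longrightarrow> \<psi> t = 0"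
      using \<psi> by (auto simp: test_fun_def)
    have \<psi>0: "\<psi> t = 0" if "t \<notin> ball t0 h" for t
      using that K0(2,3) by blast
    have \<psi>c: "continuous_on UNIV \<psi>" by (rule test_fun_continuous[OF \<psi>])
    have \<psi>i: "integrable lborel \<psi>"
      by (rule integrable_lborel_compact_support[OF K0(1,3) \<psi>c])
    define J where "J = (\<integral>t. \<psi> t \<partial>lborel)"
    have J: "\<bar>J\<bar> \<le> 2 * h * S"
    proof -
      have "\<bar>J\<bar> \<le> (\<integral>t. S * indicat_real (cball t0 h) t \<partial>lborel)"
        unfolding J_def
      proof (rule integral_abs_bound_integral[OF \<psi>i])
        show "integrable lborel (\<lambda>t. S * indicat_real (cball t0 h) t)"
          by (intro integrable_mult_right integrable_real_indicator) (use emeasure_lborel_cball_finite in \<open>auto simp: less_top\<close>)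
        show "\<bar>\<psi> t\<bar> \<le> S * indicat_real (cball t0 h) t" for t
          using S[of t] \<psi>0[of t] by (cases "t \<in> cball t0 h") auto
      qed
      then show ?thesis using meas_ball[of h] \<open>h > 0\<close> by (simp add: mult_ac)
    qed
    define f where "f = (\<lambda>t. \<psi> t - \<omega> t * J)"
    have fc: "continuous_on UNIV f" unfolding f_def by (intro continuous_intros \<psi>c \<omega>c)
    have fi: "integrable lborel f" "(\<integral>t. f t \<partial>lborel) = 0"
      using \<psi>i \<omega>i by (auto simp: f_def J_def)
    have fb: "\<bar>f t\<bar> \<le> 9 * S" for t
    proof -
      have "\<bar>\<omega> t * J\<bar> \<le> 4 / h * (2 * h * S)"
        unfolding abs_mult using \<omega>b[of t] J \<open>h > 0\<close> by (intro mult_mono) auto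
      then show ?thesis using S[of t] \<open>h > 0\<close> unfolding f_def by simp
    qed
    define K where "K = insert t0 (K0 \<union> cball t0 (h / 2))"
    have K: "compact K" "K \<subseteq> ball t0 h" "K \<noteq> {}"
      using K0(1,2) \<open>h > 0\<close> unfolding K_def
      by (intro compact_insert compact_Un compact_cball, auto simp: dist_real_def)
    have f0: "f t = 0" if "t \<notin> K" for t
      using that K0(3)[of t] w0[of t] by (auto simp: K_def f_def \<omega>_def)
    \<comment> \<open>The primitive is supported in the hull [p, q] rather than in \<open>K\<close>:
      across a gap of \<open>K\<close> it may be a nonzero constant. The hull is still a compact
      part of the open interval.\<close>
    obtain p where p: "p \<in> K" "\<And>t. t \<in> K \<Longrightarrow> p \<le> t"
      using compact_attains_inf[OF K(1,3)] by blast
    obtain q where q: "q \<in> K" "\<And>t. t \<in> K \<Longrightarrow> t \<le> q"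
      using compact_attains_sup[OF K(1,3)] by blast
    have pq: "t0 - h < p" "q < t0 + h" "p \<le> q"
      using p q K(2) by (auto simp: subset_iff dist_real_def abs_less_iff)
    have "\<exists>F. \<forall>x::real. - \<infinity> < ereal x \<longrightarrow> ereal x < \<infinity> \<longrightarrow> (F has_vector_derivative f x) (at x)"
      using fc by (intro einterval_antiderivative) (auto simp: continuous_on_eq_continuous_within)
    then obtain F where F: "\<And>t. (F has_real_derivative f t) (at t)"
      by (auto simp: has_real_derivative_iff_has_vector_derivative)
    have left: "F t = F (t0 - h)" if "t < p" for t
    proof -
      have "\<exists>c. \<forall>x\<in>{..<p}. F x = c"
      proof (rule has_field_derivative_zero_constant)
        show "(F has_real_derivative 0) (at x within {..<p})" if "x \<in> {..<p}" for x
        proof -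
          have "f x = 0" using f0 p(2)[of x] that by force
          then show ?thesis using F[of x] by (simp add: has_field_derivative_at_within)
        qed
      qed simp
      then show ?thesis using that pq(1) by (metis lessThan_iff)
    qed
    have right: "F t = F (t0 + h)" if "q < t" for t
    proof -
      have "\<exists>c. \<forall>x\<in>{q<..}. F x = c"
      proof (rule has_field_derivative_zero_constant)
        show "(F has_real_derivative 0) (at x within {q<..})" if "x \<in> {q<..}" for x
        proof -
          have "f x = 0" using f0 q(2)[of x] that by force
          then show ?thesis using F[of x] by (simp add: has_field_derivative_at_within)
        qed
      qed simp
      then show ?thesis using that pq(2) by (metis greaterThan_iff)
    qed
    have "(f has_integral (F (t0 + h) - F (t0 - h))) {t0 - h..t0 + h}"
      using \<open>h > 0\<close> F
      by (intro fundamental_theorem_of_calculus)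
        (auto simp: has_real_derivative_iff_has_vector_derivative[symmetric] intro: has_field_derivative_at_within)
    then have "F (t0 + h) - F (t0 - h) = integral (cbox (t0 - h) (t0 + h)) f"
      by (simp add: integral_unique)
    also have "\<dots> = (\<integral>t. f t \<partial>lborel)"
      by (rule integral_cbox_eq_lborel[OF _ fc]) (rule f0, use K(2) in \<open>auto simp: subset_iff dist_real_def abs_less_iff\<close>)
    \<comment> \<open>Mean zero makes the constant values of the primitive on the two sides of
      [p, q] agree, so one subtraction kills both.\<close>
    finally have Feq: "F (t0 + h) = F (t0 - h)" using fi by simp
    define \<theta> where "\<theta> = (\<lambda>t. F t - F (t0 - h))"
    have "\<bar>\<integral>t. m t * f t \<partial>lborel\<bar> \<le> M * (9 * S)"
    proof (rule bound)
      show "compact {p..q}" by simp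
      show "{p..q} \<subseteq> ball t0 h" using pq by (auto simp: dist_real_def)
      show \<theta>0: "\<theta> t = 0" if "t \<notin> {p..q}" for t
        using that left[of t] right[of t] Feq by (auto simp: \<theta>_def)
      show "(\<theta> has_real_derivative f t) (at t)" for t
        unfolding \<theta>_def using F[of t] by (auto intro!: derivative_eq_intros)
      show "\<bar>\<theta> t\<bar> \<le> 2 * h * (9 * S)" for t
      proof (cases "t \<in> {p..q}")
        case True
        have "norm (F t - F (t0 - h)) \<le> 9 * S * norm (t - (t0 - h))"
          by (rule field_differentiable_bound[of UNIV F f]) (use F fb in auto)
        also have "\<dots> \<le> 9 * S * (2 * h)"
          using True pq \<open>S \<ge> 0\<close> by (intro mult_left_mono) auto
        finally show ?thesis by (simp add: \<theta>_def mult_ac)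
      next
        case False
        then show ?thesis using \<theta>0 \<open>h > 0\<close> \<open>S \<ge> 0\<close> by simp
      qed
    qed (use fc fb in auto)
    moreover have "(\<integral>t. v t * \<psi> t \<partial>lborel) = (\<integral>t. m t * f t \<partial>lborel)"
    proof -
      have m\<psi>: "integrable lborel (\<lambda>t. m t * \<psi> t)"
        by (rule integrable_mult_bounded[OF m _ S]) (use \<psi>i in auto)
      have "(\<integral>t. v t * \<psi> t \<partial>lborel) = (\<integral>t. m t * \<psi> t - k * \<psi> t \<partial>lborel)"
      proof (intro Bochner_Integration.integral_cong refl)
        fix t
        show "v t * \<psi> t = m t * \<psi> t - k * \<psi> t"
          using \<psi>0[of t] by (cases "t \<in> ball t0 h") (auto simp: v_def algebra_simps)
      qed
      also have "\<dots> = (\<integral>t. m t * \<psi> t \<partial>lborel) - k * J"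
        using m\<psi> \<psi>i by (simp add: J_def)
      also have "\<dots> = (\<integral>t. m t * \<psi> t - (m t * \<omega> t) * J \<partial>lborel)"
        using m\<psi> m\<omega> by (simp add: k_def)
      finally show ?thesis by (simp add: f_def right_diff_distrib mult_ac)
    qed
    ultimately show "(\<integral>t. v t * \<psi> t \<partial>lborel) \<le> 9 * M * S" by linarith
  qed (use \<open>M \<ge> 0\<close> in auto)
  moreover have "(\<integral>t. indicat_real (ball t0 h) t * \<bar>v t\<bar> \<partial>lborel)
      = (\<integral>t. indicat_real (ball t0 h) t * \<bar>m t - k\<bar> \<partial>lborel)"
    by (intro Bochner_Integration.integral_cong refl) (auto simp: v_def indicator_def)
  ultimately show ?thesis by auto
qed

section \<open>The parabolic inequality\<close>

text \<open>The squared positive part is an elementary C1 profile with explicit derivative; it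
  supplies a cutoff whose gradient and mass can be computed by hand.\<close>

lemma max_0_square_has_real_derivative:
  "((\<lambda>s::real. (max 0 s)\<^sup>2) has_real_derivative 2 * max 0 s) (at s)"
proof -
  consider "s > 0" | "s < 0" | "s = 0" by linarith
  then show ?thesis
  proof cases
    case 1
    have "((\<lambda>s. s\<^sup>2) has_real_derivative 2 * max 0 s) (at s)"
      using 1 by (auto intro!: derivative_eq_intros)
    then show ?thesis
      by (rule has_field_derivative_transform_within_open[where S = "{0<..}"]) (use 1 in auto)
  next
    case 2
    have "((\<lambda>s. 0) has_real_derivative 2 * max 0 s) (at s)"
      using 2 by simp
    then show ?thesis
      by (rule has_field_derivative_transform_within_open[where S = "{..<0}"]) (use 2 in auto)
  next
    case 3
    have "((\<lambda>h::real. (max 0 h)\<^sup>2 / h) \<longlongrightarrow> 0) (at 0)"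
    proof (rule Lim_null_comparison)
      show "\<forall>\<^sub>F h in at 0. norm ((max 0 h)\<^sup>2 / h) \<le> \<bar>h\<bar>"
        by (intro always_eventually) (auto simp: max_def power2_eq_square)
      show "((\<lambda>h. \<bar>h\<bar>) \<longlongrightarrow> 0) (at (0::real))"
        by (auto intro!: tendsto_eq_intros)
    qed
    then show ?thesis
      by (simp add: 3 has_field_derivative_iff)
  qed
qed

text \<open>The cutoff is the squared positive part of 1 - 4 |x - x0|^2 / r^2. Its partial
  derivatives are at most 2 (8 / r^2)(r / 2) = 8/r. On the ball of radius r/4 it is at least
  (3/4)^2, so its mass is at least 9/16 of a volume that is smaller by the factor 4^n.\<close>

lemma ball_cutoff:
  fixes x0 :: "'a::euclidean_space"
  assumes "r > 0"
  obtains \<eta> :: "'a \<Rightarrow> real" and \<eta>' where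
    "\<And>x. (\<eta> has_derivative \<eta>' x) (at x)" "\<And>v. continuous_on UNIV (\<lambda>x. \<eta>' x v)"
    "\<And>x. 0 \<le> \<eta> x" "\<And>x. \<eta> x \<le> 1" "\<And>x. x \<notin> cball x0 (r / 2) \<Longrightarrow> \<eta> x = 0"
    "\<And>x i. i \<in> Basis \<Longrightarrow> \<bar>\<eta>' x i\<bar> \<le> 8 / r"
    "measure lborel (ball x0 r) \<le> 16 / 9 * 4 ^ DIM('a) * (\<integral>x. \<eta> x \<partial>lborel)"
proof -
  define q where "q = 4 / r\<^sup>2"
  have "q > 0" using \<open>r > 0\<close> by (simp add: q_def)
  define s where "s = (\<lambda>x. 1 - q * ((x - x0) \<bullet> (x - x0)))"
  define \<eta> where "\<eta> = (\<lambda>x. (max 0 (s x))\<^sup>2)"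
  define \<eta>' where "\<eta>' = (\<lambda>x v. 2 * max 0 (s x) * (- (2 * q) * ((x - x0) \<bullet> v)))"
  have sc: "continuous_on A s" for A unfolding s_def by (intro continuous_intros)
  have d: "(\<eta> has_derivative \<eta>' x) (at x)" for x
  proof -
    have "(s has_derivative (\<lambda>v. - (2 * q) * ((x - x0) \<bullet> v))) (at x)"
      unfolding s_def by (auto intro!: derivative_eq_intros simp: inner_commute fun_eq_iff)
    from has_derivative_compose[OF this max_0_square_has_real_derivative[unfolded has_field_derivative_def]]
    show ?thesis unfolding \<eta>_def \<eta>'_def .
  qed
  have s_dist: "s x = 1 - (2 * dist x0 x / r)\<^sup>2" for x
    using \<open>r > 0\<close> by (simp add: s_def q_def dot_square_norm dist_norm norm_minus_commute power_divide power_mult_distrib)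
  have s1: "s x \<le> 1" for x by (simp add: s_dist)
  have s0: "s x \<le> 0" if "x \<notin> cball x0 (r / 2)" for x
  proof -
    have "1 \<le> 2 * dist x0 x / r" using that \<open>r > 0\<close> by (simp add: field_simps)
    then show ?thesis by (simp add: s_dist)
  qed
  have \<eta>0: "\<eta> x = 0" if "x \<notin> cball x0 (r / 2)" for x
    using s0[OF that] by (simp add: \<eta>_def)
  have \<eta>c: "continuous_on UNIV \<eta>" unfolding \<eta>_def by (intro continuous_intros sc)
  have \<eta>i: "integrable lborel \<eta>"
    by (rule integrable_lborel_compact_support[OF compact_cball \<eta>0 \<eta>c])
  show ?thesis
  proof (rule that[of \<eta> \<eta>'])
    show "continuous_on UNIV (\<lambda>x. \<eta>' x v)" for v
      unfolding \<eta>'_def by (intro continuous_intros sc)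
    show "\<eta> x \<le> 1" for x using s1[of x] unfolding \<eta>_def by (intro power_le_one) auto
    show "\<bar>\<eta>' x i\<bar> \<le> 8 / r" if i: "i \<in> Basis" for x i
    proof (cases "x \<in> cball x0 (r / 2)")
      case True
      have "\<bar>(x - x0) \<bullet> i\<bar> \<le> norm (x - x0)" by (rule Basis_le_norm[OF i])
      also have "\<dots> \<le> r / 2" using True by (simp add: dist_norm norm_minus_commute)
      finally have 1: "\<bar>(x - x0) \<bullet> i\<bar> \<le> r / 2" .
      have "\<bar>\<eta>' x i\<bar> = (2 * max 0 (s x)) * ((2 * q) * \<bar>(x - x0) \<bullet> i\<bar>)"
        using \<open>q > 0\<close> by (simp add: \<eta>'_def abs_mult)
      also have "\<dots> \<le> 2 * ((2 * q) * (r / 2))"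
        using s1[of x] \<open>q > 0\<close> by (intro mult_mono mult_nonneg_nonneg 1) auto
      also have "\<dots> = 8 / r" using \<open>r > 0\<close> by (simp add: q_def power2_eq_square)
      finally show ?thesis .
    next
      case False
      then show ?thesis using s0[of x] \<open>r > 0\<close> by (simp add: \<eta>'_def)
    qed
    have "(\<integral>x. (9 / 16) * indicat_real (ball x0 (r / 4)) x \<partial>lborel) \<le> (\<integral>x. \<eta> x \<partial>lborel)"
    proof (rule integral_mono[OF _ \<eta>i])
      show "integrable lborel (\<lambda>x. (9 / 16) * indicat_real (ball x0 (r / 4)) x)"
        by (intro integrable_mult_right integrable_real_indicator)
          (use emeasure_lborel_ball_finite in auto)
      show "(9 / 16) * indicat_real (ball x0 (r / 4)) x \<le> \<eta> x" for x
      proof (cases "x \<in> ball x0 (r / 4)")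
        case True
        have "(2 * dist x0 x / r)\<^sup>2 \<le> (1 / 2)\<^sup>2"
          using True \<open>r > 0\<close> by (intro power_mono) (auto simp: field_simps)
        then have "3 / 4 \<le> max 0 (s x)" by (simp add: s_dist power2_eq_square)
        then have "(3 / 4)\<^sup>2 \<le> \<eta> x" unfolding \<eta>_def by (intro power_mono) auto
        then show ?thesis using True by (simp add: power2_eq_square)
      qed (simp add: \<eta>_def)
    qed
    then have "(9 / 16) * measure lborel (ball x0 (r / 4)) \<le> (\<integral>x. \<eta> x \<partial>lborel)" by simp
    moreover have "measure lborel (ball x0 r) = 4 ^ DIM('a) * measure lborel (ball x0 (r / 4))"
      using content_ball_conv_unit_ball[of r x0] content_ball_conv_unit_ball[of "r / 4" x0] \<open>r > 0\<close>
      by (simp add: power_divide)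
    ultimately show "measure lborel (ball x0 r) \<le> 16 / 9 * 4 ^ DIM('a) * (\<integral>x. \<eta> x \<partial>lborel)"
      by simp
  qed (use d \<eta>0 in \<open>auto simp: \<eta>_def\<close>)
qed

section \<open>Borel versions, slices and the volume of the cylinder\<close>

lemma borel_representative:
  fixes a :: "'b::euclidean_space \<Rightarrow> real"
  assumes a: "set_integrable lebesgue Q a" and [measurable]: "Q \<in> sets borel"
  obtains a' where "a' \<in> borel_measurable borel" "integrable lborel a'" "\<And>z. z \<notin> Q \<Longrightarrow> a' z = 0"
    "AE z in lborel. z \<in> Q \<longrightarrow> a' z = a z"
proof -
  have i: "integrable lebesgue (\<lambda>z. indicat_real Q z * a z)"
    using a by (simp add: set_integrable_def)
  \<comment> \<open>A Lebesgue measurable function agrees almost everywhere with a Borel one;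
    multiplying by the indicator afterwards makes it vanish exactly outside
    \<open>Q\<close>.\<close>
  then obtain b where b[measurable]: "b \<in> borel_measurable lborel" and eq: "AE z in lborel. indicat_real Q z * a z = b z"
    using completion_ex_borel_measurable_real[OF borel_measurable_integrable] by blast
  have "integrable lebesgue b"
  proof (rule integrable_cong_AE_imp[OF i])
    show "AE z in lebesgue. indicat_real Q z * a z = b z"
      by (rule AE_completion[OF eq])
  qed (use measurable_completion[OF b] in simp)
  then have bi: "integrable lborel b" using integrable_completion[OF b] by simp
  show ?thesis
  proof (rule that[of "\<lambda>z. b z * indicat_real Q z"])
    show "integrable lborel (\<lambda>z. b z * indicat_real Q z)"
      by (rule integrable_real_mult_indicator[OF _ bi]) simp
    show "AE z in lborel. z \<in> Q \<longrightarrow> b z * indicat_real Q z = a z"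
      using eq by eventually_elim auto
    show "(\<lambda>z. b z * indicat_real Q z) \<in> borel_measurable borel"
      using b by measurable
  qed auto
qed

text \<open>Passes from set integrals for the completed measure, in which the hypotheses are
  phrased, to full Borel integrals, on which Fubini operates. Taking \<open>\<phi>\<close>
  constantly 1 covers plain integrals.\<close>

lemma integral_borel_representative:
  fixes a a' \<phi> :: "'b::euclidean_space \<Rightarrow> real"
  assumes a: "set_integrable lebesgue Q a" and a': "a' \<in> borel_measurable borel" "\<And>z. z \<notin> Q \<Longrightarrow> a' z = 0"
    and eq: "AE z in lborel. z \<in> Q \<longrightarrow> a' z = a z" and \<phi>: "\<phi> \<in> borel_measurable borel"
  shows "(LINT z:Q|lebesgue. a z * \<phi> z) = (\<integral>z. a' z * \<phi> z \<partial>lborel)"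
proof -
  have m: "(\<lambda>z. a' z * \<phi> z) \<in> borel_measurable lborel" using a' \<phi> by simp
  have "(\<integral>z. (indicat_real Q z * a z) * \<phi> z \<partial>lebesgue) = (\<integral>z. a' z * \<phi> z \<partial>lebesgue)"
  proof (rule integral_cong_AE)
    have "(\<lambda>z. indicat_real Q z * a z) \<in> borel_measurable lebesgue"
      using a by (simp add: set_integrable_def)
    moreover have "\<phi> \<in> borel_measurable lebesgue"
      by (intro measurable_completion) (simp add: \<phi>)
    ultimately show "(\<lambda>z. (indicat_real Q z * a z) * \<phi> z) \<in> borel_measurable lebesgue"
      by (rule borel_measurable_times)
    show "AE z in lebesgue. (indicat_real Q z * a z) * \<phi> z = a' z * \<phi> z"
      using AE_completion[OF eq] by eventually_elim (use a'(2) in \<open>auto simp: indicator_def\<close>)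
  qed (use measurable_completion[OF m] in simp)
  also have "\<dots> = (\<integral>z. a' z * \<phi> z \<partial>lborel)"
    by (rule integral_completion[OF m])
  finally show ?thesis by (simp add: set_lebesgue_integral_def mult.assoc)
qed

lemma AE_lborel_sections:
  assumes "AE z in lborel. P (z :: 'b::euclidean_space \<times> 'c::euclidean_space)"
  shows "AE t in lborel. AE x in lborel. P (t, x)"
  using assms unfolding lborel_prod[symmetric] by (rule lborel_pair.AE_pair)

lemma par_cyl_eq_Times_ball: "par_cyl \<alpha> r t0 x0 = ball t0 (\<alpha> * r\<^sup>2) \<times> ball x0 r"
  by (simp add: par_cyl_def ball_eq_greaterThanLessThan)

lemma measure_par_cyl:
  fixes x0 :: "'a::euclidean_space"
  assumes "\<alpha> > 0" "r > 0"
  shows "measure lebesgue (par_cyl \<alpha> r t0 x0) = 2 * (\<alpha> * r\<^sup>2) * measure lborel (ball x0 r)"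
proof -
  have "emeasure lborel (par_cyl \<alpha> r t0 x0) = emeasure lborel (ball t0 (\<alpha> * r\<^sup>2)) * emeasure lborel (ball x0 r)"
    unfolding par_cyl_eq_Times_ball lborel_prod[symmetric]
    by (rule lborel.emeasure_pair_measure_Times) auto
  then have "measure lborel (par_cyl \<alpha> r t0 x0) = measure lborel (ball t0 (\<alpha> * r\<^sup>2)) * measure lborel (ball x0 r)"
    by (simp add: measure_def enn2real_mult)
  moreover have "measure lborel (ball t0 (\<alpha> * r\<^sup>2)) = 2 * (\<alpha> * r\<^sup>2)"
    using assms by (simp add: ball_eq_greaterThanLessThan)
  moreover have "par_cyl \<alpha> r t0 x0 \<in> sets borel" by (intro borel_open open_par_cyl)
  ultimately show ?thesis by (simp add: measure_completion)
qed

text \<open>The time derivative of the product \<theta>(t) \<eta>(x) is \<theta>'(t) \<eta>(x), and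
  by Fubini pairing \<open>a\<close> with it is c times pairing the normalised average with
  \<theta>'. This is the hypothesis of \<open>time_oscillation\<close>, with \<open>M\<close>
  carrying the factor 1/c.\<close>

lemma weighted_average_time_oscillation:
  fixes a a' :: "real \<times> 'a::euclidean_space \<Rightarrow> real" and \<eta> :: "'a \<Rightarrow> real" and \<alpha> r t0 N :: real and x0
  defines "Q \<equiv> par_cyl \<alpha> r t0 x0" and "c \<equiv> (\<integral>x. \<eta> x \<partial>lborel)"
  assumes "\<alpha> > 0" "r > 0" and a: "set_integrable lebesgue Q a"
    and N: "NQ_dt \<alpha> r t0 x0 a \<le> ereal N" "N \<ge> 0"
    and a': "a' \<in> borel_measurable borel" "integrable lborel a'" "\<And>z. z \<notin> Q \<Longrightarrow> a' z = 0"
      "AE z in lborel. z \<in> Q \<longrightarrow> a' z = a z"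
    and \<eta>: "\<And>x. (\<eta> has_derivative \<eta>' x) (at x)" "\<And>v. continuous_on UNIV (\<lambda>x. \<eta>' x v)"
      "\<And>x. 0 \<le> \<eta> x" "\<And>x. \<eta> x \<le> 1" "\<And>x. x \<notin> cball x0 (r / 2) \<Longrightarrow> \<eta> x = 0"
      "\<And>x i. i \<in> Basis \<Longrightarrow> \<bar>\<eta>' x i\<bar> \<le> 8 / r"
    and "c > 0"
  shows "integrable lborel (\<lambda>t. (\<integral>x. a' (t, x) * \<eta> x \<partial>lborel) / c)"
    "\<exists>k. (\<integral>t. indicat_real (ball t0 (\<alpha> * r\<^sup>2)) t * \<bar>(\<integral>x. a' (t, x) * \<eta> x \<partial>lborel) / c - k\<bar> \<partial>lborel)
      \<le> 9 * (measure lebesgue Q * (\<alpha> * r\<^sup>2) * (3 + 16 * DIM('a)) * N / (r * c))"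
proof -
  define h where "h = \<alpha> * r\<^sup>2"
  have "h > 0" using \<open>\<alpha> > 0\<close> \<open>r > 0\<close> by (simp add: h_def)
  have \<eta>c: "continuous_on UNIV \<eta>"
    using \<eta>(1) has_derivative_continuous continuous_at_imp_continuous_on by blast
  have [measurable]: "\<eta> \<in> borel_measurable borel" "a' \<in> borel_measurable borel"
    using borel_measurable_continuous_onI[OF \<eta>c] a'(1) by auto
  have [measurable]: "(\<lambda>z::real \<times> 'a. \<eta> (snd z)) \<in> borel_measurable borel"
    by (intro borel_measurable_continuous_onI continuous_on_compose2[OF \<eta>c] continuous_intros) auto
  have Qpos: "measure lebesgue Q > 0"
    unfolding Q_def measure_par_cyl[OF \<open>\<alpha> > 0\<close> \<open>r > 0\<close>]
    using \<open>h > 0\<close> content_ball_pos[OF \<open>r > 0\<close>, of x0] by (simp add: h_def)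
  have i1: "integrable lborel (\<lambda>z. a' z * \<eta> (snd z))"
    by (rule integrable_mult_bounded[OF a'(2), of _ 1]) (use \<eta>(3,4) in auto)
  let ?m = "\<lambda>t. (\<integral>x. a' (t, x) * \<eta> x \<partial>lborel) / c"
  show mi: "integrable lborel ?m"
    using lborel_pair.integrable_fst'[of "\<lambda>z. a' z * \<eta> (snd z)"] i1 by (simp add: lborel_prod)
  show "\<exists>k. (\<integral>t. indicat_real (ball t0 (\<alpha> * r\<^sup>2)) t * \<bar>?m t - k\<bar> \<partial>lborel)
      \<le> 9 * (measure lebesgue Q * (\<alpha> * r\<^sup>2) * (3 + 16 * DIM('a)) * N / (r * c))"
    unfolding h_def[symmetric]
  proof (rule time_oscillation[OF mi \<open>h > 0\<close>])
    show "0 \<le> measure lebesgue Q * h * (3 + 16 * DIM('a)) * N / (r * c)"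
      using Qpos \<open>h > 0\<close> \<open>r > 0\<close> \<open>c > 0\<close> \<open>N \<ge> 0\<close> by simp
    fix \<theta> \<theta>' :: "real \<Rightarrow> real" and K S
    assume K: "compact K" "K \<subseteq> ball t0 h" "\<And>t. t \<notin> K \<Longrightarrow> \<theta> t = 0"
      and \<theta>: "\<And>t. (\<theta> has_real_derivative \<theta>' t) (at t)" "continuous_on UNIV \<theta>'"
      and S: "\<And>t. \<bar>\<theta>' t\<bar> \<le> S" "\<And>t. \<bar>\<theta> t\<bar> \<le> 2 * h * S"
    have "S \<ge> 0" using S(1)[of 0] by linarith
    have \<theta>c: "continuous_on UNIV \<theta>"
      using \<theta>(1) DERIV_isCont continuous_at_imp_continuous_on by blast
    have comp_t: "continuous_on A (\<lambda>z. \<theta> (f z))" "continuous_on A (\<lambda>z. \<theta>' (f z))"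
      if "continuous_on A f" for A and f :: "real \<times> 'a \<Rightarrow> real"
      using continuous_on_compose2[OF \<theta>c that] continuous_on_compose2[OF \<theta>(2) that] by auto
    have comp_x: "continuous_on A (\<lambda>z. \<eta> (g z))" "continuous_on A (\<lambda>z. \<eta>' (g z) v)"
      if "continuous_on A g" for A v and g :: "real \<times> 'a \<Rightarrow> 'a"
      using continuous_on_compose2[OF \<eta>c that] continuous_on_compose2[OF \<eta>(2) that] by auto
    have [measurable]: "(\<lambda>z::real \<times> 'a. \<theta>' (fst z)) \<in> borel_measurable borel"
      by (intro borel_measurable_continuous_onI comp_t continuous_intros)
    define f where "f = (\<lambda>z. \<theta> (fst z) * \<eta> (snd z))"
    define D where "D = (\<lambda>z v. \<theta> (fst z) * \<eta>' (snd z) (snd v) + (\<theta>' (fst z) * fst v) * \<eta> (snd z))"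
    \<comment> \<open>In the direction (1, 0) the spatial part of the derivative is evaluated at 0
      and drops out.\<close>
    have lin: "\<eta>' x 0 = 0" for x
      using linear_0[OF has_derivative_linear[OF \<eta>(1)]] .
    \<comment> \<open>The three bounds 2hS, 2hS (8/r) and S, weighted by 1, r n and h, add up to (3
      + 16 n) h S; this is the origin of \<open>3 + 16 * DIM('a)\<close>.\<close>
    have "\<bar>LINT z:par_cyl \<alpha> r t0 x0|lebesgue. a z * D z (1, 0)\<bar>
      \<le> measure lebesgue (par_cyl \<alpha> r t0 x0) / r * (2 * h * S + r * (DIM('a) * (2 * h * S * (8 / r))) + \<alpha> * r\<^sup>2 * S) * N"
    proof (rule NQ_dt_bound_C1[where f = f and K = "K \<times> cball x0 (r / 2)"])
      show "set_integrable lebesgue (par_cyl \<alpha> r t0 x0) a" "measure lebesgue (par_cyl \<alpha> r t0 x0) > 0"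
        using a Qpos by (simp_all add: Q_def)
      show "compact (K \<times> cball x0 (r / 2))" by (intro compact_Times K compact_cball)
      show "K \<times> cball x0 (r / 2) \<subseteq> par_cyl \<alpha> r t0 x0"
        unfolding par_cyl_eq_Times_ball h_def[symmetric]
        using K(2) \<open>r > 0\<close> by (intro Sigma_mono) auto
      show "f z = 0" if "z \<notin> K \<times> cball x0 (r / 2)" for z
        using that K(3) \<eta>(5) unfolding f_def by (cases z) auto
      show "(f has_derivative D z) (at z)" for z
      proof -
        have "((\<lambda>z. \<theta> (fst z)) has_derivative (\<lambda>v. \<theta>' (fst z) * fst v)) (at z)"
          by (rule has_derivative_compose[OF _ \<theta>(1)[unfolded has_field_derivative_def]])
            (intro has_derivative_fst has_derivative_ident)
        moreover have "((\<lambda>z. \<eta> (snd z)) has_derivative (\<lambda>v. \<eta>' (snd z) (snd v))) (at z)"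
          by (rule has_derivative_compose[OF _ \<eta>(1)]) (intro has_derivative_snd has_derivative_ident)
        ultimately show ?thesis
          unfolding f_def D_def by (rule has_derivative_mult)
      qed
      show "continuous_on UNIV (\<lambda>z. D z v)" for v
        unfolding D_def by (intro continuous_intros comp_t comp_x)
      show "\<bar>f z\<bar> \<le> 2 * h * S" for z
        unfolding f_def abs_mult using S(2)[of "fst z"] \<eta>(3,4)[of "snd z"] \<open>h > 0\<close> \<open>S \<ge> 0\<close>
          mult_mono[of "\<bar>\<theta> (fst z)\<bar>" "2 * h * S" "\<bar>\<eta> (snd z)\<bar>" 1] by auto
      show "\<bar>D z (0, i)\<bar> \<le> 2 * h * S * (8 / r)" if "i \<in> Basis" for z i
        unfolding D_def using S(2)[of "fst z"] \<eta>(6)[OF that, of "snd z"] \<open>h > 0\<close> \<open>S \<ge> 0\<close>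
          mult_mono[of "\<bar>\<theta> (fst z)\<bar>" "2 * h * S" "\<bar>\<eta>' (snd z) i\<bar>" "8 / r"] by (auto simp: abs_mult)
      show "\<bar>D z (1, 0)\<bar> \<le> S" for z
        unfolding D_def using S(1)[of "fst z"] \<eta>(3,4)[of "snd z"] \<open>S \<ge> 0\<close>
          mult_mono[of "\<bar>\<theta>' (fst z)\<bar>" S "\<bar>\<eta> (snd z)\<bar>" 1] by (auto simp: abs_mult lin)
    qed (use \<open>\<alpha> > 0\<close> \<open>r > 0\<close> N in auto)
    also have "(LINT z:par_cyl \<alpha> r t0 x0|lebesgue. a z * D z (1, 0))
        = (\<integral>z. a' z * (\<theta>' (fst z) * \<eta> (snd z)) \<partial>lborel)"
      unfolding Q_def[symmetric]
      by (subst integral_borel_representative[OF a a'(1,3,4)]) (auto simp: D_def lin)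
    also have "\<dots> = c * (\<integral>t. ?m t * \<theta>' t \<partial>lborel)"
    proof -
      have "integrable lborel (\<lambda>z. (a' z * \<eta> (snd z)) * \<theta>' (fst z))"
        by (rule integrable_mult_bounded[OF i1 _ S(1)]) simp
      then have "(\<integral>z. (a' z * \<eta> (snd z)) * \<theta>' (fst z) \<partial>lborel)
          = (\<integral>t. \<integral>x. (a' (t, x) * \<eta> x) * \<theta>' t \<partial>lborel \<partial>lborel)"
        using lborel_pair.integral_fst'[of "\<lambda>z. (a' z * \<eta> (snd z)) * \<theta>' (fst z)"] by (simp add: lborel_prod)
      also have "\<dots> = (\<integral>t. c * (?m t * \<theta>' t) \<partial>lborel)"
        using \<open>c > 0\<close> by (intro Bochner_Integration.integral_cong refl) simp
      finally show ?thesis by (simp add: mult_ac)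
    qed
    finally have "c * \<bar>\<integral>t. ?m t * \<theta>' t \<partial>lborel\<bar>
        \<le> measure lebesgue Q / r * (2 * h * S + r * (DIM('a) * (2 * h * S * (8 / r))) + h * S) * N"
      using \<open>c > 0\<close> by (simp only: abs_mult Q_def[symmetric] h_def[symmetric])
    also have "\<dots> = c * (measure lebesgue Q * h * (3 + 16 * DIM('a)) * N / (r * c) * S)"
      using \<open>c > 0\<close> \<open>r > 0\<close> by (simp add: field_simps)
    finally show "\<bar>\<integral>t. ?m t * \<theta>' t \<partial>lborel\<bar> \<le> measure lebesgue Q * h * (3 + 16 * DIM('a)) * N / (r * c) * S"
      using \<open>c > 0\<close> by (simp only: mult_le_cancel_left_pos)
  qed
qed

text \<open>The deviation u(x) minus the weighted mean is the \<eta>-average of u(x) - u(y), and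
  \<eta> is at most the indicator of \<open>B\<close>. This converts the double integral of
  differences into a deviation from the weighted mean at the cost of 1/c.\<close>

lemma nn_integral_deviation_from_weighted_mean:
  fixes u \<eta> :: "'a::euclidean_space \<Rightarrow> real"
  assumes u: "integrable lborel u" and \<eta>: "integrable lborel \<eta>" "\<And>x. 0 \<le> \<eta> x" "\<And>x. \<eta> x \<le> 1" "\<And>x. x \<notin> B \<Longrightarrow> \<eta> x = 0"
    and c: "(\<integral>x. \<eta> x \<partial>lborel) = c" "c > 0" and [measurable]: "B \<in> sets borel"
  shows "(\<integral>\<^sup>+x. indicator B x * ennreal \<bar>u x - (\<integral>y. u y * \<eta> y \<partial>lborel) / c\<bar> \<partial>lborel)
    \<le> ennreal (1 / c) * (\<integral>\<^sup>+y. \<integral>\<^sup>+x. indicator B y * (indicator B x * ennreal \<bar>u x - u y\<bar>) \<partial>lborel \<partial>lborel)"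
proof -
  have [measurable]: "u \<in> borel_measurable borel" "\<eta> \<in> borel_measurable borel" using u \<eta> by auto
  have iu: "integrable lborel (\<lambda>y. u y * \<eta> y)"
    by (rule integrable_mult_bounded[OF u, of _ 1]) (use \<eta> in auto)
  have pw: "ennreal \<bar>u x - (\<integral>y. u y * \<eta> y \<partial>lborel) / c\<bar> \<le> ennreal (1 / c) * (\<integral>\<^sup>+y. indicator B y * ennreal \<bar>u x - u y\<bar> \<partial>lborel)" for x
  proof -
    have i: "integrable lborel (\<lambda>y. (u x - u y) * \<eta> y)"
      using iu \<eta>(1) by (simp add: left_diff_distrib)
    have "(\<integral>y. (u x - u y) * \<eta> y \<partial>lborel) = u x * c - (\<integral>y. u y * \<eta> y \<partial>lborel)"
      using iu \<eta>(1) c by (simp add: left_diff_distrib)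
    then have "u x - (\<integral>y. u y * \<eta> y \<partial>lborel) / c = (1 / c) * (\<integral>y. (u x - u y) * \<eta> y \<partial>lborel)"
      using c(2) by (simp only:) (simp add: diff_divide_distrib)
    then have "\<bar>u x - (\<integral>y. u y * \<eta> y \<partial>lborel) / c\<bar> = (1 / c) * \<bar>\<integral>y. (u x - u y) * \<eta> y \<partial>lborel\<bar>"
      using c(2) by (simp only: abs_mult) simp
    also have "\<dots> \<le> (1 / c) * (\<integral>y. \<bar>(u x - u y) * \<eta> y\<bar> \<partial>lborel)"
      using c(2) by (intro mult_left_mono) auto
    finally have "ennreal \<bar>u x - (\<integral>y. u y * \<eta> y \<partial>lborel) / c\<bar> \<le> ennreal (1 / c) * ennreal (\<integral>y. \<bar>(u x - u y) * \<eta> y\<bar> \<partial>lborel)"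
      using c(2) by (simp add: ennreal_mult[symmetric] ennreal_leI)
    also have "ennreal (\<integral>y. \<bar>(u x - u y) * \<eta> y\<bar> \<partial>lborel) = (\<integral>\<^sup>+y. ennreal \<bar>(u x - u y) * \<eta> y\<bar> \<partial>lborel)"
      using i by (intro nn_integral_eq_integral[symmetric]) auto
    also have "\<dots> \<le> (\<integral>\<^sup>+y. indicator B y * ennreal \<bar>u x - u y\<bar> \<partial>lborel)"
    proof (intro nn_integral_mono)
      fix y
      show "ennreal \<bar>(u x - u y) * \<eta> y\<bar> \<le> indicator B y * ennreal \<bar>u x - u y\<bar>"
        using \<eta>(2-4)[of y] by (cases "y \<in> B") (auto simp: abs_mult mult_left_le intro!: ennreal_leI)
    qed
    finally show ?thesis by (simp add: mult_left_mono)
  qed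
  have "(\<integral>\<^sup>+x. indicator B x * ennreal \<bar>u x - (\<integral>y. u y * \<eta> y \<partial>lborel) / c\<bar> \<partial>lborel)
    \<le> (\<integral>\<^sup>+x. ennreal (1 / c) * (\<integral>\<^sup>+y. indicator B x * (indicator B y * ennreal \<bar>u x - u y\<bar>) \<partial>lborel) \<partial>lborel)"
  proof (intro nn_integral_mono)
    fix x
    show "indicator B x * ennreal \<bar>u x - (\<integral>y. u y * \<eta> y \<partial>lborel) / c\<bar>
      \<le> ennreal (1 / c) * (\<integral>\<^sup>+y. indicator B x * (indicator B y * ennreal \<bar>u x - u y\<bar>) \<partial>lborel)"
      using pw[of x] by (cases "x \<in> B") auto
  qed
  also have "\<dots> = ennreal (1 / c) * (\<integral>\<^sup>+x. \<integral>\<^sup>+y. indicator B x * (indicator B y * ennreal \<bar>u x - u y\<bar>) \<partial>lborel \<partial>lborel)"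
    by (rule nn_integral_cmult) measurable
  finally show ?thesis by (simp add: abs_minus_commute)
qed

lemma set_integrable_abs_diff_const:
  fixes a :: "'b::euclidean_space \<Rightarrow> real"
  assumes a: "set_integrable lebesgue Q a" and Q: "Q \<in> sets lebesgue" "emeasure lebesgue Q < \<infinity>"
  shows "set_integrable lebesgue Q (\<lambda>z. \<bar>a z - k\<bar>)"
proof (rule set_integrable_abs, rule set_integral_diff(1)[OF a])
  show "set_integrable lebesgue Q (\<lambda>z. k)"
    using Q unfolding set_integrable_def by simp
qed

lemma emeasure_par_cyl_finite: "emeasure lebesgue (par_cyl \<alpha> r t0 (x0 :: 'a::euclidean_space)) < \<infinity>"
proof -
  have "bounded (par_cyl \<alpha> r t0 x0)"
    unfolding par_cyl_eq_Times_ball by (intro bounded_Times bounded_ball)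
  then show ?thesis
    using emeasure_bounded_finite by (auto simp: less_top top_unique open_par_cyl)
qed

text \<open>Splits a - k through the weighted average m(t): slices control a - m, the time
  derivative controls m - k. Both parts carry the ratio of the volume of the ball to the mass of the
  cutoff, bounded by the common factor 16/9 4^n.\<close>

lemma parabolic_oscillation:
  fixes a :: "real \<times> 'a::euclidean_space \<Rightarrow> real" and g :: "real \<times> 'a \<Rightarrow> 'a" and \<alpha> r t0 N :: real and x0
  defines "Q \<equiv> par_cyl \<alpha> r t0 x0"
  assumes "\<alpha> > 0" "r > 0" and L1: "L1_W11 {t0 - \<alpha> * r\<^sup>2 <..< t0 + \<alpha> * r\<^sup>2} (ball x0 r) a g"
    and N: "NQ_dt \<alpha> r t0 x0 a \<le> ereal N" "N \<ge> 0"
  shows "\<exists>k. (LINT z:Q|lebesgue. \<bar>a z - k\<bar>) \<le> 16 / 9 * 4 ^ DIM('a) *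
    (2 * 2 ^ DIM('a) * r * (LINT z:Q|lebesgue. norm (g z))
      + 9 * (measure lebesgue Q * (\<alpha> * r\<^sup>2) * (3 + 16 * DIM('a)) * N / r))"
proof -
  define h where "h = \<alpha> * r\<^sup>2"
  have "h > 0" using \<open>\<alpha> > 0\<close> \<open>r > 0\<close> by (simp add: h_def)
  define I where "I = ball t0 h"
  define B where "B = ball x0 r"
  have Q: "Q = I \<times> B" by (simp add: Q_def par_cyl_eq_Times_ball I_def B_def h_def)
  have Q': "{t0 - \<alpha> * r\<^sup>2 <..< t0 + \<alpha> * r\<^sup>2} \<times> ball x0 r = Q" by (simp add: Q_def par_cyl_def)
  have I': "{t0 - \<alpha> * r\<^sup>2 <..< t0 + \<alpha> * r\<^sup>2} = I" by (simp add: I_def h_def ball_eq_greaterThanLessThan)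
  have Qb[measurable]: "Q \<in> sets borel" unfolding Q_def by (intro borel_open open_par_cyl)
  have [measurable]: "I \<in> sets borel" "B \<in> sets borel" by (simp_all add: I_def B_def)
  have a: "set_integrable lebesgue Q a" and g: "set_integrable lebesgue Q g"
    using L1 unfolding L1_W11_def Q' by auto
  have ng: "set_integrable lebesgue Q (\<lambda>z. norm (g z))" by (rule set_integrable_norm[OF g])
  obtain a' where a': "a' \<in> borel_measurable borel" "integrable lborel a'" "\<And>z. z \<notin> Q \<Longrightarrow> a' z = 0"
    "AE z in lborel. z \<in> Q \<longrightarrow> a' z = a z"
    using borel_representative[OF a Qb] by blast
  obtain \<gamma> where \<gamma>: "\<gamma> \<in> borel_measurable borel" "integrable lborel \<gamma>" "\<And>z. z \<notin> Q \<Longrightarrow> \<gamma> z = 0"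
    "AE z in lborel. z \<in> Q \<longrightarrow> \<gamma> z = norm (g z)"
    using borel_representative[OF ng Qb] by blast
  note [measurable] = a'(1) \<gamma>(1)
  obtain \<eta> :: "'a \<Rightarrow> real" and \<eta>' where \<eta>:
    "\<And>x. (\<eta> has_derivative \<eta>' x) (at x)" "\<And>v. continuous_on UNIV (\<lambda>x. \<eta>' x v)"
    "\<And>x. 0 \<le> \<eta> x" "\<And>x. \<eta> x \<le> 1" "\<And>x. x \<notin> cball x0 (r / 2) \<Longrightarrow> \<eta> x = 0"
    "\<And>x i. i \<in> Basis \<Longrightarrow> \<bar>\<eta>' x i\<bar> \<le> 8 / r"
    and \<eta>vol: "measure lborel (ball x0 r) \<le> 16 / 9 * 4 ^ DIM('a) * (\<integral>x. \<eta> x \<partial>lborel)"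
    by (rule ball_cutoff[OF \<open>r > 0\<close>, of x0]) (rule that)
  have \<eta>c: "continuous_on UNIV \<eta>"
    using \<eta>(1) has_derivative_continuous continuous_at_imp_continuous_on by blast
  have \<eta>i: "integrable lborel \<eta>"
    by (rule integrable_lborel_compact_support[OF compact_cball \<eta>(5) \<eta>c])
  have \<eta>B: "\<eta> x = 0" if "x \<notin> B" for x
    using \<eta>(5)[of x] that \<open>r > 0\<close> by (auto simp: B_def)
  define c where "c = (\<integral>x. \<eta> x \<partial>lborel)"
  define \<kappa> :: real where "\<kappa> = 16 / 9 * 4 ^ DIM('a)"
  define b where "b = measure lborel B"
  have "b > 0" unfolding b_def B_def using content_ball_pos[OF \<open>r > 0\<close>] by simp
  have bc: "b \<le> \<kappa> * c" using \<eta>vol by (simp add: b_def B_def \<kappa>_def c_def)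
  have "\<kappa> > 0" by (simp add: \<kappa>_def)
  have "c > 0" using bc \<open>b > 0\<close> \<open>\<kappa> > 0\<close> by (metis less_le_trans zero_less_mult_pos)
  define m where "m = (\<lambda>t. (\<integral>x. a' (t, x) * \<eta> x \<partial>lborel) / c)"
  define q where "q = measure lebesgue Q * h * (3 + 16 * DIM('a)) * N / r"
  note average = weighted_average_time_oscillation[OF \<open>\<alpha> > 0\<close> \<open>r > 0\<close> a[unfolded Q_def] N
      a'(1,2) a'(3,4)[unfolded Q_def] \<eta>, folded c_def Q_def]
  have avg: "integrable lborel m"
    "\<exists>k. (\<integral>t. indicat_real (ball t0 (\<alpha> * r\<^sup>2)) t * \<bar>m t - k\<bar> \<partial>lborel)
      \<le> 9 * (measure lebesgue Q * (\<alpha> * r\<^sup>2) * (3 + 16 * DIM('a)) * N / (r * c))"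
    unfolding m_def
    by (rule average(1), assumption, assumption, assumption, rule \<open>c > 0\<close>)
      (rule average(2), assumption, assumption, assumption, rule \<open>c > 0\<close>)
  obtain k where k: "(\<integral>t. indicat_real I t * \<bar>m t - k\<bar> \<partial>lborel) \<le> 9 * (q / c)"
    using avg(2) unfolding h_def[symmetric] I_def[symmetric] q_def by auto
  have [measurable]: "m \<in> borel_measurable borel" using avg(1) by auto
  have Bfin: "emeasure lborel B = ennreal b"
    unfolding b_def B_def using emeasure_lborel_ball_finite[of x0 r]
    by (intro emeasure_eq_ennreal_measure) auto

  define G where "G = (LINT z:Q|lebesgue. norm (g z))"
  have G: "G = (\<integral>z. \<gamma> z \<partial>lborel)"
    using integral_borel_representative[OF ng \<gamma>(1,3,4), of "\<lambda>_. 1"] by (simp add: G_def)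
  define \<Gamma> where "\<Gamma> = (\<lambda>t. \<integral>x. \<gamma> (t, x) \<partial>lborel)"
  have \<Gamma>: "integrable lborel \<Gamma>" "(\<integral>t. \<Gamma> t \<partial>lborel) = G"
    using lborel_pair.integrable_fst'[of \<gamma>] lborel_pair.integral_fst'[of \<gamma>] \<gamma>(2)
    by (simp_all add: lborel_prod \<Gamma>_def G)
  \<comment> \<open>The constant of the double-integral Poincare inequality, divided by the mass
    \<open>c\<close> of the weight.\<close>
  define C where "C = 2 * 2 ^ DIM('a) * r * b / c"
  have "C \<ge> 0" using \<open>r > 0\<close> \<open>b > 0\<close> \<open>c > 0\<close> by (simp add: C_def)
  \<comment> \<open>The sign of \<open>\<Gamma>\<close> is recorded as well: its integrand equals
    the norm of the gradient only almost everywhere, and the sign is used to identify the extended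
    integral of \<open>C * \<Gamma> t\<close> with the real one.\<close>
  have slice: "AE t in lborel. 0 \<le> \<Gamma> t \<and> (\<integral>\<^sup>+x. indicator I t * (indicator B x * ennreal \<bar>a' (t, x) - m t\<bar>) \<partial>lborel) \<le> ennreal (C * \<Gamma> t)"
  proof -
    have "AE t in lborel. integrable lborel (\<lambda>x. a' (t, x))"
      using lborel_pair.AE_integrable_fst'[of a'] a'(2) by (simp add: lborel_prod)
    moreover note AE_lborel_sections[OF a'(4)] AE_lborel_sections[OF \<gamma>(4)]
    moreover have "AE t in lborel. t \<in> I \<longrightarrow>
        set_integrable lebesgue B (\<lambda>x. a (t, x)) \<and> set_integrable lebesgue B (\<lambda>x. g (t, x)) \<and>
        (\<forall>\<phi>. test_fun B \<phi> \<longrightarrow> (\<forall>i\<in>Basis.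
           (LINT x:B|lebesgue. a (t, x) * frechet_derivative \<phi> (at x) i)
           = - (LINT x:B|lebesgue. \<phi> x * (g (t, x) \<bullet> i))))"
      using L1 unfolding L1_W11_def I' B_def[symmetric] AE_completion_iff by blast
    ultimately show ?thesis
    proof eventually_elim
      case (elim t)
      show ?case
      proof (cases "t \<in> I")
        case False
        then have "\<gamma> (t, x) = 0" for x by (intro \<gamma>(3)) (simp add: Q)
        then show ?thesis using False by (simp add: \<Gamma>_def)
      next
        case True
        have at: "set_integrable lebesgue B (\<lambda>x. a (t, x))" and gt: "set_integrable lebesgue B (\<lambda>x. g (t, x))"
          and weak: "\<And>\<phi> i. test_fun B \<phi> \<Longrightarrow> i \<in> Basis \<Longrightarrow>
            (LINT x:B|lebesgue. a (t, x) * frechet_derivative \<phi> (at x) i)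
           = - (LINT x:B|lebesgue. \<phi> x * (g (t, x) \<bullet> i))"
          using elim(4) True by auto
        have aet: "AE x in lborel. x \<in> B \<longrightarrow> a' (t, x) = a (t, x)"
          using elim(2) by eventually_elim (use True in \<open>auto simp: Q\<close>)
        have get: "AE x in lborel. x \<in> B \<longrightarrow> \<gamma> (t, x) = norm (g (t, x))"
          using elim(3) by eventually_elim (use True in \<open>auto simp: Q\<close>)
        have a't: "(\<lambda>x. a' (t, x)) \<in> borel_measurable borel" "\<And>x. x \<notin> B \<Longrightarrow> a' (t, x) = 0"
          using a'(3) elim(1) by (auto simp: Q)
        have \<gamma>t: "(\<lambda>x. \<gamma> (t, x)) \<in> borel_measurable borel" "\<And>x. x \<notin> B \<Longrightarrow> \<gamma> (t, x) = 0"
          using \<gamma>(3) by (auto simp: Q intro!: measurable_compose[OF _ \<gamma>(1)] borel_measurable_continuous_onI continuous_intros)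
        have \<Gamma>t: "(LINT x:B|lebesgue. norm (g (t, x))) = \<Gamma> t"
          using integral_borel_representative[OF set_integrable_norm[OF gt] \<gamma>t get, of "\<lambda>_. 1"]
          by (simp add: \<Gamma>_def)
        have "(\<integral>\<^sup>+y. \<integral>\<^sup>+x. indicator B y * (indicator B x * ennreal \<bar>a' (t, x) - a' (t, y)\<bar>) \<partial>lborel \<partial>lborel)
          \<le> ennreal (2 * 2 ^ DIM('a) * r * (LINT x:B|lebesgue. norm (g (t, x))) * measure lborel B)"
          unfolding B_def
        proof (rule poincare_ball[OF elim(1) \<open>r > 0\<close> gt[unfolded B_def]])
          fix \<phi> i assume \<phi>: "test_fun (ball x0 r) \<phi>" and i: "i \<in> (Basis :: 'a set)"
          have "smooth \<phi>" using \<phi> by (simp add: test_fun_def)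
          then have "(\<lambda>x. frechet_derivative \<phi> (at x) i) \<in> borel_measurable borel"
            by (intro borel_measurable_continuous_onI smooth_continuous_on smooth_frechet_derivative)
          \<comment> \<open>On this slice \<open>a\<close> and \<open>a'\<close> agree almost
            everywhere in the ball, so the weak gradient identity carries over to
            \<open>a'\<close>.\<close>
          from integral_borel_representative[OF at a't aet this] weak[of \<phi> i] \<phi> i
          show "(\<integral>x. a' (t, x) * frechet_derivative \<phi> (at x) i \<partial>lborel) = - (LINT x:ball x0 r|lebesgue. \<phi> x * (g (t, x) \<bullet> i))"
            by (simp add: B_def)
        qed
        then have P: "(\<integral>\<^sup>+y. \<integral>\<^sup>+x. indicator B y * (indicator B x * ennreal \<bar>a' (t, x) - a' (t, y)\<bar>) \<partial>lborel \<partial>lborel)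
          \<le> ennreal (c * (C * \<Gamma> t))"
          using \<open>c > 0\<close> by (simp add: \<Gamma>t C_def b_def mult_ac)
        have "0 \<le> \<Gamma> t"
          unfolding \<Gamma>t[symmetric] set_lebesgue_integral_def by (intro integral_nonneg_AE) auto
        have "(\<integral>\<^sup>+x. indicator B x * ennreal \<bar>a' (t, x) - m t\<bar> \<partial>lborel) \<le> ennreal (1 / c) * ennreal (c * (C * \<Gamma> t))"
          unfolding m_def
          by (rule order_trans[OF nn_integral_deviation_from_weighted_mean[OF elim(1) \<eta>i \<eta>(3,4) \<eta>B c_def[symmetric] \<open>c > 0\<close>]])
            (auto intro: mult_left_mono P)
        also have "\<dots> = ennreal (C * \<Gamma> t)"
          using \<open>c > 0\<close> \<open>C \<ge> 0\<close> \<open>0 \<le> \<Gamma> t\<close> by (simp add: ennreal_mult[symmetric])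
        finally show ?thesis using True \<open>0 \<le> \<Gamma> t\<close> by simp
      qed
    qed
  qed
  have fubini: "(\<integral>\<^sup>+z. f z \<partial>lborel) = (\<integral>\<^sup>+t. \<integral>\<^sup>+x. f (t, x) \<partial>lborel \<partial>lborel)"
    if "f \<in> borel_measurable borel" for f :: "real \<times> 'a \<Rightarrow> ennreal"
    using lborel.nn_integral_fst[of f lborel] that by (simp add: lborel_prod)
  have [measurable]: "(\<lambda>z::real \<times> 'a. m (fst z)) \<in> borel_measurable borel"
    by (rule measurable_compose[OF _ \<open>m \<in> borel_measurable borel\<close>])
      (intro borel_measurable_continuous_onI continuous_intros)
  have 1: "(\<integral>\<^sup>+z. indicator Q z * ennreal \<bar>a' z - m (fst z)\<bar> \<partial>lborel) \<le> ennreal (C * G)"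
  proof -
    have "(\<integral>\<^sup>+z. indicator Q z * ennreal \<bar>a' z - m (fst z)\<bar> \<partial>lborel)
      = (\<integral>\<^sup>+t. \<integral>\<^sup>+x. indicator I t * (indicator B x * ennreal \<bar>a' (t, x) - m t\<bar>) \<partial>lborel \<partial>lborel)"
    proof -
      have "(\<lambda>z. indicator Q z * ennreal \<bar>a' z - m (fst z)\<bar>) \<in> borel_measurable borel" by measurable
      from fubini[OF this] show ?thesis by (simp add: Q indicator_times mult.assoc)
    qed
    also have "\<dots> \<le> (\<integral>\<^sup>+t. ennreal (C * \<Gamma> t) \<partial>lborel)"
      by (rule nn_integral_mono_AE) (use slice in \<open>eventually_elim, auto\<close>)
    also have "\<dots> = ennreal (\<integral>t. C * \<Gamma> t \<partial>lborel)"
      using slice \<open>C \<ge> 0\<close> \<Gamma>(1) by (intro nn_integral_eq_integral) (auto elim!: eventually_mono)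
    finally show ?thesis using \<Gamma>(2) by simp
  qed
  \<comment> \<open>The integrand does not depend on x, so integrating over the ball just
    contributes its volume \<open>b\<close>.\<close>
  have 2: "(\<integral>\<^sup>+z. indicator Q z * ennreal \<bar>m (fst z) - k\<bar> \<partial>lborel) \<le> ennreal (9 * (q / c) * b)"
  proof -
    have mi: "integrable lborel (\<lambda>t. indicat_real I t * \<bar>m t - k\<bar>)"
    proof -
      have "integrable lborel (\<lambda>t. m t * indicat_real I t - k * indicat_real I t)"
        using avg(1) emeasure_lborel_ball_finite[of t0 h]
        by (intro Bochner_Integration.integrable_diff integrable_real_mult_indicator[of I lborel m] integrable_mult_right[OF integrable_real_indicator])
          (auto simp: I_def)
      then have "integrable lborel (\<lambda>t. \<bar>m t * indicat_real I t - k * indicat_real I t\<bar>)"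
        by (rule integrable_abs)
      moreover have "(\<lambda>t. \<bar>m t * indicat_real I t - k * indicat_real I t\<bar>) = (\<lambda>t. indicat_real I t * \<bar>m t - k\<bar>)"
        by (auto simp: fun_eq_iff indicator_def)
      ultimately show ?thesis by simp
    qed
    have "(\<integral>\<^sup>+z. indicator Q z * ennreal \<bar>m (fst z) - k\<bar> \<partial>lborel)
      = (\<integral>\<^sup>+t. \<integral>\<^sup>+x. ennreal (indicat_real I t * \<bar>m t - k\<bar>) * indicator B x \<partial>lborel \<partial>lborel)"
    proof -
      have "(\<lambda>z. indicator Q z * ennreal \<bar>m (fst z) - k\<bar>) \<in> borel_measurable borel" by measurable
      from fubini[OF this] show ?thesis
        by (simp add: Q indicator_times ennreal_mult' ennreal_indicator mult_ac)
    qed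
    also have "\<dots> = (\<integral>\<^sup>+t. ennreal (indicat_real I t * \<bar>m t - k\<bar>) * ennreal b \<partial>lborel)"
      by (simp add: nn_integral_cmult_indicator Bfin)
    also have "\<dots> = (\<integral>\<^sup>+t. ennreal (indicat_real I t * \<bar>m t - k\<bar>) \<partial>lborel) * ennreal b"
      by (rule nn_integral_multc) measurable
    also have "(\<integral>\<^sup>+t. ennreal (indicat_real I t * \<bar>m t - k\<bar>) \<partial>lborel) = ennreal (\<integral>t. indicat_real I t * \<bar>m t - k\<bar> \<partial>lborel)"
      by (rule nn_integral_eq_integral[OF mi]) simp
    also have "\<dots> \<le> ennreal (9 * (q / c))" by (rule ennreal_leI[OF k])
    finally show ?thesis
      using \<open>b > 0\<close> by (simp only: ennreal_mult''[of b] less_imp_le mult_right_mono zero_le)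
  qed
  have ak: "set_integrable lebesgue Q (\<lambda>z. \<bar>a z - k\<bar>)"
    using emeasure_par_cyl_finite[of \<alpha> r t0 x0] by (intro set_integrable_abs_diff_const a) (auto simp: Q_def open_par_cyl)
  have "G \<ge> 0" unfolding G_def set_lebesgue_integral_def by (intro integral_nonneg_AE) auto
  have "q \<ge> 0" using \<open>h > 0\<close> \<open>r > 0\<close> \<open>N \<ge> 0\<close> by (simp add: q_def)
  have "(LINT z:Q|lebesgue. \<bar>a z - k\<bar>) = (\<integral>z. indicat_real Q z * \<bar>a' z - k\<bar> \<partial>lborel)"
  proof -
    have "AE z in lborel. z \<in> Q \<longrightarrow> indicat_real Q z * \<bar>a' z - k\<bar> = \<bar>a z - k\<bar>"
      using a'(4) by eventually_elim auto
    from integral_borel_representative[OF ak _ _ this, of "\<lambda>_. 1"] show ?thesis by simp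
  qed
  also have "\<dots> \<le> C * G + 9 * (q / c) * b"
  proof (rule integral_real_bounded)
    have "(\<integral>\<^sup>+z. ennreal (indicat_real Q z * \<bar>a' z - k\<bar>) \<partial>lborel)
      \<le> (\<integral>\<^sup>+z. indicator Q z * ennreal \<bar>a' z - m (fst z)\<bar> + indicator Q z * ennreal \<bar>m (fst z) - k\<bar> \<partial>lborel)"
    proof (intro nn_integral_mono)
      fix z
      have "ennreal \<bar>a' z - k\<bar> \<le> ennreal \<bar>a' z - m (fst z)\<bar> + ennreal \<bar>m (fst z) - k\<bar>"
        by (simp add: ennreal_plus[symmetric] ennreal_leI del: ennreal_plus)
      then show "ennreal (indicat_real Q z * \<bar>a' z - k\<bar>) \<le> indicator Q z * ennreal \<bar>a' z - m (fst z)\<bar> + indicator Q z * ennreal \<bar>m (fst z) - k\<bar>"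
        by (cases "z \<in> Q") auto
    qed
    also have "\<dots> = (\<integral>\<^sup>+z. indicator Q z * ennreal \<bar>a' z - m (fst z)\<bar> \<partial>lborel) + (\<integral>\<^sup>+z. indicator Q z * ennreal \<bar>m (fst z) - k\<bar> \<partial>lborel)"
      by (rule nn_integral_add) measurable
    also have "\<dots> \<le> ennreal (C * G) + ennreal (9 * (q / c) * b)"
      by (intro add_mono 1 2)
    also have "\<dots> = ennreal (C * G + 9 * (q / c) * b)"
      using \<open>C \<ge> 0\<close> \<open>G \<ge> 0\<close> \<open>q \<ge> 0\<close> \<open>c > 0\<close> \<open>b > 0\<close> by (intro ennreal_plus[symmetric]) auto
    finally show "(\<integral>\<^sup>+z. ennreal (indicat_real Q z * \<bar>a' z - k\<bar>) \<partial>lborel) \<le> ennreal (C * G + 9 * (q / c) * b)" .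
    show "0 \<le> C * G + 9 * (q / c) * b"
      using \<open>C \<ge> 0\<close> \<open>G \<ge> 0\<close> \<open>q \<ge> 0\<close> \<open>c > 0\<close> \<open>b > 0\<close> by auto
  qed
  \<comment> \<open>Only the ratio b/c survives, and the choice of cutoff bounds it by a constant
    depending on the dimension.\<close>
  also have "\<dots> = (b / c) * (2 * 2 ^ DIM('a) * r * G + 9 * q)"
    by (simp add: C_def algebra_simps add_divide_distrib)
  also have "\<dots> \<le> \<kappa> * (2 * 2 ^ DIM('a) * r * G + 9 * q)"
  proof (rule mult_right_mono)
    show "b / c \<le> \<kappa>" using bc \<open>c > 0\<close> by (simp add: field_simps)
    show "0 \<le> 2 * 2 ^ DIM('a) * r * G + 9 * q" using \<open>r > 0\<close> \<open>G \<ge> 0\<close> \<open>q \<ge> 0\<close> by simp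
  qed
  finally show ?thesis
    unfolding \<kappa>_def G_def q_def h_def by blast
qed

text \<open>The difference between the \<rho>-mean and \<open>k\<close> is the \<rho>-average of a -
  k. The sup bound on \<rho> makes it at most c0/|Q| times the integral of |a - k|. Integrated over
  \<open>Q\<close>, this constant costs the additional factor c0.\<close>

lemma weighted_mean_comparison:
  fixes a \<rho> :: "real \<times> 'a::euclidean_space \<Rightarrow> real"
  assumes Q: "Q \<in> sets lebesgue" "emeasure lebesgue Q < \<infinity>" "measure lebesgue Q > 0"
    and a: "set_integrable lebesgue Q a" and \<rho>: "set_integrable lebesgue Q \<rho>"
    and bound: "AE z in lebesgue. z \<in> Q \<longrightarrow> 0 \<le> \<rho> z \<and> \<rho> z \<le> c0 / measure lebesgue Q * (LINT w:Q|lebesgue. \<rho> w)"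
    and pos: "(LINT w:Q|lebesgue. \<rho> w) > 0"
  shows "(LINT z:Q|lebesgue. \<bar>a z - wmean Q \<rho> a\<bar>) \<le> (1 + c0) * (LINT z:Q|lebesgue. \<bar>a z - k\<bar>)"
proof -
  define R where "R = (LINT w:Q|lebesgue. \<rho> w)"
  define \<mu> where "\<mu> = measure lebesgue Q"
  define A where "A = (LINT z:Q|lebesgue. \<bar>a z - k\<bar>)"
  have RA: "R > 0" "\<mu> > 0" using pos Q by (auto simp: R_def \<mu>_def)
  \<comment> \<open>The assumed almost everywhere upper bound for \<rho>; its factor
    \<open>R\<close> cancels against the normalisation of the mean.\<close>
  define C where "C = c0 / \<mu> * R"
  define v where "v = (\<lambda>z. indicat_real Q z * (a z - k))"
  define s where "s = (\<lambda>z. indicat_real Q z * \<rho> z)"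
  have ci: "set_integrable lebesgue Q (\<lambda>z. d)" for d :: real
    using Q unfolding set_integrable_def by simp
  have v: "integrable lebesgue v"
    using set_integral_diff(1)[OF a ci[of k]] by (simp add: set_integrable_def v_def)
  have s: "integrable lebesgue s" "(\<integral>z. s z \<partial>lebesgue) = R"
    using \<rho> by (auto simp: set_integrable_def set_lebesgue_integral_def s_def R_def)
  have vs_le: "AE z in lebesgue. \<bar>v z * s z\<bar> \<le> C * \<bar>v z\<bar>"
    using bound
  proof eventually_elim
    case (elim z)
    have "\<bar>s z\<bar> \<le> C" if "z \<in> Q"
      using elim that by (simp add: s_def C_def \<mu>_def R_def)
    then show ?case
      by (cases "z \<in> Q") (auto simp: abs_mult v_def mult.commute[of _ "\<bar>s z\<bar>"] intro: mult_right_mono)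
  qed
  have vs: "integrable lebesgue (\<lambda>z. v z * s z)"
  proof (rule Bochner_Integration.integrable_bound)
    show "integrable lebesgue (\<lambda>z. C * \<bar>v z\<bar>)" using v by simp
    show "AE z in lebesgue. norm (v z * s z) \<le> norm (C * \<bar>v z\<bar>)"
      using vs_le by eventually_elim auto
  qed (use v s in auto)
  have A: "A = (\<integral>z. \<bar>v z\<bar> \<partial>lebesgue)"
    by (simp add: A_def v_def set_lebesgue_integral_def abs_mult)
  have "(LINT z:Q|lebesgue. a z * \<rho> z) = (\<integral>z. v z * s z + k * s z \<partial>lebesgue)"
    unfolding set_lebesgue_integral_def
    by (intro Bochner_Integration.integral_cong refl) (auto simp: v_def s_def indicator_def algebra_simps)
  also have "\<dots> = (\<integral>z. v z * s z \<partial>lebesgue) + k * R"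
    using vs s by simp
  finally have eq: "wmean Q \<rho> a - k = (\<integral>z. v z * s z \<partial>lebesgue) / R"
    using RA by (simp add: wmean_def R_def[symmetric] add_divide_distrib)
  have le: "\<bar>\<integral>z. v z * s z \<partial>lebesgue\<bar> \<le> C * A"
  proof -
    have "\<bar>\<integral>z. v z * s z \<partial>lebesgue\<bar> \<le> (\<integral>z. \<bar>v z * s z\<bar> \<partial>lebesgue)" by simp
    also have "\<dots> \<le> (\<integral>z. C * \<bar>v z\<bar> \<partial>lebesgue)"
      by (rule integral_mono_AE) (use vs v vs_le in auto)
    finally show ?thesis by (simp add: A)
  qed
  have w: "\<bar>wmean Q \<rho> a - k\<bar> \<le> c0 / \<mu> * A"
  proof -
    have "\<bar>wmean Q \<rho> a - k\<bar> \<le> C * A / R"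
      using eq le RA by (simp add: divide_right_mono)
    then show ?thesis using RA by (simp add: C_def)
  qed
  define d where "d = wmean Q \<rho> a"
  have "(LINT z:Q|lebesgue. \<bar>a z - d\<bar>) \<le> (LINT z:Q|lebesgue. \<bar>a z - k\<bar> + \<bar>d - k\<bar>)"
    by (intro set_integral_mono set_integral_add(1) set_integrable_abs_diff_const a ci Q) auto
  also have "\<dots> = A + (LINT z:Q|lebesgue. \<bar>d - k\<bar>)"
    unfolding A_def by (intro set_integral_add(2) set_integrable_abs_diff_const a ci Q)
  also have "(LINT z:Q|lebesgue. \<bar>d - k\<bar>) = \<mu> * \<bar>d - k\<bar>"
    using Q by (simp add: set_lebesgue_integral_def \<mu>_def)
  also have "\<dots> \<le> \<mu> * (c0 / \<mu> * A)"
    using w RA unfolding d_def by (intro mult_left_mono) auto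
  finally show ?thesis using RA by (simp add: A_def d_def algebra_simps)
qed

text \<open>The zero function belongs to \<open>FQ\<close>, so the supremum is not over the empty
  set, where it would be minus infinity. This allows a finite seminorm to be treated as a
  nonnegative real.\<close>

lemma NQ_dt_nonneg:
  assumes "\<alpha> > 0" "r > 0"
  shows "0 \<le> NQ_dt \<alpha> r t0 x0 a"
proof -
  have "test_fun (par_cyl \<alpha> r t0 x0) (\<lambda>z. 0)"
    unfolding test_fun_def using smooth_0 by (auto intro!: exI[of _ "{}"])
  then have "(\<lambda>z. (1 / 1) * 0) \<in> FQ \<alpha> r t0 x0"
    by (rule scaled_test_fun_in_FQ(1)[where ?L1.0 = 0 and ?L2.0 = 0 and ?L3.0 = 0])
      (use assms in \<open>auto simp: dt_def frechet_derivative_const\<close>)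
  then have "ereal (r / measure lebesgue (par_cyl \<alpha> r t0 x0) *
      \<bar>- (LINT z:par_cyl \<alpha> r t0 x0|lebesgue. a z * dt (\<lambda>z. (1 / 1) * 0) z)\<bar>) \<le> NQ_dt \<alpha> r t0 x0 a"
    unfolding NQ_dt_def by (rule SUP_upper)
  moreover have "0 \<le> ereal (r / measure lebesgue (par_cyl \<alpha> r t0 x0) *
      \<bar>- (LINT z:par_cyl \<alpha> r t0 x0|lebesgue. a z * dt (\<lambda>z. (1 / 1) * 0) z)\<bar>)"
    using assms by simp
  ultimately show ?thesis by (rule order_trans[rotated])
qed

theorem theorem2p8:
  fixes c0 :: real
  shows "\<exists>c::real. \<forall>(\<alpha>::real) (r::real) (t0::real) (x0::'a::euclidean_space)
            (\<rho>::real \<times> 'a \<Rightarrow> real) (a::real \<times> 'a \<Rightarrow> real) (g::real \<times> 'a \<Rightarrow> 'a).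
    \<alpha> > 0 \<longrightarrow> r > 0 \<longrightarrow>
    set_integrable lebesgue (par_cyl \<alpha> r t0 x0) \<rho> \<longrightarrow>
    (AE z in lebesgue. z \<in> par_cyl \<alpha> r t0 x0 \<longrightarrow> 0 \<le> \<rho> z \<and>
       \<rho> z \<le> c0 / measure lebesgue (par_cyl \<alpha> r t0 x0) *
              (LINT w:par_cyl \<alpha> r t0 x0|lebesgue. \<rho> w)) \<longrightarrow>
    (LINT w:par_cyl \<alpha> r t0 x0|lebesgue. \<rho> w) > 0 \<longrightarrow>
    L1_W11 {t0 - \<alpha> * r\<^sup>2 <..< t0 + \<alpha> * r\<^sup>2} (ball x0 r) a g \<longrightarrow>
    ereal (1 / measure lebesgue (par_cyl \<alpha> r t0 x0) *
       (LINT z:par_cyl \<alpha> r t0 x0|lebesgue. \<bar>(a z - wmean (par_cyl \<alpha> r t0 x0) \<rho> a) / r\<bar>))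
    \<le> ereal (c * (1 / measure lebesgue (par_cyl \<alpha> r t0 x0) *
       (LINT z:par_cyl \<alpha> r t0 x0|lebesgue. norm (g z))))
      + ereal (c * \<alpha>) * NQ_dt \<alpha> r t0 x0 a"
proof -
  \<comment> \<open>The gradient coefficient 2 2^n and the time coefficient 9 (3 + 16 n) are added,
    so that one constant serves both terms.\<close>
  define c1 :: real where "c1 = 16 / 9 * 4 ^ DIM('a) * (2 * 2 ^ DIM('a) + 9 * (3 + 16 * DIM('a)))"
  have "0 < 2 * 2 ^ DIM('a) + 9 * (3 + 16 * real DIM('a))" by (rule add_pos_nonneg) auto
  then have "c1 > 0" by (simp add: c1_def)
  \<comment> \<open>The absolute value makes \<open>c\<close> positive for every real
    \<open>c0\<close>; positivity is used when the seminorm is infinite.\<close>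
  define c where "c = (1 + \<bar>c0\<bar>) * c1"
  have "c > 0" using \<open>c1 > 0\<close> by (simp add: c_def)
  show ?thesis
  proof (intro exI[of _ c] allI impI)
    fix \<alpha> r t0 :: real and x0 :: 'a and \<rho> a :: "real \<times> 'a \<Rightarrow> real" and g :: "real \<times> 'a \<Rightarrow> 'a"
    let ?Q = "par_cyl \<alpha> r t0 x0" and ?N = "NQ_dt \<alpha> r t0 x0 a"
    assume "\<alpha> > 0" "r > 0" and \<rho>: "set_integrable lebesgue ?Q \<rho>"
      "AE z in lebesgue. z \<in> ?Q \<longrightarrow> 0 \<le> \<rho> z \<and> \<rho> z \<le> c0 / measure lebesgue ?Q * (LINT w:?Q|lebesgue. \<rho> w)"
      "(LINT w:?Q|lebesgue. \<rho> w) > 0"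
      and L1: "L1_W11 {t0 - \<alpha> * r\<^sup>2 <..< t0 + \<alpha> * r\<^sup>2} (ball x0 r) a g"
    define \<mu> where "\<mu> = measure lebesgue ?Q"
    have "\<mu> > 0"
      unfolding \<mu>_def measure_par_cyl[OF \<open>\<alpha> > 0\<close> \<open>r > 0\<close>]
      using \<open>\<alpha> > 0\<close> \<open>r > 0\<close> content_ball_pos[OF \<open>r > 0\<close>, of x0] by simp
    define G where "G = (LINT z:?Q|lebesgue. norm (g z))"
    have "G \<ge> 0" unfolding G_def set_lebesgue_integral_def by (intro integral_nonneg_AE) auto
    define osc where "osc = (LINT z:?Q|lebesgue. \<bar>a z - wmean ?Q \<rho> a\<bar>)"
    have Oeq: "(LINT z:?Q|lebesgue. \<bar>(a z - wmean ?Q \<rho> a) / r\<bar>) = osc / r"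
      using \<open>r > 0\<close> by (simp add: osc_def)
    have "ereal (1 / \<mu> * (osc / r)) \<le> ereal (c * (1 / \<mu> * G)) + ereal (c * \<alpha>) * ?N"
    proof (cases "?N = \<infinity>")
      case True
      then show ?thesis using \<open>c > 0\<close> \<open>\<alpha> > 0\<close> by simp
    next
      case False
      then obtain N where N: "?N = ereal N" "N \<ge> 0"
        using NQ_dt_nonneg[OF \<open>\<alpha> > 0\<close> \<open>r > 0\<close>, of t0 x0 a] by (cases ?N) auto
      obtain k where k: "(LINT z:?Q|lebesgue. \<bar>a z - k\<bar>) \<le> 16 / 9 * 4 ^ DIM('a) *
        (2 * 2 ^ DIM('a) * r * G + 9 * (\<mu> * (\<alpha> * r\<^sup>2) * (3 + 16 * DIM('a)) * N / r))"
        using parabolic_oscillation[OF \<open>\<alpha> > 0\<close> \<open>r > 0\<close> L1 _ N(2)] N(1) unfolding G_def \<mu>_def by auto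
      \<comment> \<open>One power of r in \<alpha> r^2 cancels, so both terms carry exactly one r,
        which the division by r in the statement removes.\<close>
      also have "\<dots> \<le> c1 * (r * G + \<mu> * \<alpha> * r * N)"
      proof -
        have "\<mu> * (\<alpha> * r\<^sup>2) * (3 + 16 * DIM('a)) * N / r = (3 + 16 * DIM('a)) * (\<mu> * \<alpha> * r * N)"
          using \<open>r > 0\<close> by (simp add: power2_eq_square)
        then have "2 * 2 ^ DIM('a) * r * G + 9 * (\<mu> * (\<alpha> * r\<^sup>2) * (3 + 16 * DIM('a)) * N / r)
          = (2 * 2 ^ DIM('a)) * (r * G) + (9 * (3 + 16 * DIM('a))) * (\<mu> * \<alpha> * r * N)" by simp
        also have "\<dots> \<le> (2 * 2 ^ DIM('a) + 9 * (3 + 16 * DIM('a))) * (r * G)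
            + (2 * 2 ^ DIM('a) + 9 * (3 + 16 * DIM('a))) * (\<mu> * \<alpha> * r * N)"
          using \<open>r > 0\<close> \<open>G \<ge> 0\<close> \<open>\<mu> > 0\<close> \<open>\<alpha> > 0\<close> N(2)
          by (intro add_mono mult_right_mono mult_nonneg_nonneg) auto
        finally show ?thesis unfolding c1_def mult.assoc[of "16 / 9 * 4 ^ DIM('a)"]
          by (intro mult_left_mono) (simp_all add: algebra_simps)
      qed
      finally have k': "(LINT z:?Q|lebesgue. \<bar>a z - k\<bar>) \<le> c1 * (r * G + \<mu> * \<alpha> * r * N)" .
      have a: "set_integrable lebesgue ?Q a" using L1 by (simp add: L1_W11_def par_cyl_def)
      have "osc \<le> (1 + c0) * (LINT z:?Q|lebesgue. \<bar>a z - k\<bar>)"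
        unfolding osc_def
        by (rule weighted_mean_comparison[OF _ emeasure_par_cyl_finite _ a \<rho>])
          (use \<open>\<mu> > 0\<close> in \<open>auto simp: \<mu>_def open_par_cyl\<close>)
      also have "\<dots> \<le> (1 + \<bar>c0\<bar>) * (c1 * (r * G + \<mu> * \<alpha> * r * N))"
      proof (rule mult_mono[OF _ k'])
        show "0 \<le> (LINT z:?Q|lebesgue. \<bar>a z - k\<bar>)"
          unfolding set_lebesgue_integral_def by (intro integral_nonneg_AE) auto
      qed auto
      also have "\<dots> = c * (r * G + \<mu> * \<alpha> * r * N)" by (simp add: c_def)
      finally have "1 / \<mu> * (osc / r) \<le> 1 / \<mu> * (c * (r * G + \<mu> * \<alpha> * r * N) / r)"
        using \<open>\<mu> > 0\<close> \<open>r > 0\<close> by (intro mult_left_mono divide_right_mono) auto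
      also have "\<dots> = c * (1 / \<mu> * G) + c * \<alpha> * N"
        using \<open>\<mu> > 0\<close> \<open>r > 0\<close> by (simp add: field_simps)
      finally show ?thesis unfolding N(1) by simp
    qed
    then show "ereal (1 / measure lebesgue ?Q * (LINT z:?Q|lebesgue. \<bar>(a z - wmean ?Q \<rho> a) / r\<bar>))
      \<le> ereal (c * (1 / measure lebesgue ?Q * (LINT z:?Q|lebesgue. norm (g z)))) + ereal (c * \<alpha>) * ?N"
      unfolding Oeq \<mu>_def G_def .
  qed
qed

end
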